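(* Let $S_1,S_2$ be finite inverse semigroups and $[S_1,S_2;U]$ an amalgam of inverse semigroups. Let $e\in E(S_1*_US_2)$ be $\mathcal{D}$-related in $S_1*_US_2$ to some idempotent $g\in S_i\setminus U$, $i\in\{1,2\}$, and suppose that $e$ is not $\mathcal{D}$-related in $S_1*_US_2$ to any idempotent of $U$. Then $$H_e^{S_1*_US_2}\simeq H_g^{S_i}.$$
   Context: An amalgam $[S_1,S_2;U]$ of inverse semigroups consists of inverse semigroups $S_1,S_2$ and an inverse semigroup $U$ embedded in both. $S_1*_US_2$ denotes the amalgamated free product in the category of inverse semigroups; $S_1$ and $S_2$ embed in it, with intersection $U$, and are identified with their images. $E(S)$ is the set of idempotents of $S$; $H_e^S$ is the maximal subgroup of $S$ with identity the idempotent $e$. *)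

theory Defs
  imports "HOL-Algebra.Group"
begin

section \<open>Inverse semigroups\<close>

text \<open>
  Semigroups are carried by the record type of HOL-Algebra's monoids, so that \<^const>\<open>hom\<close>,
  \<^const>\<open>mon\<close> and \<^const>\<open>is_iso\<close> are available; these depend on the carrier and the
  multiplication only. The field \<^const>\<open>one\<close> of a semigroup is never constrained or used.
  Semigroups are nonempty.
\<close>

locale inverse_semigroup =
  fixes S (structure)
  assumes nonempty: "carrier S \<noteq> {}"
    and m_closed: "\<lbrakk>x \<in> carrier S; y \<in> carrier S\<rbrakk> \<Longrightarrow> x \<otimes> y \<in> carrier S"
    and m_assoc: "\<lbrakk>x \<in> carrier S; y \<in> carrier S; z \<in> carrier S\<rbrakk> \<Longrightarrow> (x \<otimes> y) \<otimes> z = x \<otimes> (y \<otimes> z)"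
    and ex1_inverse: "x \<in> carrier S \<Longrightarrow> \<exists>!y. y \<in> carrier S \<and> x \<otimes> y \<otimes> x = x \<and> y \<otimes> x \<otimes> y = y"

definition sinv :: "('a, 'm) monoid_scheme \<Rightarrow> 'a \<Rightarrow> 'a" where
  "sinv S x = (THE y. y \<in> carrier S \<and> x \<otimes>\<^bsub>S\<^esub> y \<otimes>\<^bsub>S\<^esub> x = x \<and> y \<otimes>\<^bsub>S\<^esub> x \<otimes>\<^bsub>S\<^esub> y = y)"

definition idempotents :: "('a, 'm) monoid_scheme \<Rightarrow> 'a set" where
  "idempotents S = {e \<in> carrier S. e \<otimes>\<^bsub>S\<^esub> e = e}"

section \<open>Green's relations and maximal subgroups\<close>

text \<open>The one-sided ideals are the principal ones \<open>a S\<^sup>1\<close> and \<open>S\<^sup>1 a\<close>.\<close>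

definition greenR :: "('a, 'm) monoid_scheme \<Rightarrow> 'a rel" where
  "greenR S = {(a, b). a \<in> carrier S \<and> b \<in> carrier S \<and>
     insert a ((\<lambda>s. a \<otimes>\<^bsub>S\<^esub> s) ` carrier S) = insert b ((\<lambda>s. b \<otimes>\<^bsub>S\<^esub> s) ` carrier S)}"

definition greenL :: "('a, 'm) monoid_scheme \<Rightarrow> 'a rel" where
  "greenL S = {(a, b). a \<in> carrier S \<and> b \<in> carrier S \<and>
     insert a ((\<lambda>s. s \<otimes>\<^bsub>S\<^esub> a) ` carrier S) = insert b ((\<lambda>s. s \<otimes>\<^bsub>S\<^esub> b) ` carrier S)}"

definition greenH :: "('a, 'm) monoid_scheme \<Rightarrow> 'a rel" where
  "greenH S = greenL S \<inter> greenR S"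

definition greenD :: "('a, 'm) monoid_scheme \<Rightarrow> 'a rel" where
  "greenD S = greenL S O greenR S"

text \<open>
  The \<open>\<H>\<close>-class of an idempotent \<open>e\<close>, as a group with identity \<open>e\<close>. That it is
  a group, and the largest one with identity \<open>e\<close> inside \<open>S\<close>, is shown below.
\<close>

definition max_subgroup :: "('a, 'm) monoid_scheme \<Rightarrow> 'a \<Rightarrow> 'a monoid" where
  "max_subgroup S e = \<lparr>carrier = greenH S `` {e}, mult = mult S, one = e\<rparr>"

context inverse_semigroup
begin

lemma e_idem: "e \<in> carrier S \<Longrightarrow> e \<otimes> e = e \<Longrightarrow> x \<in> carrier S \<Longrightarrow> e \<otimes> (e \<otimes> x) = e \<otimes> x"
  by (simp flip: m_assoc)

lemma max_subgroup_iff: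
  assumes e: "e \<in> idempotents S"
  shows "x \<in> carrier (max_subgroup S e) \<longleftrightarrow>
    x \<in> carrier S \<and> e \<otimes> x = x \<and> x \<otimes> e = x \<and>
    (\<exists>y\<in>carrier S. e \<otimes> y = y \<and> y \<otimes> e = y \<and> x \<otimes> y = e \<and> y \<otimes> x = e)"
proof
  have eS: "e \<in> carrier S" and ee: "e \<otimes> e = e" using e by (auto simp: idempotents_def)
  { assume "x \<in> carrier (max_subgroup S e)"
    then have xS: "x \<in> carrier S"
      and R: "insert e ((\<lambda>s. e \<otimes> s) ` carrier S) = insert x ((\<lambda>s. x \<otimes> s) ` carrier S)"
      and L: "insert e ((\<lambda>s. s \<otimes> e) ` carrier S) = insert x ((\<lambda>s. s \<otimes> x) ` carrier S)"
      by (auto simp: max_subgroup_def greenH_def greenR_def greenL_def)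
    have "x \<in> insert e ((\<lambda>s. e \<otimes> s) ` carrier S)" using R by blast
    then have ex: "e \<otimes> x = x" using ee eS by (auto simp flip: m_assoc)
    have "x \<in> insert e ((\<lambda>s. s \<otimes> e) ` carrier S)" using L by blast
    then have xe: "x \<otimes> e = x" using ee eS by (auto simp: m_assoc)
    have "e \<in> insert x ((\<lambda>s. x \<otimes> s) ` carrier S)" using R by blast
    then obtain s where s: "s \<in> carrier S" "x \<otimes> s = e" using ee eS by auto
    have "e \<in> insert x ((\<lambda>s. s \<otimes> x) ` carrier S)" using L by blast
    then obtain t where t: "t \<in> carrier S" "t \<otimes> x = e" using ee eS by auto
    define y where "y = e \<otimes> s \<otimes> e"
    define z where "z = e \<otimes> t \<otimes> e"
    have yS: "y \<in> carrier S" and zS: "z \<in> carrier S"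
      using s t eS by (auto simp: y_def z_def intro!: m_closed)
    have ey: "e \<otimes> y = y" "y \<otimes> e = y" "e \<otimes> z = z" "z \<otimes> e = z"
      using s(1) t(1) eS ee e_idem[OF eS ee] unfolding y_def z_def by (simp_all add: m_assoc m_closed)
    have xy: "x \<otimes> y = e"
    proof -
      have "x \<otimes> y = ((x \<otimes> e) \<otimes> s) \<otimes> e" using xS s(1) eS by (simp add: y_def m_assoc m_closed)
      then show ?thesis using xe s ee by simp
    qed
    have zx: "z \<otimes> x = e"
    proof -
      have "z \<otimes> x = e \<otimes> (t \<otimes> (e \<otimes> x))" using xS t(1) eS by (simp add: z_def m_assoc m_closed)
      then show ?thesis using ex t ee by simp
    qed
    have "z = z \<otimes> (x \<otimes> y)" using xy ey by simp
    also have "\<dots> = y" using zx ey xS yS zS by (simp flip: m_assoc)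
    finally have "z = y" .
    with xS ex xe yS ey xy zx
    show "x \<in> carrier S \<and> e \<otimes> x = x \<and> x \<otimes> e = x \<and>
      (\<exists>y\<in>carrier S. e \<otimes> y = y \<and> y \<otimes> e = y \<and> x \<otimes> y = e \<and> y \<otimes> x = e)" by blast }
  { assume "x \<in> carrier S \<and> e \<otimes> x = x \<and> x \<otimes> e = x \<and>
      (\<exists>y\<in>carrier S. e \<otimes> y = y \<and> y \<otimes> e = y \<and> x \<otimes> y = e \<and> y \<otimes> x = e)"
    then obtain y where h: "x \<in> carrier S" "e \<otimes> x = x" "x \<otimes> e = x" "y \<in> carrier S"
      "x \<otimes> y = e" "y \<otimes> x = e" by blast
    have a1: "e \<otimes> s = x \<otimes> (y \<otimes> s)" "x \<otimes> s = e \<otimes> (x \<otimes> s)"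
      "s \<otimes> e = (s \<otimes> y) \<otimes> x" "s \<otimes> x = (s \<otimes> x) \<otimes> e" if "s \<in> carrier S" for s
      using h eS that by (simp_all add: m_assoc[symmetric]) (simp_all add: m_assoc)
    have "insert e ((\<lambda>s. e \<otimes> s) ` carrier S) = insert x ((\<lambda>s. x \<otimes> s) ` carrier S)"
    proof (intro equalityI subsetI)
      fix z assume "z \<in> insert e ((\<lambda>s. e \<otimes> s) ` carrier S)"
      then obtain s where "s \<in> carrier S" "z = e \<otimes> s" using eS ee[symmetric] by blast
      then show "z \<in> insert x ((\<lambda>s. x \<otimes> s) ` carrier S)"
        using a1(1)[of s] h m_closed by (intro insertI2 image_eqI[where x = "y \<otimes> s"]) auto
    next
      fix z assume "z \<in> insert x ((\<lambda>s. x \<otimes> s) ` carrier S)"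
      then obtain s where "s \<in> carrier S" "z = x \<otimes> s" using eS h(3)[symmetric] by blast
      then show "z \<in> insert e ((\<lambda>s. e \<otimes> s) ` carrier S)"
        using a1(2)[of s] h m_closed by (intro insertI2 image_eqI[where x = "x \<otimes> s"]) auto
    qed
    moreover have "insert e ((\<lambda>s. s \<otimes> e) ` carrier S) = insert x ((\<lambda>s. s \<otimes> x) ` carrier S)"
    proof (intro equalityI subsetI)
      fix z assume "z \<in> insert e ((\<lambda>s. s \<otimes> e) ` carrier S)"
      then obtain s where "s \<in> carrier S" "z = s \<otimes> e" using eS ee[symmetric] by blast
      then show "z \<in> insert x ((\<lambda>s. s \<otimes> x) ` carrier S)"
        using a1(3)[of s] h m_closed by (intro insertI2 image_eqI[where x = "s \<otimes> y"]) auto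
    next
      fix z assume "z \<in> insert x ((\<lambda>s. s \<otimes> x) ` carrier S)"
      then obtain s where "s \<in> carrier S" "z = s \<otimes> x" using eS h(2)[symmetric] by blast
      then show "z \<in> insert e ((\<lambda>s. s \<otimes> e) ` carrier S)"
        using a1(4)[of s] h m_closed by (intro insertI2 image_eqI[where x = "s \<otimes> x"]) auto
    qed
    ultimately show "x \<in> carrier (max_subgroup S e)"
      using h eS by (auto simp: max_subgroup_def greenH_def greenR_def greenL_def) }
qed

lemma group_max_subgroup:
  assumes e: "e \<in> idempotents S"
  shows "group (max_subgroup S e)"
proof -
  have eS: "e \<in> carrier S" and ee: "e \<otimes> e = e" using e by (auto simp: idempotents_def)
  have sel: "mult (max_subgroup S e) = mult S" "one (max_subgroup S e) = e"
    by (auto simp: max_subgroup_def)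
  note I = max_subgroup_iff[OF e]
  show ?thesis
  proof (rule groupI, unfold sel)
    fix x y assume "x \<in> carrier (max_subgroup S e)" "y \<in> carrier (max_subgroup S e)"
    then obtain x' y' where h: "x \<in> carrier S" "e \<otimes> x = x" "x \<otimes> e = x" "y \<in> carrier S"
      "e \<otimes> y = y" "y \<otimes> e = y" "x' \<in> carrier S" "e \<otimes> x' = x'" "x' \<otimes> e = x'" "y' \<in> carrier S"
      "e \<otimes> y' = y'" "y' \<otimes> e = y'" "x \<otimes> x' = e" "x' \<otimes> x = e" "y \<otimes> y' = e" "y' \<otimes> y = e"
      unfolding I by blast
    note S = h(1,4,7,10)
    have "(x \<otimes> y) \<otimes> (y' \<otimes> x') = x \<otimes> ((y \<otimes> y') \<otimes> x')" using S by (simp add: m_assoc m_closed)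
    then have 1: "(x \<otimes> y) \<otimes> (y' \<otimes> x') = e" using h by simp
    have "(y' \<otimes> x') \<otimes> (x \<otimes> y) = y' \<otimes> ((x' \<otimes> x) \<otimes> y)" using S by (simp add: m_assoc m_closed)
    then have 2: "(y' \<otimes> x') \<otimes> (x \<otimes> y) = e" using h by simp
    have 3: "e \<otimes> (x \<otimes> y) = x \<otimes> y" "(x \<otimes> y) \<otimes> e = x \<otimes> y"
      "e \<otimes> (y' \<otimes> x') = y' \<otimes> x'" "(y' \<otimes> x') \<otimes> e = y' \<otimes> x'"
      using h eS by (simp_all add: m_assoc) (simp_all add: m_assoc[symmetric])
    show "x \<otimes> y \<in> carrier (max_subgroup S e)"
      unfolding I using 1 2 3 h m_closed by blast
  next
    show "e \<in> carrier (max_subgroup S e)" unfolding I using eS ee by blast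
  next
    fix x y z
    assume "x \<in> carrier (max_subgroup S e)" "y \<in> carrier (max_subgroup S e)"
      "z \<in> carrier (max_subgroup S e)"
    then show "x \<otimes> y \<otimes> z = x \<otimes> (y \<otimes> z)" unfolding I by (simp add: m_assoc)
  next
    fix x assume "x \<in> carrier (max_subgroup S e)"
    then show "e \<otimes> x = x" unfolding I by simp
  next
    fix x assume "x \<in> carrier (max_subgroup S e)"
    then show "\<exists>y\<in>carrier (max_subgroup S e). y \<otimes> x = e" unfolding Bex_def I by blast
  qed
qed

lemma max_subgroup_greatest:
  assumes e: "e \<in> idempotents S" and G: "G \<subseteq> carrier S"
    and grp: "group \<lparr>carrier = G, mult = mult S, one = e\<rparr>"
  shows "G \<subseteq> carrier (max_subgroup S e)"
proof
  interpret G: group "\<lparr>carrier = G, mult = mult S, one = e\<rparr>" by (fact grp)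
  fix x assume x: "x \<in> G"
  obtain y where "y \<in> G" "x \<otimes> y = e" "y \<otimes> x = e"
    using G.l_inv_ex[of x] G.r_inv_ex[of x] G.inv_unique x
    by simp (metis G.inv_unique partial_object.select_convs(1) monoid.select_convs)
  moreover have "e \<otimes> z = z" "z \<otimes> e = z" if "z \<in> G" for z
    using that G.l_one[of z] G.r_one[of z] by auto
  ultimately show "x \<in> carrier (max_subgroup S e)"
    unfolding max_subgroup_iff[OF e] using x G by blast
qed

end

lemma inverse_semigroupI:
  fixes S (structure)
  assumes nonempty: "carrier S \<noteq> {}"
    and closed: "\<And>x y. x \<in> carrier S \<Longrightarrow> y \<in> carrier S \<Longrightarrow> x \<otimes> y \<in> carrier S"
    and assoc: "\<And>x y z. x \<in> carrier S \<Longrightarrow> y \<in> carrier S \<Longrightarrow> z \<in> carrier S \<Longrightarrow>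
      (x \<otimes> y) \<otimes> z = x \<otimes> (y \<otimes> z)"
    and R_ex: "\<And>x. x \<in> carrier S \<Longrightarrow> \<exists>y\<in>carrier S. R x y"
    and R_sym: "\<And>x y. R x y \<Longrightarrow> R y x"
    and R_inv: "\<And>x y. R x y \<Longrightarrow> x \<otimes> (y \<otimes> x) = x"
    and R_comm: "\<And>x x' y y'. R x x' \<Longrightarrow> R y y' \<Longrightarrow> (x \<otimes> x') \<otimes> (y \<otimes> y') = (y \<otimes> y') \<otimes> (x \<otimes> x')"
  shows "inverse_semigroup S"
proof -
  have idem: "\<exists>x x'. R x x' \<and> e = x \<otimes> x'" if e: "e \<in> carrier S" "e \<otimes> e = e" for e
  proof -
    obtain f where f: "f \<in> carrier S" "R e f" using R_ex e by blast
    have efe: "e \<otimes> (f \<otimes> e) = e" and fef: "f \<otimes> (e \<otimes> f) = f"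
      using R_inv f R_sym by blast+
    define p q where "p = e \<otimes> f" and "q = f \<otimes> e"
    have pq: "p \<in> carrier S" "q \<in> carrier S" using e f closed by (auto simp: p_def q_def)
    have comm: "p \<otimes> q = q \<otimes> p" unfolding p_def q_def using R_comm f R_sym by blast
    have pp: "p \<otimes> p = p" and qq: "q \<otimes> q = q"
      using e f efe fef by (simp_all add: p_def q_def assoc closed)
    have "q \<otimes> p = f \<otimes> ((e \<otimes> e) \<otimes> f)" using e(1) f by (simp add: p_def q_def assoc closed)
    then have qp: "f = q \<otimes> p" using e fef by simp
    have "f \<otimes> f = (q \<otimes> p) \<otimes> (p \<otimes> q)" using qp comm by simp
    also have "\<dots> = q \<otimes> ((p \<otimes> p) \<otimes> q)" using pq by (simp add: assoc closed)
    also have "\<dots> = q \<otimes> (q \<otimes> p)" using pp comm by simp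
    also have "\<dots> = f" using qq qp pq by (simp flip: assoc)
    finally have ff: "f \<otimes> f = f" .
    have "e = (e \<otimes> f) \<otimes> (f \<otimes> e)"
    proof -
      have "(e \<otimes> f) \<otimes> (f \<otimes> e) = e \<otimes> ((f \<otimes> f) \<otimes> e)" using e(1) f(1) by (simp add: assoc closed)
      then show ?thesis using ff efe by simp
    qed
    then have "e = p \<otimes> q" by (simp add: p_def q_def)
    then have "e = f" using comm qp by simp
    then have "R e e" using f by simp
    then show ?thesis using e by metis
  qed
  have comm: "e \<otimes> f = f \<otimes> e"
    if "e \<in> carrier S" "e \<otimes> e = e" "f \<in> carrier S" "f \<otimes> f = f" for e f
    using idem[OF that(1,2)] idem[OF that(3,4)] R_comm by metis
  show ?thesis
  proof (unfold_locales, fact nonempty)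
    fix x assume x: "x \<in> carrier S"
    obtain y where y: "y \<in> carrier S" "x \<otimes> (y \<otimes> x) = x" "y \<otimes> (x \<otimes> y) = y"
      using R_ex R_inv R_sym x by meson
    have "z = y" if z: "z \<in> carrier S" "x \<otimes> (z \<otimes> x) = x" "z \<otimes> (x \<otimes> z) = z" for z
    proof -
      have idem: "(x \<otimes> y) \<otimes> (x \<otimes> y) = x \<otimes> y" "(y \<otimes> x) \<otimes> (y \<otimes> x) = y \<otimes> x"
        "(x \<otimes> z) \<otimes> (x \<otimes> z) = x \<otimes> z" "(z \<otimes> x) \<otimes> (z \<otimes> x) = z \<otimes> x"
        using x y z by (simp_all add: assoc closed)
      have c1: "(y \<otimes> x) \<otimes> (z \<otimes> x) = (z \<otimes> x) \<otimes> (y \<otimes> x)"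
        and c2: "(x \<otimes> y) \<otimes> (x \<otimes> z) = (x \<otimes> z) \<otimes> (x \<otimes> y)"
        using comm idem x y z closed by blast+
      have "y = y \<otimes> ((x \<otimes> (z \<otimes> x)) \<otimes> y)" using y z by simp
      also have "\<dots> = ((y \<otimes> x) \<otimes> (z \<otimes> x)) \<otimes> y" using x y(1) z(1) by (simp add: assoc closed)
      also have "\<dots> = z \<otimes> ((x \<otimes> (y \<otimes> x)) \<otimes> y)"
        unfolding c1 using x y(1) z(1) by (simp add: assoc closed)
      also have "\<dots> = z \<otimes> (x \<otimes> y)" using y by simp
      finally have 1: "y = z \<otimes> (x \<otimes> y)" .
      have "z = z \<otimes> ((x \<otimes> (y \<otimes> x)) \<otimes> z)" using y z by simp
      also have "\<dots> = z \<otimes> ((x \<otimes> y) \<otimes> (x \<otimes> z))" using x y(1) z(1) by (simp add: assoc closed)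
      also have "\<dots> = (z \<otimes> (x \<otimes> z)) \<otimes> (x \<otimes> y)"
        unfolding c2 using x y(1) z(1) by (simp add: assoc closed)
      also have "\<dots> = y" using z 1 by simp
      finally show ?thesis .
    qed
    then show "\<exists>!y. y \<in> carrier S \<and> x \<otimes> y \<otimes> x = x \<and> y \<otimes> x \<otimes> y = y"
      using x y by (metis assoc)
  qed (use closed assoc in auto)
qed

context inverse_semigroup
begin

lemma sinv:
  assumes "x \<in> carrier S"
  shows sinv_closed: "sinv S x \<in> carrier S"
    and inv1: "x \<otimes> (sinv S x \<otimes> x) = x"
    and inv2: "sinv S x \<otimes> (x \<otimes> sinv S x) = sinv S x"
  using theI'[OF ex1_inverse[OF assms]] assms unfolding sinv_def by (auto simp: m_assoc)

lemma sinv_unique: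
  assumes "x \<in> carrier S" "y \<in> carrier S" "x \<otimes> (y \<otimes> x) = x" "y \<otimes> (x \<otimes> y) = y"
  shows "sinv S x = y"
  using ex1_inverse[OF assms(1)] sinv[OF assms(1)] assms by (metis m_assoc)

lemma sinv_sinv: "x \<in> carrier S \<Longrightarrow> sinv S (sinv S x) = x"
  using sinv sinv_unique by blast

lemma sinv_idem: "e \<in> carrier S \<Longrightarrow> e \<otimes> e = e \<Longrightarrow> sinv S e = e"
  by (rule sinv_unique) auto

lemma mult_idem:
  assumes e: "e \<in> carrier S" "e \<otimes> e = e" and f: "f \<in> carrier S" "f \<otimes> f = f"
  shows "(e \<otimes> f) \<otimes> (e \<otimes> f) = e \<otimes> f"
proof -
  define x where "x = sinv S (e \<otimes> f)"
  have xS: "x \<in> carrier S" using e f by (simp add: x_def m_closed sinv)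
  have x1: "(e \<otimes> f) \<otimes> (x \<otimes> (e \<otimes> f)) = e \<otimes> f" and x2: "x \<otimes> ((e \<otimes> f) \<otimes> x) = x"
    using inv1[of "e \<otimes> f"] inv2[of "e \<otimes> f"] e f by (simp_all add: x_def m_closed)
  note idems = e_idem[OF e] e_idem[OF f]
  have x1': "e \<otimes> (f \<otimes> (x \<otimes> (e \<otimes> f))) = e \<otimes> f"
    using x1 e(1) f(1) xS by (simp add: m_assoc m_closed)
  have x2': "x \<otimes> (e \<otimes> (f \<otimes> x)) = x" using x2 e(1) f(1) xS by (simp add: m_assoc m_closed)
  have x3: "x \<otimes> (e \<otimes> (f \<otimes> (x \<otimes> z))) = x \<otimes> z" if "z \<in> carrier S" for z
  proof -
    have "x \<otimes> (e \<otimes> (f \<otimes> (x \<otimes> z))) = (x \<otimes> (e \<otimes> (f \<otimes> x))) \<otimes> z"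
      using e(1) f(1) xS that by (simp add: m_assoc m_closed)
    then show ?thesis using x2' by simp
  qed
  have fxe: "x = f \<otimes> (x \<otimes> e)"
    unfolding x_def
  proof (rule sinv_unique, fold x_def)
    show "e \<otimes> f \<otimes> (f \<otimes> (x \<otimes> e) \<otimes> (e \<otimes> f)) = e \<otimes> f"
      using e(1) f(1) xS idems x1' by (simp add: m_assoc m_closed)
    show "f \<otimes> (x \<otimes> e) \<otimes> (e \<otimes> f \<otimes> (f \<otimes> (x \<otimes> e))) = f \<otimes> (x \<otimes> e)"
      using e(1) f(1) xS idems x3 by (simp add: m_assoc m_closed)
  qed (use e f xS m_closed in auto)
  have "x \<otimes> x = (f \<otimes> (x \<otimes> e)) \<otimes> (f \<otimes> (x \<otimes> e))" using fxe by simp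
  also have "\<dots> = f \<otimes> (x \<otimes> e)"
    using e(1) f(1) xS x3 by (simp add: m_assoc m_closed)
  finally have xx: "x \<otimes> x = x" using fxe by simp
  have "sinv S x = e \<otimes> f" using e f by (simp add: x_def sinv_sinv m_closed)
  then have "e \<otimes> f = x" using sinv_idem xx xS by simp
  then show ?thesis using xx by simp
qed

lemma idem_comm:
  assumes e: "e \<in> carrier S" "e \<otimes> e = e" and f: "f \<in> carrier S" "f \<otimes> f = f"
  shows "e \<otimes> f = f \<otimes> e"
proof -
  have 1: "(e \<otimes> f) \<otimes> (e \<otimes> f) = e \<otimes> f" and 2: "(f \<otimes> e) \<otimes> (f \<otimes> e) = f \<otimes> e"
    using mult_idem e f by blast+
  note idems = e_idem[OF e] e_idem[OF f]
  have "sinv S (e \<otimes> f) = f \<otimes> e"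
    using e f idems 1 2 by (intro sinv_unique) (simp_all add: m_assoc m_closed)
  then show ?thesis using sinv_idem[OF _ 1] e f by (simp add: m_closed)
qed

lemma sinv_mult:
  assumes x: "x \<in> carrier S" and y: "y \<in> carrier S"
  shows "sinv S (x \<otimes> y) = sinv S y \<otimes> sinv S x"
proof (rule sinv_unique)
  define a b where "a = sinv S x" and "b = sinv S y"
  have ab: "a \<in> carrier S" "b \<in> carrier S" using x y sinv by (auto simp: a_def b_def)
  have i: "x \<otimes> (a \<otimes> x) = x" "a \<otimes> (x \<otimes> a) = a" "y \<otimes> (b \<otimes> y) = y" "b \<otimes> (y \<otimes> b) = b"
    using x y inv1 inv2 by (auto simp: a_def b_def)
  have c: "(a \<otimes> x) \<otimes> (y \<otimes> b) = (y \<otimes> b) \<otimes> (a \<otimes> x)"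
    using x y ab i by (intro idem_comm) (simp_all add: m_assoc m_closed)
  have "(x \<otimes> y) \<otimes> ((b \<otimes> a) \<otimes> (x \<otimes> y)) = x \<otimes> (((y \<otimes> b) \<otimes> (a \<otimes> x)) \<otimes> y)"
    using x y ab by (simp add: m_assoc m_closed)
  also have "\<dots> = (x \<otimes> (a \<otimes> x)) \<otimes> (y \<otimes> (b \<otimes> y))"
    unfolding c[symmetric] using x y ab by (simp add: m_assoc m_closed)
  finally show "(x \<otimes> y) \<otimes> ((sinv S y \<otimes> sinv S x) \<otimes> (x \<otimes> y)) = x \<otimes> y"
    unfolding i by (simp add: a_def b_def)
  have "(b \<otimes> a) \<otimes> ((x \<otimes> y) \<otimes> (b \<otimes> a)) = b \<otimes> (((a \<otimes> x) \<otimes> (y \<otimes> b)) \<otimes> a)"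
    using x y ab by (simp add: m_assoc m_closed)
  also have "\<dots> = (b \<otimes> (y \<otimes> b)) \<otimes> (a \<otimes> (x \<otimes> a))"
    unfolding c using x y ab by (simp add: m_assoc m_closed)
  finally show "(sinv S y \<otimes> sinv S x) \<otimes> ((x \<otimes> y) \<otimes> (sinv S y \<otimes> sinv S x)) = sinv S y \<otimes> sinv S x"
    unfolding i by (simp add: a_def b_def)
qed (use x y m_closed sinv in auto)

end

lemma hom_sinv:
  assumes S: "inverse_semigroup S" and T: "inverse_semigroup T"
    and h: "h \<in> hom S T" and x: "x \<in> carrier S"
  shows "h (sinv S x) = sinv T (h x)"
proof -
  interpret S: inverse_semigroup S by fact
  interpret T: inverse_semigroup T by fact
  have c: "x \<in> carrier S" "sinv S x \<in> carrier S" using x S.sinv by auto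
  have hm: "h (a \<otimes>\<^bsub>S\<^esub> b) = h a \<otimes>\<^bsub>T\<^esub> h b" if "a \<in> carrier S" "b \<in> carrier S" for a b
    using h that by (auto simp: hom_def)
  show ?thesis
    by (rule T.sinv_unique[symmetric])
      (use c h S.inv1[OF x] S.inv2[OF x] S.m_closed in \<open>auto simp: hom_in_carrier simp flip: hm\<close>)
qed

section \<open>Amalgams and their amalgamated free product\<close>

text \<open>An amalgam \<open>[S1, S2; U]\<close>, the embeddings of \<open>U\<close> being \<open>\<phi>1\<close> and \<open>\<phi>2\<close>.\<close>

locale inverse_semigroup_amalgam =
  S1: inverse_semigroup S1 + S2: inverse_semigroup S2 + U: inverse_semigroup U
  for S1 :: "('a, 'm) monoid_scheme" and S2 :: "('b, 'n) monoid_scheme"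
    and U :: "('c, 'k) monoid_scheme" +
  fixes \<phi>1 :: "'c \<Rightarrow> 'a" and \<phi>2 :: "'c \<Rightarrow> 'b"
  assumes emb1: "\<phi>1 \<in> mon U S1" and emb2: "\<phi>2 \<in> mon U S2"

text \<open>
  The amalgamated free product is presented as an inverse semigroup by the generators
  \<open>S1 \<uplus> S2\<close> subject to the multiplication tables of \<open>S1\<close> and \<open>S2\<close> and the identifications
  \<open>\<phi>1 u = \<phi>2 u\<close>. The formal inverse of a letter is taken to be its inverse in \<open>S1\<close> or \<open>S2\<close>, so
  words in the letters of \<open>S1 \<uplus> S2\<close> suffice.
\<close>

type_synonym ('a, 'b) word = "('a + 'b) list"

definition words :: "('a, 'm) monoid_scheme \<Rightarrow> ('b, 'n) monoid_scheme \<Rightarrow> ('a, 'b) word set" where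
  "words S1 S2 = {w. w \<noteq> [] \<and> set w \<subseteq> carrier S1 <+> carrier S2}"

definition word_inv ::
    "('a, 'm) monoid_scheme \<Rightarrow> ('b, 'n) monoid_scheme \<Rightarrow> ('a, 'b) word \<Rightarrow> ('a, 'b) word" where
  "word_inv S1 S2 w = rev (map (map_sum (sinv S1) (sinv S2)) w)"

text \<open>The rules \<open>vagner\<close> and \<open>vagner_comm\<close> generate the Vagner congruence.\<close>

inductive_set amalg_cong ::
    "('a, 'm) monoid_scheme \<Rightarrow> ('b, 'n) monoid_scheme \<Rightarrow> ('c, 'k) monoid_scheme \<Rightarrow>
     ('c \<Rightarrow> 'a) \<Rightarrow> ('c \<Rightarrow> 'b) \<Rightarrow> ('a, 'b) word rel"
  for S1 S2 U \<phi>1 \<phi>2 where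
  refl: "w \<in> words S1 S2 \<Longrightarrow> (w, w) \<in> amalg_cong S1 S2 U \<phi>1 \<phi>2"
| sym: "(v, w) \<in> amalg_cong S1 S2 U \<phi>1 \<phi>2 \<Longrightarrow> (w, v) \<in> amalg_cong S1 S2 U \<phi>1 \<phi>2"
| trans: "(u, v) \<in> amalg_cong S1 S2 U \<phi>1 \<phi>2 \<Longrightarrow> (v, w) \<in> amalg_cong S1 S2 U \<phi>1 \<phi>2 \<Longrightarrow>
    (u, w) \<in> amalg_cong S1 S2 U \<phi>1 \<phi>2"
| append: "(v, v') \<in> amalg_cong S1 S2 U \<phi>1 \<phi>2 \<Longrightarrow> (w, w') \<in> amalg_cong S1 S2 U \<phi>1 \<phi>2 \<Longrightarrow>
    (v @ w, v' @ w') \<in> amalg_cong S1 S2 U \<phi>1 \<phi>2"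
| vagner: "w \<in> words S1 S2 \<Longrightarrow> (w @ word_inv S1 S2 w @ w, w) \<in> amalg_cong S1 S2 U \<phi>1 \<phi>2"
| vagner_comm: "v \<in> words S1 S2 \<Longrightarrow> w \<in> words S1 S2 \<Longrightarrow>
    (v @ word_inv S1 S2 v @ w @ word_inv S1 S2 w, w @ word_inv S1 S2 w @ v @ word_inv S1 S2 v)
      \<in> amalg_cong S1 S2 U \<phi>1 \<phi>2"
| mult1: "s \<in> carrier S1 \<Longrightarrow> t \<in> carrier S1 \<Longrightarrow>
    ([Inl s, Inl t], [Inl (s \<otimes>\<^bsub>S1\<^esub> t)]) \<in> amalg_cong S1 S2 U \<phi>1 \<phi>2"
| mult2: "s \<in> carrier S2 \<Longrightarrow> t \<in> carrier S2 \<Longrightarrow>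
    ([Inr s, Inr t], [Inr (s \<otimes>\<^bsub>S2\<^esub> t)]) \<in> amalg_cong S1 S2 U \<phi>1 \<phi>2"
| amalg: "u \<in> carrier U \<Longrightarrow> ([Inl (\<phi>1 u)], [Inr (\<phi>2 u)]) \<in> amalg_cong S1 S2 U \<phi>1 \<phi>2"

definition amalg_product ::
    "('a, 'm) monoid_scheme \<Rightarrow> ('b, 'n) monoid_scheme \<Rightarrow> ('c, 'k) monoid_scheme \<Rightarrow>
     ('c \<Rightarrow> 'a) \<Rightarrow> ('c \<Rightarrow> 'b) \<Rightarrow> ('a, 'b) word set monoid" where
  "amalg_product S1 S2 U \<phi>1 \<phi>2 =
    \<lparr>carrier = words S1 S2 // amalg_cong S1 S2 U \<phi>1 \<phi>2,
     mult = (\<lambda>X Y. amalg_cong S1 S2 U \<phi>1 \<phi>2 `` {x @ y | x y. x \<in> X \<and> y \<in> Y}),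
     one = undefined\<rparr>"

definition amalg_inj1 ::
    "('a, 'm) monoid_scheme \<Rightarrow> ('b, 'n) monoid_scheme \<Rightarrow> ('c, 'k) monoid_scheme \<Rightarrow>
     ('c \<Rightarrow> 'a) \<Rightarrow> ('c \<Rightarrow> 'b) \<Rightarrow> 'a \<Rightarrow> ('a, 'b) word set" where
  "amalg_inj1 S1 S2 U \<phi>1 \<phi>2 s = amalg_cong S1 S2 U \<phi>1 \<phi>2 `` {[Inl s]}"

definition amalg_inj2 ::
    "('a, 'm) monoid_scheme \<Rightarrow> ('b, 'n) monoid_scheme \<Rightarrow> ('c, 'k) monoid_scheme \<Rightarrow>
     ('c \<Rightarrow> 'a) \<Rightarrow> ('c \<Rightarrow> 'b) \<Rightarrow> 'b \<Rightarrow> ('a, 'b) word set" where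
  "amalg_inj2 S1 S2 U \<phi>1 \<phi>2 s = amalg_cong S1 S2 U \<phi>1 \<phi>2 `` {[Inr s]}"

text \<open>
  The construction yields an inverse semigroup, and it is the pushout of \<open>\<phi>1\<close> and \<open>\<phi>2\<close> among
  inverse semigroups (of any type).
\<close>

lemma word_inv_Cons:
  "word_inv S1 S2 (x # w) = word_inv S1 S2 w @ [map_sum (sinv S1) (sinv S2) x]"
  by (simp add: word_inv_def)

context inverse_semigroup_amalgam
begin

abbreviation "W \<equiv> words S1 S2"
abbreviation "C \<equiv> amalg_cong S1 S2 U \<phi>1 \<phi>2"
abbreviation "P \<equiv> amalg_product S1 S2 U \<phi>1 \<phi>2"
abbreviation "\<iota>1 \<equiv> amalg_inj1 S1 S2 U \<phi>1 \<phi>2"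
abbreviation "\<iota>2 \<equiv> amalg_inj2 S1 S2 U \<phi>1 \<phi>2"

lemma words_append: "v \<in> W \<Longrightarrow> w \<in> W \<Longrightarrow> v @ w \<in> W"
  by (auto simp: words_def)

lemma word_inv_words: "w \<in> W \<Longrightarrow> word_inv S1 S2 w \<in> W"
  by (fastforce simp: words_def word_inv_def intro: S1.sinv_closed S2.sinv_closed)

lemma word_inv_word_inv: "w \<in> W \<Longrightarrow> word_inv S1 S2 (word_inv S1 S2 w) = w"
proof -
  assume w: "w \<in> W"
  have "map (map_sum (sinv S1) (sinv S2) \<circ> map_sum (sinv S1) (sinv S2)) w = w"
    by (rule map_idI) (use w in \<open>auto simp: words_def S1.sinv_sinv S2.sinv_sinv\<close>)
  then show ?thesis by (simp add: word_inv_def rev_map)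
qed

lemma cong_words: "(v, w) \<in> C \<Longrightarrow> v \<in> W \<and> w \<in> W"
proof (induction rule: amalg_cong.induct)
  case (mult1 s t)
  then show ?case by (auto simp: words_def S1.m_closed)
next
  case (mult2 s t)
  then show ?case by (auto simp: words_def S2.m_closed)
next
  case (amalg u)
  then show ?case using emb1 emb2 by (auto simp: words_def mon_def hom_in_carrier)
qed (auto intro: words_append word_inv_words)

lemma equiv_cong: "equiv W C"
proof (rule equivI)
  show "C \<subseteq> W \<times> W" using cong_words by auto
  show "refl_on W C" by (auto simp: refl_on_def intro: amalg_cong.refl)
  show "sym C" by (auto simp: sym_def intro: amalg_cong.sym)
  show "trans C" by (auto simp: trans_def intro: amalg_cong.trans)
qed

lemma class_eq_iff: "v \<in> W \<Longrightarrow> w \<in> W \<Longrightarrow> C `` {v} = C `` {w} \<longleftrightarrow> (v, w) \<in> C"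
  using eq_equiv_class_iff[OF equiv_cong] by blast

lemma carrier_product: "carrier P = W // C"
  by (simp add: amalg_product_def)

lemma class_in_carrier: "w \<in> W \<Longrightarrow> C `` {w} \<in> carrier P"
  by (simp add: carrier_product quotientI)

lemma carrier_productE:
  assumes "X \<in> carrier P" obtains w where "w \<in> W" "X = C `` {w}"
  using assms by (auto simp: carrier_product elim: quotientE)

lemma mult_class:
  assumes "v \<in> W" "w \<in> W"
  shows "C `` {v} \<otimes>\<^bsub>P\<^esub> C `` {w} = C `` {v @ w}"
proof -
  have "C `` {x @ y | x y. x \<in> C `` {v} \<and> y \<in> C `` {w}} = C `` {v @ w}" (is "?A = ?B")
  proof (intro equalityI subsetI)
    fix z assume "z \<in> ?A"
    then obtain x y where "(v, x) \<in> C" "(w, y) \<in> C" "(x @ y, z) \<in> C" by auto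
    then show "z \<in> ?B" by (auto intro: amalg_cong.append amalg_cong.trans)
  next
    fix z assume "z \<in> ?B"
    then show "z \<in> ?A" using assms amalg_cong.refl by blast
  qed
  then show ?thesis by (simp add: amalg_product_def)
qed

lemma inverse_semigroup_product: "inverse_semigroup P"
proof (rule inverse_semigroupI[where
      R = "\<lambda>X Y. \<exists>w\<in>W. X = C `` {w} \<and> Y = C `` {word_inv S1 S2 w}"])
  obtain s where "s \<in> carrier S1" using S1.nonempty by blast
  then have "[Inl s] \<in> W" by (auto simp: words_def)
  then show "carrier P \<noteq> {}" using class_in_carrier by blast
next
  fix X Y assume "X \<in> carrier P" "Y \<in> carrier P"
  then show "X \<otimes>\<^bsub>P\<^esub> Y \<in> carrier P"
    by (metis carrier_productE mult_class class_in_carrier words_append)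
next
  fix X Y Z assume "X \<in> carrier P" "Y \<in> carrier P" "Z \<in> carrier P"
  then show "X \<otimes>\<^bsub>P\<^esub> Y \<otimes>\<^bsub>P\<^esub> Z = X \<otimes>\<^bsub>P\<^esub> (Y \<otimes>\<^bsub>P\<^esub> Z)"
    by (elim carrier_productE) (simp add: mult_class words_append)
next
  fix X assume "X \<in> carrier P"
  then show "\<exists>Y\<in>carrier P. \<exists>w\<in>W. X = C `` {w} \<and> Y = C `` {word_inv S1 S2 w}"
    by (metis carrier_productE class_in_carrier word_inv_words)
next
  fix X Y assume "\<exists>w\<in>W. X = C `` {w} \<and> Y = C `` {word_inv S1 S2 w}"
  then show "\<exists>w\<in>W. Y = C `` {w} \<and> X = C `` {word_inv S1 S2 w}"
    by (metis word_inv_word_inv word_inv_words)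
next
  fix X Y assume "\<exists>w\<in>W. X = C `` {w} \<and> Y = C `` {word_inv S1 S2 w}"
  then show "X \<otimes>\<^bsub>P\<^esub> (Y \<otimes>\<^bsub>P\<^esub> X) = X"
    by (metis amalg_cong.vagner class_eq_iff cong_words mult_class words_append word_inv_words)
next
  fix X X' Y Y'
  assume "\<exists>w\<in>W. X = C `` {w} \<and> X' = C `` {word_inv S1 S2 w}"
  then obtain v where v: "v \<in> W" "X = C `` {v}" "X' = C `` {word_inv S1 S2 v}" by blast
  assume "\<exists>w\<in>W. Y = C `` {w} \<and> Y' = C `` {word_inv S1 S2 w}"
  then obtain w where w: "w \<in> W" "Y = C `` {w}" "Y' = C `` {word_inv S1 S2 w}" by blast
  show "X \<otimes>\<^bsub>P\<^esub> X' \<otimes>\<^bsub>P\<^esub> (Y \<otimes>\<^bsub>P\<^esub> Y') = Y \<otimes>\<^bsub>P\<^esub> Y' \<otimes>\<^bsub>P\<^esub> (X \<otimes>\<^bsub>P\<^esub> X')"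
    using v w equiv_class_eq[OF equiv_cong amalg_cong.vagner_comm[OF v(1) w(1)]]
    by (simp add: mult_class words_append word_inv_words)
qed

lemma letter_words: "s \<in> carrier S1 \<Longrightarrow> [Inl s] \<in> W" "t \<in> carrier S2 \<Longrightarrow> [Inr t] \<in> W"
  by (auto simp: words_def)

lemma inj1_hom: "\<iota>1 \<in> hom S1 P"
proof (rule homI)
  fix s t assume st: "s \<in> carrier S1" "t \<in> carrier S1"
  then have "([Inl (s \<otimes>\<^bsub>S1\<^esub> t)], [Inl s] @ [Inl t]) \<in> C"
    by (simp add: amalg_cong.mult1 amalg_cong.sym)
  then show "\<iota>1 (s \<otimes>\<^bsub>S1\<^esub> t) = \<iota>1 s \<otimes>\<^bsub>P\<^esub> \<iota>1 t"
    unfolding amalg_inj1_def using st by (metis mult_class class_eq_iff cong_words letter_words(1))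
qed (simp add: amalg_inj1_def class_in_carrier letter_words)

lemma inj2_hom: "\<iota>2 \<in> hom S2 P"
proof (rule homI)
  fix s t assume st: "s \<in> carrier S2" "t \<in> carrier S2"
  then have "([Inr (s \<otimes>\<^bsub>S2\<^esub> t)], [Inr s] @ [Inr t]) \<in> C"
    by (simp add: amalg_cong.mult2 amalg_cong.sym)
  then show "\<iota>2 (s \<otimes>\<^bsub>S2\<^esub> t) = \<iota>2 s \<otimes>\<^bsub>P\<^esub> \<iota>2 t"
    unfolding amalg_inj2_def using st by (metis mult_class class_eq_iff cong_words letter_words(2))
qed (simp add: amalg_inj2_def class_in_carrier letter_words)

lemma inj_amalg: "u \<in> carrier U \<Longrightarrow> \<iota>1 (\<phi>1 u) = \<iota>2 (\<phi>2 u)"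
  using amalg_cong.amalg[of u U \<phi>1 \<phi>2 S1 S2] cong_words class_eq_iff
  unfolding amalg_inj1_def amalg_inj2_def by blast

theorem product_universal:
  assumes T: "inverse_semigroup T"
    and f1: "f1 \<in> hom S1 T" and f2: "f2 \<in> hom S2 T"
    and f: "\<And>u. u \<in> carrier U \<Longrightarrow> f1 (\<phi>1 u) = f2 (\<phi>2 u)"
  shows "\<exists>h\<in>hom P T. (\<forall>s\<in>carrier S1. h (\<iota>1 s) = f1 s) \<and> (\<forall>s\<in>carrier S2. h (\<iota>2 s) = f2 s) \<and>
    (\<forall>k\<in>hom P T. (\<forall>s\<in>carrier S1. k (\<iota>1 s) = f1 s) \<and> (\<forall>s\<in>carrier S2. k (\<iota>2 s) = f2 s) \<longrightarrow>
      (\<forall>X\<in>carrier P. k X = h X))"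
proof -
  interpret T: inverse_semigroup T by fact
  define l where "l = case_sum f1 f2"
  define ev where "ev w = foldr (\<lambda>x y. l x \<otimes>\<^bsub>T\<^esub> y) (butlast w) (l (last w))" for w
  have ev1: "ev [x] = l x" for x by (simp add: ev_def)
  have ev_Cons: "ev (x # w) = l x \<otimes>\<^bsub>T\<^esub> ev w" if "w \<noteq> []" for x w using that by (simp add: ev_def)
  define A where "A = carrier S1 <+> carrier S2"
  have l: "l x \<in> carrier T" if "x \<in> A" for x
    using that f1 f2 by (auto simp: A_def l_def hom_in_carrier)
  have ev_closed: "w \<noteq> [] \<Longrightarrow> set w \<subseteq> A \<Longrightarrow> ev w \<in> carrier T" for w
    by (induction w rule: list_nonempty_induct) (auto simp: ev1 ev_Cons l T.m_closed)
  then have evW: "ev w \<in> carrier T" if "w \<in> W" for w using that by (simp add: words_def A_def)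
  have ev_app: "ev (v @ w) = ev v \<otimes>\<^bsub>T\<^esub> ev w" if vw: "v \<in> W" "w \<in> W" for v w
  proof -
    have "v \<noteq> [] \<Longrightarrow> set v \<subseteq> A \<Longrightarrow> ev (v @ w) = ev v \<otimes>\<^bsub>T\<^esub> ev w"
      by (induction v rule: list_nonempty_induct)
        (use vw(2) evW[OF vw(2)] in \<open>auto simp: ev1 ev_Cons l ev_closed T.m_assoc words_def\<close>)
    then show ?thesis using vw(1) by (simp add: words_def A_def)
  qed
  have l_inv: "l (map_sum (sinv S1) (sinv S2) x) = sinv T (l x)" if "x \<in> A" for x
    using that hom_sinv[OF S1.inverse_semigroup_axioms T f1]
      hom_sinv[OF S2.inverse_semigroup_axioms T f2]
    by (auto simp: A_def l_def)
  have ev_inv: "ev (word_inv S1 S2 w) = sinv T (ev w)" if w: "w \<in> W" for w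
  proof -
    have "w \<noteq> [] \<Longrightarrow> set w \<subseteq> A \<Longrightarrow> ev (word_inv S1 S2 w) = sinv T (ev w)"
    proof (induction w rule: list_nonempty_induct)
      case (single x)
      then show ?case by (simp add: word_inv_def ev1 l_inv)
    next
      case (cons x w)
      then have wW: "w \<in> W" and xW: "[map_sum (sinv S1) (sinv S2) x] \<in> W"
        by (auto simp: words_def A_def S1.sinv_closed S2.sinv_closed)
      show ?case
        using cons by (simp add: word_inv_Cons ev_app[OF word_inv_words[OF wW] xW] ev1 ev_Cons
            l_inv T.sinv_mult l evW[OF wW])
    qed
    then show ?thesis using w by (simp add: words_def A_def)
  qed
  have ev_cong: "(v, w) \<in> C \<Longrightarrow> ev v = ev w" for v w
  proof (induction rule: amalg_cong.induct)
    case (append v v' w w')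
    then show ?case using cong_words by (metis ev_app)
  next
    case (vagner w)
    then show ?case
      by (simp add: ev_app words_append word_inv_words ev_inv T.inv1 evW)
  next
    case (vagner_comm v w)
    define x y where "x = ev v" and "y = ev w"
    have xy: "x \<in> carrier T" "y \<in> carrier T" "sinv T x \<in> carrier T" "sinv T y \<in> carrier T"
      using vagner_comm evW T.sinv_closed by (auto simp: x_def y_def)
    have "(x \<otimes>\<^bsub>T\<^esub> sinv T x) \<otimes>\<^bsub>T\<^esub> (y \<otimes>\<^bsub>T\<^esub> sinv T y) = (y \<otimes>\<^bsub>T\<^esub> sinv T y) \<otimes>\<^bsub>T\<^esub> (x \<otimes>\<^bsub>T\<^esub> sinv T x)"
      using xy T.inv2 by (intro T.idem_comm) (simp_all add: T.m_assoc T.m_closed)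
    then show ?case
      using vagner_comm xy
      by (simp add: ev_app words_append word_inv_words ev_inv T.m_assoc T.m_closed
          flip: x_def y_def)
  next
    case (mult1 s t)
    then show ?case using f1 by (simp add: ev1 ev_Cons l_def hom_def)
  next
    case (mult2 s t)
    then show ?case using f2 by (simp add: ev1 ev_Cons l_def hom_def)
  next
    case (amalg u)
    then show ?case using f by (simp add: ev1 l_def)
  qed auto
  define h where "h X = ev (SOME w. w \<in> X)" for X
  have h_class: "h (C `` {w}) = ev w" if "w \<in> W" for w
  proof -
    have "w \<in> C `` {w}" using that amalg_cong.refl by blast
    then have "(SOME v. v \<in> C `` {w}) \<in> C `` {w}" by (rule someI)
    then show ?thesis unfolding h_def using ev_cong by (metis Image_singleton_iff)
  qed
  have hom: "h \<in> hom P T"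
    by (auto simp: hom_def h_class evW mult_class ev_app words_append elim!: carrier_productE)
  have h1: "h (\<iota>1 s) = f1 s" if "s \<in> carrier S1" for s
    using that by (simp add: amalg_inj1_def h_class letter_words ev1 l_def)
  have h2: "h (\<iota>2 s) = f2 s" if "s \<in> carrier S2" for s
    using that by (simp add: amalg_inj2_def h_class letter_words ev1 l_def)
  have "k X = h X"
    if k: "k \<in> hom P T" "\<forall>s\<in>carrier S1. k (\<iota>1 s) = f1 s" "\<forall>s\<in>carrier S2. k (\<iota>2 s) = f2 s"
      and X: "X \<in> carrier P" for k X
  proof -
    have kl: "k (C `` {[x]}) = l x" if "x \<in> A" for x
      using that k by (auto simp: A_def l_def amalg_inj1_def amalg_inj2_def)
    have "w \<noteq> [] \<Longrightarrow> set w \<subseteq> A \<Longrightarrow> k (C `` {w}) = ev w" for w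
    proof (induction w rule: list_nonempty_induct)
      case (single x)
      then show ?case by (simp add: kl ev1)
    next
      case (cons x w)
      then have xw: "[x] \<in> W" "w \<in> W" by (auto simp: words_def A_def)
      have "k (C `` {[x]} \<otimes>\<^bsub>P\<^esub> C `` {w}) = k (C `` {[x]}) \<otimes>\<^bsub>T\<^esub> k (C `` {w})"
        using k(1) xw class_in_carrier by (simp add: hom_def)
      then show ?case using cons xw by (simp add: mult_class kl ev_Cons)
    qed
    moreover obtain w where "w \<in> W" "X = C `` {w}" using X by (rule carrier_productE)
    ultimately show ?thesis using h_class by (simp add: words_def A_def)
  qed
  then show ?thesis using hom h1 h2 by blast
qed

end

end

theory Submission
  imports Defs
begin

text \<open>
  The product \<open>P\<close> acts by partial bijections on a tree of lobes. Its root is the right regular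
  representation of the factor containing \<open>g\<close>; each further lobe extends the action of \<open>U\<close> on the
  points of the previous one freely to an action of the other factor. Freeness yields two facts.
  First, an element of a factor that takes an old point to an old point lies above an element of
  \<open>U\<close> that does so, whence excursions into other lobes can be shortcut: if \<open>x\<close> takes
  the point \<open>[g]\<close> to a point of the root, then some \<open>s\<close> in the factor does so as well and lies below
  \<open>g x\<close>. Second, if \<open>g\<close> fixes a point outside the root, then so does some idempotent \<open>h \<le> g\<close> of the
  factor that is \<open>\<D>\<close>-related to an idempotent of \<open>U\<close>.

  Now let \<open>x \<in> H\<^sub>g\<close> take \<open>[g]\<close> to \<open>q\<close>; then \<open>g = x\<^sup>-\<^sup>1 x\<close> fixes \<open>q\<close>. If \<open>q\<close> were outside the root,
  then \<open>x h x\<^sup>-\<^sup>1\<close> would fix \<open>[g]\<close>, hence \<open>x h x\<^sup>-\<^sup>1 \<ge> g\<close> and \<open>h = g\<close>, which is excluded. So \<open>q\<close> lies in the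
  root, and \<open>x \<ge> g s \<in> R\<^sub>g\<close> for some \<open>s\<close> in the factor, whence \<open>x = g s\<close>.
\<close>

section \<open>The natural partial order\<close>

definition nat_le :: "('a, 'm) monoid_scheme \<Rightarrow> 'a \<Rightarrow> 'a \<Rightarrow> bool" (infix "\<preceq>\<index>" 50) where
  "a \<preceq>\<^bsub>S\<^esub> b \<longleftrightarrow> b \<in> carrier S \<and> (\<exists>e\<in>idempotents S. a = e \<otimes>\<^bsub>S\<^esub> b)"

context inverse_semigroup
begin

section \<open>Idempotents and their conjugates\<close>

lemma idem_closed: "e \<in> idempotents S \<Longrightarrow> e \<in> carrier S"
  and idem_idem: "e \<in> idempotents S \<Longrightarrow> e \<otimes> e = e"
  by (auto simp: idempotents_def)

lemma idem_mult: "e \<in> idempotents S \<Longrightarrow> f \<in> idempotents S \<Longrightarrow> e \<otimes> f \<in> idempotents S"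
  using mult_idem m_closed by (auto simp: idempotents_def)

lemma idem_commute: "e \<in> idempotents S \<Longrightarrow> f \<in> idempotents S \<Longrightarrow> e \<otimes> f = f \<otimes> e"
  using idem_comm by (auto simp: idempotents_def)

lemma idem_sinv: "e \<in> idempotents S \<Longrightarrow> sinv S e = e"
  using sinv_idem by (auto simp: idempotents_def)

lemma inv1': "x \<in> carrier S \<Longrightarrow> x \<otimes> sinv S x \<otimes> x = x"
  and inv2': "x \<in> carrier S \<Longrightarrow> sinv S x \<otimes> x \<otimes> sinv S x = sinv S x"
  using inv1 inv2 by (simp_all add: m_assoc sinv_closed)

lemma range_idem: "x \<in> carrier S \<Longrightarrow> x \<otimes> sinv S x \<in> idempotents S"
  using inv2 by (simp add: idempotents_def m_assoc m_closed sinv_closed)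

lemma domain_idem: "x \<in> carrier S \<Longrightarrow> sinv S x \<otimes> x \<in> idempotents S"
  using inv1 by (simp add: idempotents_def m_assoc m_closed sinv_closed)

text \<open>The conjugate equals \<open>(x e) (x e)^-1\<close>, a range idempotent.\<close>

lemma conj_idem:
  assumes e: "e \<in> idempotents S" and x: "x \<in> carrier S"
  shows "x \<otimes> e \<otimes> sinv S x \<in> idempotents S"
proof -
  note c = idem_closed[OF e] x sinv_closed[OF x]
  have "x \<otimes> e \<otimes> sinv S x = (x \<otimes> e) \<otimes> sinv S (x \<otimes> e)"
    using c idem_idem[OF e] e_idem[OF idem_closed[OF e] idem_idem[OF e]]
    by (simp add: sinv_mult idem_sinv[OF e] m_assoc m_closed)
  then show ?thesis using range_idem c by (simp add: m_closed)
qed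

text \<open>\<open>e\<close> commutes with the idempotent \<open>x^-1 x\<close>, so it can be
  carried past \<open>x\<close> at the price of a conjugation.\<close>

lemma move_idem:
  assumes e: "e \<in> idempotents S" and x: "x \<in> carrier S"
  shows "x \<otimes> e = (x \<otimes> e \<otimes> sinv S x) \<otimes> x"
proof -
  note c = idem_closed[OF e] x sinv_closed[OF x]
  have "(x \<otimes> e \<otimes> sinv S x) \<otimes> x = x \<otimes> (e \<otimes> (sinv S x \<otimes> x))" using c by (simp add: m_assoc m_closed)
  also have "\<dots> = x \<otimes> ((sinv S x \<otimes> x) \<otimes> e)" using idem_commute[OF e domain_idem[OF x]] by simp
  also have "\<dots> = (x \<otimes> sinv S x \<otimes> x) \<otimes> e" using c by (simp add: m_assoc m_closed)
  finally show ?thesis using inv1' x by simp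
qed

lemma move_idem':
  assumes e: "e \<in> idempotents S" and x: "x \<in> carrier S"
  shows "e \<otimes> x = x \<otimes> (sinv S x \<otimes> e \<otimes> x)"
proof -
  note c = idem_closed[OF e] x sinv_closed[OF x]
  have "x \<otimes> (sinv S x \<otimes> e \<otimes> x) = ((x \<otimes> sinv S x) \<otimes> e) \<otimes> x" using c by (simp add: m_assoc m_closed)
  also have "\<dots> = (e \<otimes> (x \<otimes> sinv S x)) \<otimes> x" using idem_commute[OF e range_idem[OF x]] by simp
  also have "\<dots> = e \<otimes> (x \<otimes> sinv S x \<otimes> x)" using c by (simp add: m_assoc m_closed)
  finally show ?thesis using inv1' x by simp
qed

lemma nat_leD: "a \<preceq> b \<Longrightarrow> a \<in> carrier S \<and> b \<in> carrier S"
  by (auto simp: nat_le_def idem_closed m_closed)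

text \<open>Conjugation by \<open>b\<close> moves the idempotent to the other side. With both forms
  at hand, a product of two comparisons can keep its idempotents on the outside, as in
  \<open>nat_le_mult\<close>.\<close>

lemma nat_le_right: "a \<preceq> b \<longleftrightarrow> b \<in> carrier S \<and> (\<exists>e\<in>idempotents S. a = b \<otimes> e)"
  unfolding nat_le_def
  using move_idem move_idem' conj_idem conj_idem[where x = "sinv S b"]
  by (metis sinv_closed sinv_sinv)

lemma nat_le_refl: "a \<in> carrier S \<Longrightarrow> a \<preceq> a"
  unfolding nat_le_def using range_idem inv1' by metis

lemma idem_mult_le: "e \<in> idempotents S \<Longrightarrow> a \<in> carrier S \<Longrightarrow> e \<otimes> a \<preceq> a"
  unfolding nat_le_def by blast

lemma mult_idem_le: "e \<in> idempotents S \<Longrightarrow> a \<in> carrier S \<Longrightarrow> a \<otimes> e \<preceq> a"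
  unfolding nat_le_right by blast

lemma nat_le_trans [trans]:
  assumes "a \<preceq> b" "b \<preceq> c" shows "a \<preceq> c"
proof -
  obtain e f where "e \<in> idempotents S" "f \<in> idempotents S" "a = e \<otimes> b" "b = f \<otimes> c" "c \<in> carrier S"
    using assms by (auto simp: nat_le_def)
  then show ?thesis
    unfolding nat_le_def by (metis idem_closed idem_mult m_assoc)
qed

lemma nat_le_antisym:
  assumes "a \<preceq> b" "b \<preceq> a" shows "a = b"
proof -
  obtain e f where h: "e \<in> idempotents S" "f \<in> idempotents S" "a = e \<otimes> b" "b = f \<otimes> a"
    using assms by (auto simp: nat_le_def)
  note c = nat_leD[OF assms(1)] idem_closed[OF h(1)] idem_closed[OF h(2)]
  have ea: "e \<otimes> a = a" using h c idem_idem[OF h(1)] by (metis m_assoc)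
  have "a = e \<otimes> (f \<otimes> a)" using h(3) unfolding h(4)[symmetric] .
  also have "\<dots> = (e \<otimes> f) \<otimes> a" using c by (simp add: m_assoc)
  also have "\<dots> = f \<otimes> (e \<otimes> a)" using idem_commute[OF h(1,2)] c by (simp add: m_assoc)
  finally show ?thesis unfolding ea h(4)[symmetric] .
qed

lemma nat_le_mult:
  assumes "a \<preceq> b" "c \<preceq> d" shows "a \<otimes> c \<preceq> b \<otimes> d"
proof -
  obtain e f where h: "e \<in> idempotents S" "f \<in> idempotents S" "a = e \<otimes> b" "c = d \<otimes> f"
    using assms unfolding nat_le_def[of S a] nat_le_right[of c] by auto
  note c = nat_leD[OF assms(1)] nat_leD[OF assms(2)] idem_closed[OF h(1)] idem_closed[OF h(2)]
  have "a \<otimes> c = e \<otimes> (b \<otimes> d) \<otimes> f" using h c by (simp add: m_assoc m_closed)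
  also have "\<dots> \<preceq> e \<otimes> (b \<otimes> d)" using mult_idem_le[OF h(2)] c by (simp add: m_closed)
  also have "\<dots> \<preceq> b \<otimes> d" using idem_mult_le[OF h(1)] c by (simp add: m_closed)
  finally show ?thesis .
qed

lemma nat_le_sinv:
  assumes "a \<preceq> b" shows "sinv S a \<preceq> sinv S b"
proof -
  obtain e where h: "e \<in> idempotents S" "a = e \<otimes> b" using assms by (auto simp: nat_le_def)
  then have "sinv S a = sinv S b \<otimes> e"
    using nat_leD[OF assms] by (simp add: sinv_mult idem_closed idem_sinv)
  then show ?thesis using h nat_leD[OF assms] mult_idem_le sinv_closed by simp
qed

lemma nat_le_idem: "a \<preceq> e \<Longrightarrow> e \<in> idempotents S \<Longrightarrow> a \<in> idempotents S"
  unfolding nat_le_def using idem_mult by blast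

text \<open>The inner factor \<open>s^-1 s\<close> is idempotent and may be dropped going upwards.
  This and the two one-sided variants below let witnesses from \<open>U\<close> be composed when
  tensors are compared.\<close>

lemma nat_le_cancel:
  assumes "a \<preceq> x \<otimes> sinv S s" "c \<preceq> s \<otimes> y" "x \<in> carrier S" "y \<in> carrier S" "s \<in> carrier S"
  shows "a \<otimes> c \<preceq> x \<otimes> y"
proof -
  have "a \<otimes> c \<preceq> (x \<otimes> sinv S s) \<otimes> (s \<otimes> y)" using assms(1,2) by (rule nat_le_mult)
  also have "(x \<otimes> sinv S s) \<otimes> (s \<otimes> y) = (x \<otimes> (sinv S s \<otimes> s)) \<otimes> y"
    using assms by (simp add: m_assoc m_closed sinv_closed)
  also have "\<dots> \<preceq> x \<otimes> y"
    by (rule nat_le_mult[OF mult_idem_le[OF domain_idem] nat_le_refl]) (use assms in simp_all)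
  finally show ?thesis .
qed

lemma nat_le_cancel_right:
  assumes "a \<preceq> x \<otimes> sinv S s" "c \<preceq> s" "x \<in> carrier S" "s \<in> carrier S"
  shows "a \<otimes> c \<preceq> x"
proof -
  have "a \<otimes> c \<preceq> (x \<otimes> sinv S s) \<otimes> s" using assms(1,2) by (rule nat_le_mult)
  also have "(x \<otimes> sinv S s) \<otimes> s = x \<otimes> (sinv S s \<otimes> s)"
    using assms by (simp add: m_assoc m_closed sinv_closed)
  also have "\<dots> \<preceq> x" using assms mult_idem_le domain_idem by blast
  finally show ?thesis .
qed

lemma nat_le_cancel_left:
  assumes "a \<preceq> sinv S s" "c \<preceq> s \<otimes> y" "y \<in> carrier S" "s \<in> carrier S"
  shows "a \<otimes> c \<preceq> y"
proof -
  have "a \<otimes> c \<preceq> sinv S s \<otimes> (s \<otimes> y)" using assms(1,2) by (rule nat_le_mult)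
  also have "sinv S s \<otimes> (s \<otimes> y) = (sinv S s \<otimes> s) \<otimes> y"
    using assms by (simp add: m_assoc m_closed sinv_closed)
  also have "\<dots> \<preceq> y" using assms idem_mult_le domain_idem by blast
  finally show ?thesis .
qed

lemma range_mult_le:
  assumes "x \<in> carrier S" "y \<in> carrier S"
  shows "(x \<otimes> y) \<otimes> sinv S (x \<otimes> y) \<preceq> x \<otimes> sinv S x"
proof -
  have "(x \<otimes> y) \<otimes> sinv S (x \<otimes> y) = (x \<otimes> (y \<otimes> sinv S y)) \<otimes> sinv S x"
    using assms by (simp add: sinv_mult m_assoc m_closed sinv_closed)
  then show ?thesis
    using assms mult_idem_le range_idem nat_le_mult nat_le_refl sinv_closed by simp
qed

text \<open>Multiplying \<open>b\<close> on the left by its own range idempotent gives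
  \<open>b\<close>, by that of \<open>a\<close> gives \<open>a\<close>.\<close>

lemma nat_le_eq:
  assumes "a \<preceq> b" "a \<otimes> sinv S a = b \<otimes> sinv S b"
  shows "a = b"
proof -
  obtain e where h: "e \<in> idempotents S" "a = e \<otimes> b" using assms by (auto simp: nat_le_def)
  note c = nat_leD[OF assms(1)] idem_closed[OF h(1)] sinv_closed
  have "a \<otimes> sinv S a \<otimes> b = e \<otimes> ((b \<otimes> sinv S b) \<otimes> e) \<otimes> b"
    using h c by (simp add: sinv_mult idem_sinv m_assoc m_closed)
  also have "\<dots> = e \<otimes> (e \<otimes> (b \<otimes> sinv S b)) \<otimes> b"
    using idem_commute[OF h(1) range_idem] c by simp
  also have "\<dots> = (e \<otimes> e) \<otimes> (b \<otimes> sinv S b \<otimes> b)" using c by (simp add: m_assoc m_closed)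
  also have "\<dots> = a" using c h idem_idem inv1' by simp
  finally show ?thesis using assms(2) inv1' c by simp
qed

end

lemma hom_idem: "f \<in> hom S T \<Longrightarrow> e \<in> idempotents S \<Longrightarrow> f e \<in> idempotents T"
  by (auto simp: idempotents_def hom_in_carrier simp flip: hom_mult)

lemma hom_nat_le: "f \<in> hom S T \<Longrightarrow> a \<preceq>\<^bsub>S\<^esub> b \<Longrightarrow> f a \<preceq>\<^bsub>T\<^esub> f b"
  unfolding nat_le_def using hom_idem[of f S T] hom_mult[of f S T] hom_in_carrier[of f S T]
  by (metis (no_types, lifting) idempotents_def mem_Collect_eq)

section \<open>Green's relations and maximal subgroups\<close>

context inverse_semigroup
begin

text \<open>Membership of \<open>a\<close> in the ideal of \<open>b\<close> forces
  \<open>a a^-1 \<preceq> b b^-1\<close>, so equal ideals give equal range idempotents by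
  antisymmetry. Conversely, \<open>a = b (b^-1 a)\<close> once the range idempotents agree.\<close>

lemma greenR_iff:
  "(a, b) \<in> greenR S \<longleftrightarrow> a \<in> carrier S \<and> b \<in> carrier S \<and> a \<otimes> sinv S a = b \<otimes> sinv S b"
proof -
  have sub: "insert a ((\<lambda>s. a \<otimes> s) ` carrier S) \<subseteq> insert b ((\<lambda>s. b \<otimes> s) ` carrier S)"
    if "a \<in> carrier S" "b \<in> carrier S" "a \<otimes> sinv S a = b \<otimes> sinv S b" for a b
  proof -
    have a': "(b \<otimes> sinv S b) \<otimes> a = a" using that inv1'[of a] by simp
    then have "b \<otimes> (sinv S b \<otimes> a) = a" using that by (simp add: m_assoc sinv_closed)
    then have "a \<in> (\<lambda>s. b \<otimes> s) ` carrier S"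
      using that m_closed sinv_closed by (metis image_eqI)
    moreover have "a \<otimes> s \<in> (\<lambda>s. b \<otimes> s) ` carrier S" if "s \<in> carrier S" for s
    proof (rule image_eqI)
      show "a \<otimes> s = b \<otimes> (sinv S b \<otimes> a \<otimes> s)"
        using arg_cong[OF a', of "\<lambda>x. x \<otimes> s"] that \<open>a \<in> carrier S\<close> \<open>b \<in> carrier S\<close>
        by (simp add: m_assoc m_closed sinv_closed)
    qed (use that \<open>a \<in> carrier S\<close> \<open>b \<in> carrier S\<close> m_closed sinv_closed in simp)
    ultimately show ?thesis by blast
  qed
  have le: "a \<otimes> sinv S a \<preceq> b \<otimes> sinv S b"
    if "a \<in> carrier S" "b \<in> carrier S" "a \<in> insert b ((\<lambda>s. b \<otimes> s) ` carrier S)" for a b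
    using that range_mult_le nat_le_refl m_closed sinv_closed by auto
  show ?thesis
  proof
    assume "(a, b) \<in> greenR S"
    then have "a \<in> carrier S" "b \<in> carrier S" and
      eq: "insert a ((\<lambda>s. a \<otimes> s) ` carrier S) = insert b ((\<lambda>s. b \<otimes> s) ` carrier S)"
      by (simp_all add: greenR_def)
    moreover have "a \<in> insert b ((\<lambda>s. b \<otimes> s) ` carrier S)" unfolding eq[symmetric] by (rule insertI1)
    moreover have "b \<in> insert a ((\<lambda>s. a \<otimes> s) ` carrier S)" unfolding eq by (rule insertI1)
    ultimately show "a \<in> carrier S \<and> b \<in> carrier S \<and> a \<otimes> sinv S a = b \<otimes> sinv S b"
      using nat_le_antisym[OF le[of a b] le[of b a]] by simp
  next
    assume "a \<in> carrier S \<and> b \<in> carrier S \<and> a \<otimes> sinv S a = b \<otimes> sinv S b"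
    then show "(a, b) \<in> greenR S" using sub[of a b] sub[of b a] by (simp add: greenR_def set_eq_subset)
  qed
qed

lemma greenL_iff:
  "(a, b) \<in> greenL S \<longleftrightarrow> a \<in> carrier S \<and> b \<in> carrier S \<and> sinv S a \<otimes> a = sinv S b \<otimes> b"
proof -
  have sub: "insert a ((\<lambda>s. s \<otimes> a) ` carrier S) \<subseteq> insert b ((\<lambda>s. s \<otimes> b) ` carrier S)"
    if "a \<in> carrier S" "b \<in> carrier S" "sinv S a \<otimes> a = sinv S b \<otimes> b" for a b
  proof -
    have a': "a \<otimes> (sinv S b \<otimes> b) = a" using that inv1[of a] by simp
    then have "(a \<otimes> sinv S b) \<otimes> b = a" using that by (simp add: m_assoc sinv_closed)
    then have "a \<in> (\<lambda>s. s \<otimes> b) ` carrier S"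
      using that m_closed sinv_closed by (metis image_eqI)
    moreover have "s \<otimes> a \<in> (\<lambda>s. s \<otimes> b) ` carrier S" if "s \<in> carrier S" for s
    proof (rule image_eqI)
      show "s \<otimes> a = (s \<otimes> (a \<otimes> sinv S b)) \<otimes> b"
        using arg_cong[OF a', of "\<lambda>x. s \<otimes> x"] that \<open>a \<in> carrier S\<close> \<open>b \<in> carrier S\<close>
        by (simp add: m_assoc m_closed sinv_closed)
    qed (use that \<open>a \<in> carrier S\<close> \<open>b \<in> carrier S\<close> m_closed sinv_closed in simp)
    ultimately show ?thesis by blast
  qed
  have le: "sinv S a \<otimes> a \<preceq> sinv S b \<otimes> b"
    if "a \<in> carrier S" "b \<in> carrier S" "a \<in> insert b ((\<lambda>s. s \<otimes> b) ` carrier S)" for a b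
  proof -
    have "sinv S (s \<otimes> b) \<otimes> (s \<otimes> b) \<preceq> sinv S b \<otimes> b" if "s \<in> carrier S" for s
      using range_mult_le[of "sinv S b" "sinv S s"] that \<open>b \<in> carrier S\<close>
      by (simp add: sinv_mult sinv_sinv sinv_closed m_closed)
    then show ?thesis using that nat_le_refl m_closed sinv_closed by auto
  qed
  show ?thesis
  proof
    assume "(a, b) \<in> greenL S"
    then have "a \<in> carrier S" "b \<in> carrier S" and
      eq: "insert a ((\<lambda>s. s \<otimes> a) ` carrier S) = insert b ((\<lambda>s. s \<otimes> b) ` carrier S)"
      by (simp_all add: greenL_def)
    moreover have "a \<in> insert b ((\<lambda>s. s \<otimes> b) ` carrier S)" unfolding eq[symmetric] by (rule insertI1)
    moreover have "b \<in> insert a ((\<lambda>s. s \<otimes> a) ` carrier S)" unfolding eq by (rule insertI1)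
    ultimately show "a \<in> carrier S \<and> b \<in> carrier S \<and> sinv S a \<otimes> a = sinv S b \<otimes> b"
      using nat_le_antisym[OF le[of a b] le[of b a]] by simp
  next
    assume "a \<in> carrier S \<and> b \<in> carrier S \<and> sinv S a \<otimes> a = sinv S b \<otimes> b"
    then show "(a, b) \<in> greenL S" using sub[of a b] sub[of b a] by (simp add: greenL_def set_eq_subset)
  qed
qed

lemma greenD_idem_iff:
  assumes "e \<in> idempotents S" "f \<in> idempotents S"
  shows "(e, f) \<in> greenD S \<longleftrightarrow> (\<exists>z\<in>carrier S. z \<otimes> sinv S z = e \<and> sinv S z \<otimes> z = f)"
proof -
  have "(e, f) \<in> greenD S \<longleftrightarrow> (\<exists>z\<in>carrier S. sinv S z \<otimes> z = e \<and> z \<otimes> sinv S z = f)"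
    using assms by (auto simp: greenD_def relcomp_unfold greenL_iff greenR_iff idem_closed idem_sinv
        idem_idem)
  \<comment> \<open>Passing to the inverse of \<open>z\<close> exchanges its range and domain
    idempotents.\<close>
  also have "\<dots> \<longleftrightarrow> (\<exists>z\<in>carrier S. z \<otimes> sinv S z = e \<and> sinv S z \<otimes> z = f)"
    by (metis sinv_closed sinv_sinv)
  finally show ?thesis .
qed

lemma greenD_trans:
  assumes "e \<in> idempotents S" "f \<in> idempotents S" "h \<in> idempotents S"
    "(e, f) \<in> greenD S" "(f, h) \<in> greenD S"
  shows "(e, h) \<in> greenD S"
proof -
  obtain y z where y: "y \<in> carrier S" "y \<otimes> sinv S y = e" "sinv S y \<otimes> y = f"
    and z: "z \<in> carrier S" "z \<otimes> sinv S z = f" "sinv S z \<otimes> z = h"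
    using assms greenD_idem_iff by blast
  note c = y(1) z(1) sinv_closed m_closed
  have "(y \<otimes> z) \<otimes> sinv S (y \<otimes> z) = y \<otimes> (z \<otimes> sinv S z) \<otimes> sinv S y"
    using c by (simp add: sinv_mult m_assoc)
  also have "\<dots> = (y \<otimes> sinv S y \<otimes> y) \<otimes> sinv S y"
    unfolding z(2) y(3)[symmetric] using c by (simp add: m_assoc)
  also have "\<dots> = y \<otimes> sinv S y" by (simp only: inv1'[OF y(1)])
  also have "\<dots> = e" by (rule y(2))
  finally have 1: "(y \<otimes> z) \<otimes> sinv S (y \<otimes> z) = e" .
  have "sinv S (y \<otimes> z) \<otimes> (y \<otimes> z) = sinv S z \<otimes> (sinv S y \<otimes> y) \<otimes> z"
    using c by (simp add: sinv_mult m_assoc)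
  also have "\<dots> = sinv S z \<otimes> (z \<otimes> sinv S z \<otimes> z)"
    unfolding y(3) z(2)[symmetric] using c by (simp add: m_assoc)
  also have "\<dots> = sinv S z \<otimes> z" by (simp only: inv1'[OF z(1)])
  also have "\<dots> = h" by (rule z(3))
  finally have 2: "sinv S (y \<otimes> z) \<otimes> (y \<otimes> z) = h" .
  show ?thesis using 1 2 c greenD_idem_iff assms by blast
qed

lemma max_subgroup_sinv_iff:
  assumes "e \<in> idempotents S"
  shows "x \<in> carrier (max_subgroup S e) \<longleftrightarrow>
    x \<in> carrier S \<and> x \<otimes> sinv S x = e \<and> sinv S x \<otimes> x = e"
  using assms by (auto simp: max_subgroup_def greenH_def greenL_iff greenR_iff idem_closed idem_sinv
      idem_idem)

lemma max_subgroup_cong_greenD: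
  assumes e: "e \<in> idempotents S" and f: "f \<in> idempotents S" and D: "(e, f) \<in> greenD S"
  shows "max_subgroup S e \<cong> max_subgroup S f"
proof -
  obtain z where z: "z \<in> carrier S" "z \<otimes> sinv S z = e" "sinv S z \<otimes> z = f"
    using assms greenD_idem_iff by blast
  \<comment> \<open>Stated for arbitrary data, so that it applies to \<open>z\<close> and, with
    \<open>e\<close> and \<open>f\<close> exchanged, to \<open>z^-1\<close>; the two conjugations
    are mutually inverse.\<close>
  have conj: "sinv S z \<otimes> x \<otimes> z \<in> carrier (max_subgroup S f) \<and>
      z \<otimes> (sinv S z \<otimes> x \<otimes> z) \<otimes> sinv S z = x"
    if z: "z \<in> carrier S" "z \<otimes> sinv S z = e" "sinv S z \<otimes> z = f"
      and e: "e \<in> idempotents S" and f: "f \<in> idempotents S"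
      and x: "x \<in> carrier (max_subgroup S e)" for z x e f
  proof -
    obtain y where h: "x \<in> carrier S" "e \<otimes> x = x" "x \<otimes> e = x" "y \<in> carrier S" "e \<otimes> y = y" "y \<otimes> e = y"
      "x \<otimes> y = e" "y \<otimes> x = e"
      using x max_subgroup_iff[OF e] by blast
    note c = h(1,4) z(1) sinv_closed[OF z(1)] m_closed
    have p: "(sinv S z \<otimes> v \<otimes> z) \<otimes> (sinv S z \<otimes> w \<otimes> z) = f"
      if "v \<in> carrier S" "w \<in> carrier S" "v \<otimes> e = v" "v \<otimes> w = e" for v w
    proof -
      have "(sinv S z \<otimes> v \<otimes> z) \<otimes> (sinv S z \<otimes> w \<otimes> z) = sinv S z \<otimes> (v \<otimes> (z \<otimes> sinv S z) \<otimes> w) \<otimes> z"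
        using c that by (simp add: m_assoc)
      also have "\<dots> = sinv S z \<otimes> (z \<otimes> sinv S z) \<otimes> z" unfolding z(2) that(3,4) ..
      also have "\<dots> = f" by (simp only: inv2[OF z(1)] z(3))
      finally show ?thesis .
    qed
    have q: "f \<otimes> (sinv S z \<otimes> v \<otimes> z) = sinv S z \<otimes> v \<otimes> z" "(sinv S z \<otimes> v \<otimes> z) \<otimes> f = sinv S z \<otimes> v \<otimes> z"
      if v: "v \<in> carrier S" for v
    proof -
      have "f \<otimes> (sinv S z \<otimes> v \<otimes> z) = (sinv S z \<otimes> z \<otimes> sinv S z) \<otimes> v \<otimes> z"
        unfolding z(3)[symmetric] using c v by (simp add: m_assoc)
      then show "f \<otimes> (sinv S z \<otimes> v \<otimes> z) = sinv S z \<otimes> v \<otimes> z" by (simp only: inv2'[OF z(1)])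
      have "(sinv S z \<otimes> v \<otimes> z) \<otimes> f = sinv S z \<otimes> v \<otimes> (z \<otimes> sinv S z \<otimes> z)"
        unfolding z(3)[symmetric] using c v by (simp add: m_assoc)
      then show "(sinv S z \<otimes> v \<otimes> z) \<otimes> f = sinv S z \<otimes> v \<otimes> z" by (simp only: inv1'[OF z(1)])
    qed
    have "z \<otimes> (sinv S z \<otimes> x \<otimes> z) \<otimes> sinv S z = (z \<otimes> sinv S z) \<otimes> x \<otimes> (z \<otimes> sinv S z)"
      using c by (simp add: m_assoc)
    also have "\<dots> = x" using h z(2) by simp
    finally show ?thesis
      unfolding max_subgroup_iff[OF f]
      using p[OF h(1,4,3,7)] p[OF h(4,1,6,8)] q[OF h(1)] q[OF h(4)] c by blast
  qed
  let ?h = "\<lambda>x. sinv S z \<otimes> x \<otimes> z" and ?k = "\<lambda>x. z \<otimes> x \<otimes> sinv S z"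
  have fwd: "?h x \<in> carrier (max_subgroup S f) \<and> ?k (?h x) = x" if "x \<in> carrier (max_subgroup S e)" for x
    using conj[OF z e f that] .
  have bwd: "?k x \<in> carrier (max_subgroup S e) \<and> ?h (?k x) = x" if "x \<in> carrier (max_subgroup S f)" for x
    using conj[of "sinv S z" f e x] z e f that by (simp add: sinv_closed sinv_sinv)
  have "?h \<in> hom (max_subgroup S e) (max_subgroup S f)"
  proof (rule homI)
    fix x y assume xy: "x \<in> carrier (max_subgroup S e)" "y \<in> carrier (max_subgroup S e)"
    then have c: "x \<in> carrier S" "y \<in> carrier S" "x \<otimes> e = x" using max_subgroup_iff[OF e] by auto
    have "?h x \<otimes> ?h y = sinv S z \<otimes> (x \<otimes> (z \<otimes> sinv S z) \<otimes> y) \<otimes> z"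
      using c(1,2) z(1) by (simp add: m_assoc m_closed sinv_closed)
    then show "?h (x \<otimes>\<^bsub>max_subgroup S e\<^esub> y) = ?h x \<otimes>\<^bsub>max_subgroup S f\<^esub> ?h y"
      unfolding z(2) c(3) by (simp add: max_subgroup_def)
  qed (use fwd in blast)
  moreover have "bij_betw ?h (carrier (max_subgroup S e)) (carrier (max_subgroup S f))"
    by (rule bij_betw_byWitness[where f' = ?k]) (use fwd bwd in auto)
  ultimately show ?thesis unfolding is_iso_def iso_def by blast
qed

end

text \<open>\<open>f\<close> preserves and, being injective, reflects the equations
  \<open>x x^-1 = e\<close> and \<open>x^-1 x = e\<close>. By \<open>sub\<close>, every element of
  the target group therefore comes from the source group.\<close>

lemma max_subgroup_cong_hom:
  assumes S: "inverse_semigroup S" and T: "inverse_semigroup T"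
    and f: "f \<in> hom S T" "inj_on f (carrier S)" and e: "e \<in> idempotents S"
    and sub: "carrier (max_subgroup T (f e)) \<subseteq> f ` carrier S"
  shows "max_subgroup S e \<cong> max_subgroup T (f e)"
proof -
  interpret S: inverse_semigroup S by fact
  interpret T: inverse_semigroup T by fact
  note I = S.max_subgroup_sinv_iff[OF e] T.max_subgroup_sinv_iff[OF hom_idem[OF f(1) e]]
  have eq: "f s \<in> carrier (max_subgroup T (f e)) \<longleftrightarrow> s \<in> carrier (max_subgroup S e)"
    if s: "s \<in> carrier S" for s
  proof -
    have "f s \<otimes>\<^bsub>T\<^esub> sinv T (f s) = f (s \<otimes>\<^bsub>S\<^esub> sinv S s)" "sinv T (f s) \<otimes>\<^bsub>T\<^esub> f s = f (sinv S s \<otimes>\<^bsub>S\<^esub> s)"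
      using s f(1) by (simp_all add: hom_mult S.sinv_closed flip: hom_sinv[OF S T f(1)])
    then show ?thesis
      using s f inj_on_eq_iff[OF f(2)] S.m_closed S.sinv_closed S.idem_closed[OF e]
      by (simp add: I hom_in_carrier)
  qed
  have "f ` carrier (max_subgroup S e) = carrier (max_subgroup T (f e))"
  proof (intro equalityI subsetI)
    fix x assume x: "x \<in> carrier (max_subgroup T (f e))"
    then obtain s where "s \<in> carrier S" "x = f s" using sub by blast
    then show "x \<in> f ` carrier (max_subgroup S e)" using x eq by blast
  next
    fix x assume "x \<in> f ` carrier (max_subgroup S e)"
    then show "x \<in> carrier (max_subgroup T (f e))" using eq I(1) by blast
  qed
  moreover have "carrier (max_subgroup S e) \<subseteq> carrier S" using I(1) by blast
  ultimately have "bij_betw f (carrier (max_subgroup S e)) (carrier (max_subgroup T (f e)))"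
    using f(2) inj_on_subset by (auto simp: bij_betw_def)
  moreover have "f \<in> hom (max_subgroup S e) (max_subgroup T (f e))"
  proof (rule homI)
    fix x y assume "x \<in> carrier (max_subgroup S e)" "y \<in> carrier (max_subgroup S e)"
    then show "f (x \<otimes>\<^bsub>max_subgroup S e\<^esub> y) = f x \<otimes>\<^bsub>max_subgroup T (f e)\<^esub> f y"
      using f(1) I(1) by (simp add: max_subgroup_def hom_mult)
  qed (use eq I(1) in blast)
  ultimately show ?thesis unfolding is_iso_def iso_def by blast
qed

section \<open>Actions by partial bijections\<close>

text \<open>Elements act from the right: in \<open>M a O M b\<close> the element \<open>a\<close>
  acts first. Since the converse of \<open>M a\<close> is the single-valued
  \<open>M (sinv S a)\<close>, each \<open>M a\<close> is a partial injection.\<close>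

definition partial_action :: "('a, 'm) monoid_scheme \<Rightarrow> ('a \<Rightarrow> 'o rel) \<Rightarrow> bool" where
  "partial_action S M \<longleftrightarrow>
    (\<forall>a\<in>carrier S. single_valued (M a) \<and> M (sinv S a) = (M a)\<inverse>) \<and>
    (\<forall>a\<in>carrier S. \<forall>b\<in>carrier S. M (a \<otimes>\<^bsub>S\<^esub> b) = M a O M b)"

lemma partial_action_hom:
  assumes "inverse_semigroup S" "inverse_semigroup T" "f \<in> hom S T" "partial_action T M"
  shows "partial_action S (\<lambda>a. M (f a))"
  using assms(3,4) hom_sinv[OF assms(1-3)] inverse_semigroup.m_closed[OF assms(1)]
  by (auto simp: partial_action_def hom_in_carrier hom_mult)

text \<open>The map \<open>c\<close> recovers the index from a point. The point sets of the
  different \<open>M k\<close> are thus disjoint, and no composite can pass from one to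
  another.\<close>

lemma partial_action_UN:
  assumes M: "\<And>k. k \<in> K \<Longrightarrow> partial_action S (M k)" and S: "inverse_semigroup S"
    and c: "\<And>k a x y. k \<in> K \<Longrightarrow> a \<in> carrier S \<Longrightarrow> (x, y) \<in> M k a \<Longrightarrow> c x = k \<and> c y = k"
  shows "partial_action S (\<lambda>a. \<Union>k\<in>K. M k a)"
  unfolding partial_action_def
proof (intro conjI ballI)
  fix a assume a: "a \<in> carrier S"
  show "single_valued (\<Union>k\<in>K. M k a)"
  proof (rule single_valuedI)
    fix x y z assume "(x, y) \<in> (\<Union>k\<in>K. M k a)" "(x, z) \<in> (\<Union>k\<in>K. M k a)"
    then obtain k k' where k: "k \<in> K" "(x, y) \<in> M k a" "k' \<in> K" "(x, z) \<in> M k' a" by blast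
    then have "k = k'" using c[OF k(1) a k(2)] c[OF k(3) a k(4)] by simp
    then show "y = z" using M[OF k(1)] k a by (auto simp: partial_action_def single_valued_def)
  qed
  show "(\<Union>k\<in>K. M k (sinv S a)) = (\<Union>k\<in>K. M k a)\<inverse>"
    using M a unfolding partial_action_def by auto
next
  fix a b assume ab: "a \<in> carrier S" "b \<in> carrier S"
  have "M k (a \<otimes>\<^bsub>S\<^esub> b) = M k a O M k b" if "k \<in> K" for k
    using M[OF that] ab by (simp add: partial_action_def)
  moreover have "(\<Union>k\<in>K. M k a) O (\<Union>k\<in>K. M k b) = (\<Union>k\<in>K. M k a O M k b)"
  proof (intro equalityI subrelI)
    fix x z assume "(x, z) \<in> (\<Union>k\<in>K. M k a) O (\<Union>k\<in>K. M k b)"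
    then obtain y k k' where k: "k \<in> K" "(x, y) \<in> M k a" "k' \<in> K" "(y, z) \<in> M k' b" by blast
    then have "k = k'" using c[OF k(1) ab(1) k(2)] c[OF k(3) ab(2) k(4)] by simp
    then show "(x, z) \<in> (\<Union>k\<in>K. M k a O M k b)" using k by blast
  qed blast
  ultimately show "(\<Union>k\<in>K. M k (a \<otimes>\<^bsub>S\<^esub> b)) = (\<Union>k\<in>K. M k a) O (\<Union>k\<in>K. M k b)" by simp
qed

text \<open>Invariance of \<open>X\<close> keeps the midpoint of a composite in \<open>X\<close>,
  which multiplicativity requires.\<close>

lemma partial_action_restrict:
  assumes M: "partial_action S M"
    and X: "\<And>a x y. a \<in> carrier S \<Longrightarrow> (x, y) \<in> M a \<Longrightarrow> x \<in> X \<longleftrightarrow> y \<in> X"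
  shows "partial_action S (\<lambda>a. M a \<inter> X \<times> X)"
  unfolding partial_action_def
proof (intro conjI ballI)
  fix a assume a: "a \<in> carrier S"
  show "single_valued (M a \<inter> X \<times> X)" "M (sinv S a) \<inter> X \<times> X = (M a \<inter> X \<times> X)\<inverse>"
    using M a by (auto simp: partial_action_def single_valued_def)
next
  fix a b assume ab: "a \<in> carrier S" "b \<in> carrier S"
  have "M (a \<otimes>\<^bsub>S\<^esub> b) = M a O M b" using M ab by (simp add: partial_action_def)
  moreover have "y \<in> X" if "(x, y) \<in> M a" "x \<in> X" for x y using X[OF ab(1)] that by blast
  ultimately show "M (a \<otimes>\<^bsub>S\<^esub> b) \<inter> X \<times> X = (M a \<inter> X \<times> X) O (M b \<inter> X \<times> X)" by blast
qed

locale inverse_semigroup_action = inverse_semigroup S for S (structure) +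
  fixes M :: "'a \<Rightarrow> 'o rel"
  assumes action: "partial_action S M"
begin

lemma act_unique: "a \<in> carrier S \<Longrightarrow> (x, y) \<in> M a \<Longrightarrow> (x, z) \<in> M a \<Longrightarrow> y = z"
  using action by (auto simp: partial_action_def single_valued_def)

lemma act_sinv: "a \<in> carrier S \<Longrightarrow> (x, y) \<in> M (sinv S a) \<longleftrightarrow> (y, x) \<in> M a"
  using action by (auto simp: partial_action_def)

lemma act_mult: "a \<in> carrier S \<Longrightarrow> b \<in> carrier S \<Longrightarrow> M (a \<otimes> b) = M a O M b"
  using action by (simp add: partial_action_def)

lemma act_multI:
  "(x, y) \<in> M a \<Longrightarrow> (y, z) \<in> M b \<Longrightarrow> a \<in> carrier S \<Longrightarrow> b \<in> carrier S \<Longrightarrow> (x, z) \<in> M (a \<otimes> b)"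
  by (auto simp: act_mult)

text \<open>\<open>M e\<close> is symmetric since \<open>e\<close> is its own inverse, so
  \<open>e e = e\<close> takes \<open>x\<close> over \<open>y\<close> back to \<open>x\<close>;
  single-valuedness then gives \<open>y = x\<close>.\<close>

lemma act_idem:
  assumes e: "e \<in> idempotents S" and xy: "(x, y) \<in> M e"
  shows "x = y"
proof -
  have "(y, x) \<in> M e" using act_sinv[of e y x] e xy idem_closed idem_sinv by simp
  then have "(x, x) \<in> M (e \<otimes> e)" using act_multI xy idem_closed e by blast
  then show ?thesis using act_unique e xy idem_closed idem_idem by metis
qed

lemma act_range: "a \<in> carrier S \<Longrightarrow> (x, y) \<in> M a \<Longrightarrow> (x, x) \<in> M (a \<otimes> sinv S a)"
  using act_multI act_sinv sinv_closed by blast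

lemma act_rangeE:
  assumes "a \<in> carrier S" "(x, x) \<in> M (a \<otimes> sinv S a)" obtains y where "(x, y) \<in> M a"
  using assms by (auto simp: act_mult sinv_closed)

lemma act_mono: assumes "a \<preceq> b" "(x, y) \<in> M a" shows "(x, y) \<in> M b"
proof -
  obtain e where e: "e \<in> idempotents S" "a = e \<otimes> b" using assms by (auto simp: nat_le_def)
  then show ?thesis using assms act_idem[OF e(1)] nat_leD[OF assms(1)] idem_closed
    by (auto simp: act_mult)
qed

end

section \<open>Extending an action of \<open>U\<close> to an action of \<open>S\<close>\<close>

text \<open>
  The points of the extension are the tensors \<open>y \<otimes> s\<close>, with
  \<open>y \<otimes> s = y' \<otimes> s'\<close> iff some \<open>t \<in> U\<close> below \<open>s s'\<^sup>-\<^sup>1\<close> takes \<open>y\<close> to \<open>y'\<close>. A tensor that equals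
  some \<open>y' \<otimes> u\<close> with \<open>u \<in> E(U)\<close> is identified with \<open>y'\<close>; any other is encoded as the list
  \<open>s # y\<close> for a chosen representative, so that new points are longer than old ones.
\<close>

definition tensor_eq :: "('l, 'm) monoid_scheme \<Rightarrow> ('c, 'k) monoid_scheme \<Rightarrow> ('c \<Rightarrow> 'l) \<Rightarrow>
    ('c \<Rightarrow> 'o rel) \<Rightarrow> 'o \<Rightarrow> 'l \<Rightarrow> 'o \<Rightarrow> 'l \<Rightarrow> bool" where
  "tensor_eq S U \<phi> N y s y' s' \<longleftrightarrow> (\<exists>t\<in>carrier U. (y, y') \<in> N t \<and> \<phi> t \<preceq>\<^bsub>S\<^esub> s \<otimes>\<^bsub>S\<^esub> sinv S s')"

definition tensor_old :: "('l, 'm) monoid_scheme \<Rightarrow> ('c, 'k) monoid_scheme \<Rightarrow> ('c \<Rightarrow> 'l) \<Rightarrow>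
    ('c \<Rightarrow> 'o rel) \<Rightarrow> 'o \<Rightarrow> 'l \<Rightarrow> 'o \<Rightarrow> bool" where
  "tensor_old S U \<phi> N y s y' \<longleftrightarrow> (\<exists>t\<in>carrier U. (y, y') \<in> N t \<and> \<phi> t \<preceq>\<^bsub>S\<^esub> s)"

definition tensor :: "('l, 'm) monoid_scheme \<Rightarrow> ('c, 'k) monoid_scheme \<Rightarrow> ('c \<Rightarrow> 'l) \<Rightarrow>
    ('c \<Rightarrow> 'l list rel) \<Rightarrow> 'l list \<Rightarrow> 'l \<Rightarrow> 'l list" where
  "tensor S U \<phi> N y s =
    (if \<exists>y'. tensor_old S U \<phi> N y s y' then SOME y'. tensor_old S U \<phi> N y s y'
     else case SOME (y', s'). s' \<in> carrier S \<and> tensor_eq S U \<phi> N y s y' s' of (y', s') \<Rightarrow> s' # y')"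

text \<open>A tensor y \<otimes> s counts as defined when \<open>tensor_eq\<close> relates it to
  itself, that is, when some idempotent of \<open>U\<close> that fixes \<open>y\<close> has its
  image below \<open>s s^-1\<close>. Definedness of y \<otimes> (s a) implies that of y \<otimes> s,
  so it alone is demanded.\<close>

definition extend_action :: "('l, 'm) monoid_scheme \<Rightarrow> ('c, 'k) monoid_scheme \<Rightarrow> ('c \<Rightarrow> 'l) \<Rightarrow>
    ('c \<Rightarrow> 'l list rel) \<Rightarrow> 'l \<Rightarrow> 'l list rel" where
  "extend_action S U \<phi> N a = {(tensor S U \<phi> N y s, tensor S U \<phi> N y (s \<otimes>\<^bsub>S\<^esub> a)) | y s.
     s \<in> carrier S \<and> tensor_eq S U \<phi> N y (s \<otimes>\<^bsub>S\<^esub> a) y (s \<otimes>\<^bsub>S\<^esub> a)}"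

text \<open>All points of \<open>N\<close> share the length \<open>n\<close>, so that length alone
  tells them from the new points, which have length \<open>n + 1\<close>.\<close>

locale action_extension =
  S: inverse_semigroup S + U: inverse_semigroup_action U N
  for S :: "'l monoid" and U :: "('c, 'k) monoid_scheme" and N :: "'c \<Rightarrow> 'l list rel" +
  fixes \<phi> :: "'c \<Rightarrow> 'l" and n :: nat
  assumes emb: "\<phi> \<in> mon U S"
    and len: "t \<in> carrier U \<Longrightarrow> (y, y') \<in> N t \<Longrightarrow> length y = n \<and> length y' = n"
begin

abbreviation "teq \<equiv> tensor_eq S U \<phi> N"
abbreviation "told \<equiv> tensor_old S U \<phi> N"
abbreviation "ten \<equiv> tensor S U \<phi> N"
abbreviation "ext \<equiv> extend_action S U \<phi> N"

lemma \<phi>_hom: "\<phi> \<in> hom U S" using emb by (simp add: mon_def)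

lemma \<phi>_closed: "t \<in> carrier U \<Longrightarrow> \<phi> t \<in> carrier S" using \<phi>_hom by (rule hom_in_carrier)

lemma \<phi>_mult: "t \<in> carrier U \<Longrightarrow> u \<in> carrier U \<Longrightarrow> \<phi> (t \<otimes>\<^bsub>U\<^esub> u) = \<phi> t \<otimes>\<^bsub>S\<^esub> \<phi> u"
  using \<phi>_hom by (simp add: hom_mult)

lemma \<phi>_sinv: "t \<in> carrier U \<Longrightarrow> \<phi> (sinv U t) = sinv S (\<phi> t)"
  using hom_sinv[OF U.inverse_semigroup_axioms S.inverse_semigroup_axioms \<phi>_hom] .

lemma \<phi>_inj: "t \<in> carrier U \<Longrightarrow> u \<in> carrier U \<Longrightarrow> \<phi> t = \<phi> u \<Longrightarrow> t = u"
  using emb by (auto simp: mon_def inj_on_def)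

lemma \<phi>_idem: "t \<in> carrier U \<Longrightarrow> \<phi> t \<in> idempotents S \<Longrightarrow> t \<in> idempotents U"
  using \<phi>_inj \<phi>_mult U.m_closed by (auto simp: idempotents_def)

text \<open>The idempotent of \<open>S\<close> that witnesses the comparison can be replaced by the
  image of \<open>t t^-1\<close>, which comes from \<open>U\<close>; injectivity of
  \<open>\<phi>\<close> does the rest.\<close>

lemma \<phi>_le_reflect:
  assumes "t \<in> carrier U" "u \<in> carrier U" "\<phi> t \<preceq>\<^bsub>S\<^esub> \<phi> u" shows "t \<preceq>\<^bsub>U\<^esub> u"
proof -
  obtain e where e: "e \<in> idempotents S" "\<phi> t = e \<otimes>\<^bsub>S\<^esub> \<phi> u" using assms by (auto simp: nat_le_def)
  define f where "f = t \<otimes>\<^bsub>U\<^esub> sinv U t"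
  have f: "f \<in> idempotents U" using U.range_idem assms by (simp add: f_def)
  note c = \<phi>_closed[OF assms(1)] \<phi>_closed[OF assms(2)] S.idem_closed[OF e(1)] S.sinv_closed
  have fc: "f \<in> carrier U" using f by (rule U.idem_closed)
  have "\<phi> (f \<otimes>\<^bsub>U\<^esub> u) = \<phi> t \<otimes>\<^bsub>S\<^esub> sinv S (\<phi> t) \<otimes>\<^bsub>S\<^esub> \<phi> u"
    using assms fc by (simp add: f_def \<phi>_mult \<phi>_sinv U.sinv_closed)
  also have "\<dots> = e \<otimes>\<^bsub>S\<^esub> ((\<phi> u \<otimes>\<^bsub>S\<^esub> sinv S (\<phi> u)) \<otimes>\<^bsub>S\<^esub> e) \<otimes>\<^bsub>S\<^esub> \<phi> u"
    using c e by (simp add: S.sinv_mult S.idem_sinv S.m_assoc S.m_closed)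
  also have "\<dots> = e \<otimes>\<^bsub>S\<^esub> (e \<otimes>\<^bsub>S\<^esub> (\<phi> u \<otimes>\<^bsub>S\<^esub> sinv S (\<phi> u))) \<otimes>\<^bsub>S\<^esub> \<phi> u"
    using S.idem_commute[OF e(1) S.range_idem] c by simp
  also have "\<dots> = (e \<otimes>\<^bsub>S\<^esub> e) \<otimes>\<^bsub>S\<^esub> (\<phi> u \<otimes>\<^bsub>S\<^esub> sinv S (\<phi> u) \<otimes>\<^bsub>S\<^esub> \<phi> u)"
    using c by (simp add: S.m_assoc S.m_closed)
  also have "\<dots> = \<phi> t" using e S.idem_idem S.inv1' c by simp
  finally have "f \<otimes>\<^bsub>U\<^esub> u = t" using \<phi>_inj assms fc U.m_closed by blast
  then show ?thesis using f assms U.idem_mult_le by metis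
qed

section \<open>Equality of tensors and their coincidence with old points\<close>

lemma teqI: "t \<in> carrier U \<Longrightarrow> (y, y') \<in> N t \<Longrightarrow> \<phi> t \<preceq>\<^bsub>S\<^esub> s \<otimes>\<^bsub>S\<^esub> sinv S s' \<Longrightarrow> teq y s y' s'"
  by (auto simp: tensor_eq_def)

lemma toldI: "t \<in> carrier U \<Longrightarrow> (y, y') \<in> N t \<Longrightarrow> \<phi> t \<preceq>\<^bsub>S\<^esub> s \<Longrightarrow> told y s y'"
  by (auto simp: tensor_old_def)

lemma teq_sym:
  assumes "teq y s y' s'" "s \<in> carrier S" "s' \<in> carrier S" shows "teq y' s' y s"
proof -
  obtain t where t: "t \<in> carrier U" "(y, y') \<in> N t" "\<phi> t \<preceq>\<^bsub>S\<^esub> s \<otimes>\<^bsub>S\<^esub> sinv S s'"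
    using assms by (auto simp: tensor_eq_def)
  show ?thesis
  proof (rule teqI)
    show "\<phi> (sinv U t) \<preceq>\<^bsub>S\<^esub> s' \<otimes>\<^bsub>S\<^esub> sinv S s"
      using S.nat_le_sinv[OF t(3)] assms t(1)
      by (simp add: \<phi>_sinv S.sinv_mult S.sinv_sinv S.sinv_closed)
  qed (use t U.act_sinv U.sinv_closed in auto)
qed

lemma teq_trans:
  assumes "teq y s y' s'" "teq y' s' y'' s''" "s \<in> carrier S" "s' \<in> carrier S" "s'' \<in> carrier S"
  shows "teq y s y'' s''"
proof -
  obtain t u where t: "t \<in> carrier U" "(y, y') \<in> N t" "\<phi> t \<preceq>\<^bsub>S\<^esub> s \<otimes>\<^bsub>S\<^esub> sinv S s'"
    and u: "u \<in> carrier U" "(y', y'') \<in> N u" "\<phi> u \<preceq>\<^bsub>S\<^esub> s' \<otimes>\<^bsub>S\<^esub> sinv S s''"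
    using assms by (auto simp: tensor_eq_def)
  show ?thesis
  proof (rule teqI)
    show "(y, y'') \<in> N (t \<otimes>\<^bsub>U\<^esub> u)" using t u U.act_multI by blast
    show "\<phi> (t \<otimes>\<^bsub>U\<^esub> u) \<preceq>\<^bsub>S\<^esub> s \<otimes>\<^bsub>S\<^esub> sinv S s''"
      using S.nat_le_cancel[OF t(3) u(3)] t u assms by (simp add: \<phi>_mult S.sinv_closed)
  qed (use t u U.m_closed in auto)
qed

lemma told_teq:
  assumes "told y s z" "teq y s y' s'" "s \<in> carrier S" "s' \<in> carrier S"
  shows "told y' s' z"
proof -
  obtain t where t: "t \<in> carrier U" "(y, z) \<in> N t" "\<phi> t \<preceq>\<^bsub>S\<^esub> s"
    using assms by (auto simp: tensor_old_def)
  obtain u where u: "u \<in> carrier U" "(y', y) \<in> N u" "\<phi> u \<preceq>\<^bsub>S\<^esub> s' \<otimes>\<^bsub>S\<^esub> sinv S s"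
    using teq_sym[OF assms(2-4)] by (auto simp: tensor_eq_def)
  show ?thesis
  proof (rule toldI)
    show "(y', z) \<in> N (u \<otimes>\<^bsub>U\<^esub> t)" using t u U.act_multI by blast
    show "\<phi> (u \<otimes>\<^bsub>U\<^esub> t) \<preceq>\<^bsub>S\<^esub> s'"
      using S.nat_le_cancel_right[OF u(3) t(3)] t u assms by (simp add: \<phi>_mult)
  qed (use t u U.m_closed in auto)
qed

text \<open>If the images of \<open>t\<close> and \<open>u\<close> both lie below \<open>s\<close>,
  then that of \<open>t^-1 u\<close> lies below the idempotent \<open>s^-1 s\<close>. So
  \<open>t^-1 u\<close> is idempotent and cannot move \<open>z\<close> to a different point.\<close>

lemma told_unique:
  assumes "told y s z" "told y s z'" "s \<in> carrier S" shows "z = z'"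
proof -
  obtain t u where t: "t \<in> carrier U" "(y, z) \<in> N t" "\<phi> t \<preceq>\<^bsub>S\<^esub> s"
    and u: "u \<in> carrier U" "(y, z') \<in> N u" "\<phi> u \<preceq>\<^bsub>S\<^esub> s"
    using assms by (auto simp: tensor_old_def)
  have c: "sinv U t \<otimes>\<^bsub>U\<^esub> u \<in> carrier U" using t u U.m_closed U.sinv_closed by blast
  have "\<phi> (sinv U t \<otimes>\<^bsub>U\<^esub> u) \<preceq>\<^bsub>S\<^esub> sinv S s \<otimes>\<^bsub>S\<^esub> s"
    using S.nat_le_mult[OF S.nat_le_sinv[OF t(3)] u(3)] t u by (simp add: \<phi>_mult \<phi>_sinv U.sinv_closed)
  then have "sinv U t \<otimes>\<^bsub>U\<^esub> u \<in> idempotents U"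
    using \<phi>_idem[OF c] S.nat_le_idem S.domain_idem assms(3) by blast
  moreover have "(z, z') \<in> N (sinv U t \<otimes>\<^bsub>U\<^esub> u)"
    using t u U.act_multI U.act_sinv U.sinv_closed by blast
  ultimately show ?thesis using U.act_idem by blast
qed

lemma told_imp_teq:
  assumes "told y s z" "told y' s' z" "s \<in> carrier S" "s' \<in> carrier S" shows "teq y s y' s'"
proof -
  obtain t u where t: "t \<in> carrier U" "(y, z) \<in> N t" "\<phi> t \<preceq>\<^bsub>S\<^esub> s"
    and u: "u \<in> carrier U" "(y', z) \<in> N u" "\<phi> u \<preceq>\<^bsub>S\<^esub> s'"
    using assms by (auto simp: tensor_old_def)
  show ?thesis
  proof (rule teqI)
    show "(y, y') \<in> N (t \<otimes>\<^bsub>U\<^esub> sinv U u)" using t u U.act_multI U.act_sinv U.sinv_closed by blast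
    show "\<phi> (t \<otimes>\<^bsub>U\<^esub> sinv U u) \<preceq>\<^bsub>S\<^esub> s \<otimes>\<^bsub>S\<^esub> sinv S s'"
      using S.nat_le_mult[OF t(3) S.nat_le_sinv[OF u(3)]] t u by (simp add: \<phi>_mult \<phi>_sinv U.sinv_closed)
  qed (use t u U.m_closed U.sinv_closed in auto)
qed

lemma ten_old: "told y s z \<Longrightarrow> s \<in> carrier S \<Longrightarrow> ten y s = z"
  unfolding tensor_def using told_unique by (metis (mono_tags, lifting) someI_ex)

lemma ten_new:
  assumes "teq y s y s" "s \<in> carrier S" "\<nexists>z. told y s z"
  obtains y' s' where "ten y s = s' # y'" "s' \<in> carrier S" "teq y s y' s'"
proof -
  define p where "p = (SOME (y', s'). s' \<in> carrier S \<and> teq y s y' s')"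
  have "case p of (y', s') \<Rightarrow> s' \<in> carrier S \<and> teq y s y' s'"
    unfolding p_def by (rule someI[where x = "(y, s)"]) (use assms in simp)
  then show ?thesis using that assms(3) by (auto simp: tensor_def p_def[symmetric] split: prod.splits)
qed

lemma teq_len: "teq y s y' s' \<Longrightarrow> length y = n \<and> length y' = n"
  using len by (auto simp: tensor_eq_def)

lemma told_len: "told y s y' \<Longrightarrow> length y = n \<and> length y' = n"
  using len by (auto simp: tensor_old_def)

lemma ten_len:
  assumes "teq y s y s" "s \<in> carrier S"
  shows "length (ten y s) = n \<and> told y s (ten y s) \<or> length (ten y s) = Suc n \<and> (\<nexists>z. told y s z)"
proof (cases "\<exists>z. told y s z")
  case True
  then show ?thesis using ten_old assms told_len by blast
next
  case False
  then show ?thesis using ten_new[OF assms False] teq_len by (metis length_Cons)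
qed

text \<open>By \<open>ten_len\<close> the length tells old from new. Equal old values are compared
  by \<open>told_imp_teq\<close>, equal new ones share their chosen representative. Conversely, both
  choices in \<open>tensor\<close> depend on the equivalence class alone.\<close>

lemma ten_eq_iff:
  assumes y: "teq y s y s" "s \<in> carrier S" and y': "teq y' s' y' s'" "s' \<in> carrier S"
  shows "ten y s = ten y' s' \<longleftrightarrow> teq y s y' s'"
proof
  assume eq: "ten y s = ten y' s'"
  show "teq y s y' s'"
  proof (cases "\<exists>z. told y s z")
    case True
    then have "told y s (ten y s)" "told y' s' (ten y s)"
      using ten_len[OF y] ten_len[OF y'] eq by auto
    then show ?thesis using told_imp_teq y y' by blast
  next
    case False
    then have F: "\<nexists>z. told y' s' z" using ten_len[OF y] ten_len[OF y'] eq by auto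
    obtain y1 s1 where "ten y s = s1 # y1" "s1 \<in> carrier S" "teq y s y1 s1"
      using ten_new[OF y False] by blast
    moreover obtain y2 s2 where "ten y' s' = s2 # y2" "s2 \<in> carrier S" "teq y' s' y2 s2"
      using ten_new[OF y' F] by blast
    ultimately show ?thesis using eq y y' teq_trans teq_sym by (metis list.inject)
  qed
next
  assume eq: "teq y s y' s'"
  have "told y s = told y' s'" using told_teq teq_sym eq y y' by blast
  moreover have "(s'' \<in> carrier S \<and> teq y s y'' s'') = (s'' \<in> carrier S \<and> teq y' s' y'' s'')" for y'' s''
    using teq_trans teq_sym eq y y' by blast
  ultimately show "ten y s = ten y' s'" by (simp add: tensor_def)
qed

text \<open>Definedness of y \<otimes> (s a) provides \<open>u\<close> fixing \<open>y\<close> with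
  image below \<open>s a a^-1 s^-1\<close>. Composed with \<open>t\<close> below
  \<open>s s'^-1\<close>, it yields a witness below \<open>s a a^-1 s'^-1\<close>.\<close>

lemma teq_mult:
  assumes "teq y s y' s'" "teq y (s \<otimes>\<^bsub>S\<^esub> a) y (s \<otimes>\<^bsub>S\<^esub> a)"
    "s \<in> carrier S" "s' \<in> carrier S" "a \<in> carrier S"
  shows "teq y (s \<otimes>\<^bsub>S\<^esub> a) y' (s' \<otimes>\<^bsub>S\<^esub> a)"
proof -
  obtain t where t: "t \<in> carrier U" "(y, y') \<in> N t" "\<phi> t \<preceq>\<^bsub>S\<^esub> s \<otimes>\<^bsub>S\<^esub> sinv S s'"
    using assms by (auto simp: tensor_eq_def)
  obtain u where u: "u \<in> carrier U" "(y, y) \<in> N u" "\<phi> u \<preceq>\<^bsub>S\<^esub> (s \<otimes>\<^bsub>S\<^esub> a) \<otimes>\<^bsub>S\<^esub> sinv S (s \<otimes>\<^bsub>S\<^esub> a)"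
    using assms by (auto simp: tensor_eq_def)
  have u': "\<phi> u \<preceq>\<^bsub>S\<^esub> (s \<otimes>\<^bsub>S\<^esub> a \<otimes>\<^bsub>S\<^esub> sinv S a) \<otimes>\<^bsub>S\<^esub> sinv S s"
    using u(3) assms by (simp add: S.sinv_mult S.m_assoc S.m_closed S.sinv_closed)
  show ?thesis
  proof (rule teqI)
    show "(y, y') \<in> N (u \<otimes>\<^bsub>U\<^esub> t)" using t u U.act_multI by blast
    show "\<phi> (u \<otimes>\<^bsub>U\<^esub> t) \<preceq>\<^bsub>S\<^esub> s \<otimes>\<^bsub>S\<^esub> a \<otimes>\<^bsub>S\<^esub> sinv S (s' \<otimes>\<^bsub>S\<^esub> a)"
      using S.nat_le_cancel[OF u' t(3)] t u assms
      by (simp add: \<phi>_mult S.sinv_mult S.m_assoc S.m_closed S.sinv_closed)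
  qed (use t u U.m_closed in auto)
qed

lemma teq_mult_left:
  assumes "teq y (s \<otimes>\<^bsub>S\<^esub> a) y (s \<otimes>\<^bsub>S\<^esub> a)" "s \<in> carrier S" "a \<in> carrier S"
  shows "teq y s y s"
  using assms S.range_mult_le S.nat_le_trans unfolding tensor_eq_def by blast

section \<open>The action on tensors\<close>

lemma extI:
  "s \<in> carrier S \<Longrightarrow> teq y (s \<otimes>\<^bsub>S\<^esub> a) y (s \<otimes>\<^bsub>S\<^esub> a) \<Longrightarrow> (ten y s, ten y (s \<otimes>\<^bsub>S\<^esub> a)) \<in> ext a"
  by (auto simp: extend_action_def)

lemma extE:
  assumes "(x, z) \<in> ext a" "a \<in> carrier S"
  obtains y s where "s \<in> carrier S" "teq y (s \<otimes>\<^bsub>S\<^esub> a) y (s \<otimes>\<^bsub>S\<^esub> a)" "teq y s y s"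
    "x = ten y s" "z = ten y (s \<otimes>\<^bsub>S\<^esub> a)"
  using assms teq_mult_left by (auto simp: extend_action_def)

text \<open>Acting by \<open>a^-1\<close> leads from y \<otimes> (s a) to y \<otimes> (s a a^-1).
  The witness that y \<otimes> (s a) is defined also shows that this tensor equals y \<otimes>
  s.\<close>

lemma ext_sinv:
  assumes "(x, z) \<in> ext a" "a \<in> carrier S" shows "(z, x) \<in> ext (sinv S a)"
proof -
  obtain y s where h: "s \<in> carrier S" "teq y (s \<otimes>\<^bsub>S\<^esub> a) y (s \<otimes>\<^bsub>S\<^esub> a)" "teq y s y s"
    "x = ten y s" "z = ten y (s \<otimes>\<^bsub>S\<^esub> a)"
    using assms by (rule extE)
  let ?r = "s \<otimes>\<^bsub>S\<^esub> a \<otimes>\<^bsub>S\<^esub> sinv S a"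
  note c = assms(2) h(1) S.sinv_closed S.m_closed
  have r: "?r \<in> carrier S" using c by simp
  have "(s \<otimes>\<^bsub>S\<^esub> a) \<otimes>\<^bsub>S\<^esub> sinv S (s \<otimes>\<^bsub>S\<^esub> a) = ?r \<otimes>\<^bsub>S\<^esub> sinv S s"
    using c by (simp add: S.sinv_mult S.m_assoc)
  then have "teq y ?r y s" using h(2) by (simp add: tensor_eq_def)
  moreover from this have "teq y ?r y ?r" using teq_trans teq_sym h(1) r by blast
  ultimately show ?thesis using extI[of "s \<otimes>\<^bsub>S\<^esub> a" y "sinv S a"] ten_eq_iff[of y ?r y s] r h c by simp
qed

lemma partial_action_ext: "partial_action S ext"
  unfolding partial_action_def
proof (intro conjI ballI)
  fix a assume a: "a \<in> carrier S"
  show "single_valued (ext a)"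
  proof (rule single_valuedI)
    fix x z z' assume "(x, z) \<in> ext a" "(x, z') \<in> ext a"
    then obtain y s y' s' where h: "s \<in> carrier S" "teq y (s \<otimes>\<^bsub>S\<^esub> a) y (s \<otimes>\<^bsub>S\<^esub> a)" "teq y s y s"
      "x = ten y s" "z = ten y (s \<otimes>\<^bsub>S\<^esub> a)" "s' \<in> carrier S" "teq y' (s' \<otimes>\<^bsub>S\<^esub> a) y' (s' \<otimes>\<^bsub>S\<^esub> a)"
      "teq y' s' y' s'" "x = ten y' s'" "z' = ten y' (s' \<otimes>\<^bsub>S\<^esub> a)"
      using a by (elim extE) blast
    have "teq y s y' s'" using ten_eq_iff[of y s y' s'] h by simp
    then show "z = z'" using teq_mult ten_eq_iff h a S.m_closed by blast
  qed
  show "ext (sinv S a) = (ext a)\<inverse>"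
    using ext_sinv a ext_sinv[of _ _ "sinv S a"] by (auto simp: S.sinv_closed S.sinv_sinv)
next
  fix a b assume ab: "a \<in> carrier S" "b \<in> carrier S"
  show "ext (a \<otimes>\<^bsub>S\<^esub> b) = ext a O ext b"
  proof (intro equalityI subrelI)
    fix x z assume "(x, z) \<in> ext (a \<otimes>\<^bsub>S\<^esub> b)"
    then obtain y s where h: "s \<in> carrier S"
      "teq y (s \<otimes>\<^bsub>S\<^esub> a \<otimes>\<^bsub>S\<^esub> b) y (s \<otimes>\<^bsub>S\<^esub> a \<otimes>\<^bsub>S\<^esub> b)" "x = ten y s" "z = ten y (s \<otimes>\<^bsub>S\<^esub> a \<otimes>\<^bsub>S\<^esub> b)"
      using ab by (elim extE) (auto simp: S.m_closed S.m_assoc)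
    moreover have "teq y (s \<otimes>\<^bsub>S\<^esub> a) y (s \<otimes>\<^bsub>S\<^esub> a)" using teq_mult_left h ab S.m_closed by blast
    ultimately show "(x, z) \<in> ext a O ext b" using extI ab S.m_closed by blast
  next
    fix x z assume "(x, z) \<in> ext a O ext b"
    then obtain x' where "(x, x') \<in> ext a" "(x', z) \<in> ext b" by blast
    then obtain y s y' s' where h: "s \<in> carrier S" "teq y (s \<otimes>\<^bsub>S\<^esub> a) y (s \<otimes>\<^bsub>S\<^esub> a)"
      "x = ten y s" "x' = ten y (s \<otimes>\<^bsub>S\<^esub> a)" "s' \<in> carrier S" "teq y' (s' \<otimes>\<^bsub>S\<^esub> b) y' (s' \<otimes>\<^bsub>S\<^esub> b)"
      "teq y' s' y' s'" "x' = ten y' s'" "z = ten y' (s' \<otimes>\<^bsub>S\<^esub> b)"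
      using ab by (elim extE) blast
    note sa = S.m_closed[OF h(1) ab(1)]
    \<comment> \<open>The midpoint has two representatives. By \<open>teq_mult\<close> the action of
      \<open>b\<close> can be moved from the second to the first, where it continues that of
      \<open>a\<close>.\<close>
    have "teq y' s' y (s \<otimes>\<^bsub>S\<^esub> a)" using ten_eq_iff[of y' s' y "s \<otimes>\<^bsub>S\<^esub> a"] h sa by simp
    then have t: "teq y' (s' \<otimes>\<^bsub>S\<^esub> b) y (s \<otimes>\<^bsub>S\<^esub> a \<otimes>\<^bsub>S\<^esub> b)" using teq_mult h ab sa by blast
    moreover from this have t': "teq y (s \<otimes>\<^bsub>S\<^esub> a \<otimes>\<^bsub>S\<^esub> b) y (s \<otimes>\<^bsub>S\<^esub> a \<otimes>\<^bsub>S\<^esub> b)"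
      using teq_sym teq_trans h sa ab S.m_closed by meson
    ultimately have "z = ten y (s \<otimes>\<^bsub>S\<^esub> a \<otimes>\<^bsub>S\<^esub> b)"
      using ten_eq_iff h sa ab S.m_closed by simp
    then show "(x, z) \<in> ext (a \<otimes>\<^bsub>S\<^esub> b)"
      using extI[OF h(1), of y "a \<otimes>\<^bsub>S\<^esub> b"] t' h ab by (simp add: S.m_assoc)
  qed
qed

sublocale E: inverse_semigroup_action S ext
  by unfold_locales (rule partial_action_ext)

section \<open>Old and new points of the extension\<close>

lemma ext_len:
  assumes "a \<in> carrier S" "(x, z) \<in> ext a"
  shows "(length x = n \<or> length x = Suc n) \<and> (length z = n \<or> length z = Suc n)"
  using assms(2,1)
proof (rule extE)
  fix y s assume "s \<in> carrier S" "teq y (s \<otimes>\<^bsub>S\<^esub> a) y (s \<otimes>\<^bsub>S\<^esub> a)" "teq y s y s"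
    "x = ten y s" "z = ten y (s \<otimes>\<^bsub>S\<^esub> a)"
  then show ?thesis using ten_len S.m_closed assms(1) by metis
qed

text \<open>Both ends being old, they are reached from a common \<open>y\<close> by some
  \<open>t\<close> below \<open>s\<close> and some \<open>u\<close> below \<open>s a\<close>, both
  in \<open>U\<close>. Then \<open>t^-1 u\<close> takes \<open>x\<close> to \<open>z\<close>, and
  its image lies below \<open>s^-1 s a\<close>, hence below \<open>a\<close>.\<close>

lemma ext_tight:
  assumes a: "a \<in> carrier S" and xz: "(x, z) \<in> ext a" and "length x = n" "length z = n"
  obtains t where "t \<in> carrier U" "(x, z) \<in> N t" "\<phi> t \<preceq>\<^bsub>S\<^esub> a"
  using xz a
proof (rule extE)
  fix y s assume h: "s \<in> carrier S" "teq y (s \<otimes>\<^bsub>S\<^esub> a) y (s \<otimes>\<^bsub>S\<^esub> a)" "teq y s y s"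
    "x = ten y s" "z = ten y (s \<otimes>\<^bsub>S\<^esub> a)"
  have "told y s x" "told y (s \<otimes>\<^bsub>S\<^esub> a) z"
    using ten_len[OF h(3,1)] ten_len[OF h(2) S.m_closed] h assms by auto
  then obtain t u where t: "t \<in> carrier U" "(y, x) \<in> N t" "\<phi> t \<preceq>\<^bsub>S\<^esub> s"
    and u: "u \<in> carrier U" "(y, z) \<in> N u" "\<phi> u \<preceq>\<^bsub>S\<^esub> s \<otimes>\<^bsub>S\<^esub> a"
    by (auto simp: tensor_old_def)
  show thesis
  proof (rule that)
    show "(x, z) \<in> N (sinv U t \<otimes>\<^bsub>U\<^esub> u)" using t u U.act_multI U.act_sinv U.sinv_closed by blast
    show "\<phi> (sinv U t \<otimes>\<^bsub>U\<^esub> u) \<preceq>\<^bsub>S\<^esub> a"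
      using S.nat_le_cancel_left[OF S.nat_le_sinv[OF t(3)] u(3)] t u a h(1)
      by (simp add: \<phi>_mult \<phi>_sinv U.sinv_closed)
  qed (use t u U.m_closed U.sinv_closed in auto)
qed

text \<open>The old point \<open>x\<close> is the tensor of \<open>x\<close> with
  \<open>\<phi> (t t^-1)\<close>, on which \<open>\<phi> t\<close> acts by right
  multiplication.\<close>

lemma N_imp_ext:
  assumes t: "t \<in> carrier U" and N: "(x, z) \<in> N t" shows "(x, z) \<in> ext (\<phi> t)"
proof -
  let ?e = "t \<otimes>\<^bsub>U\<^esub> sinv U t"
  have e: "?e \<in> carrier U" using t U.m_closed U.sinv_closed by blast
  have et: "\<phi> ?e \<otimes>\<^bsub>S\<^esub> \<phi> t = \<phi> t" using t e \<phi>_mult[OF e t] U.inv1' by simp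
  have told: "told x (\<phi> ?e) x" "told x (\<phi> t) z"
    using t e N U.act_range S.nat_le_refl \<phi>_closed by (blast intro: toldI)+
  have "teq x (\<phi> t) x (\<phi> t)" using told_imp_teq told(2) t \<phi>_closed by blast
  then have "(ten x (\<phi> ?e), ten x (\<phi> t)) \<in> ext (\<phi> t)" using extI[of "\<phi> ?e" x "\<phi> t"] e \<phi>_closed et by simp
  then show ?thesis using ten_old told e t \<phi>_closed by simp
qed

text \<open>The extension adds nothing to the action of \<open>U\<close> on old points:
  \<open>ext_tight\<close> gives some \<open>u\<close> fixing \<open>x\<close> with image below that
  of \<open>t t^-1\<close>, and \<open>\<phi>\<close> reflects the order, so \<open>t\<close> was
  already defined at \<open>x\<close>.\<close>

lemma ext_\<phi>_old:
  assumes t: "t \<in> carrier U" and x: "length x = n"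
  shows "(x, z) \<in> ext (\<phi> t) \<longleftrightarrow> (x, z) \<in> N t"
proof
  assume xz: "(x, z) \<in> ext (\<phi> t)"
  let ?e = "t \<otimes>\<^bsub>U\<^esub> sinv U t"
  have e: "?e \<in> carrier U" using t U.m_closed U.sinv_closed by blast
  have "(x, x) \<in> ext (\<phi> ?e)"
    using E.act_range xz t \<phi>_closed \<phi>_mult \<phi>_sinv U.sinv_closed by metis
  then obtain u where "u \<in> carrier U" "(x, x) \<in> N u" "\<phi> u \<preceq>\<^bsub>S\<^esub> \<phi> ?e"
    using ext_tight[of "\<phi> ?e" x x] x e \<phi>_closed by blast
  then have "(x, x) \<in> N ?e" using \<phi>_le_reflect U.act_mono e by blast
  then obtain z' where "(x, z') \<in> N t" using U.act_rangeE t by blast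
  then show "(x, z) \<in> N t" using N_imp_ext E.act_unique xz t \<phi>_closed by blast
qed (use N_imp_ext t in blast)

text \<open>By \<open>ext_\<phi>_old\<close>, for \<open>t\<close> and its inverse, an old point is
  linked by \<open>U\<close> to old points only. Hence \<open>U\<close> acts on the new points by
  themselves, ready for the next extension.\<close>

lemma ext_\<phi>_new:
  assumes t: "t \<in> carrier U" and xz: "(x, z) \<in> ext (\<phi> t)"
  shows "length x = Suc n \<longleftrightarrow> length z = Suc n"
proof -
  have zx: "(z, x) \<in> ext (\<phi> (sinv U t))" using t xz \<phi>_sinv ext_sinv \<phi>_closed by simp
  have "length z = n" if "length x = n" using ext_\<phi>_old[OF t that] xz len[OF t] by blast
  moreover have "length x = n" if "length z = n"
    using ext_\<phi>_old[OF U.sinv_closed[OF t] that] zx len[OF U.sinv_closed[OF t]] by blast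
  ultimately show ?thesis using ext_len[OF \<phi>_closed[OF t] xz] by auto
qed

text \<open>The point \<open>x\<close> is some y \<otimes> s. An idempotent \<open>\<phi> t\<close>
  below \<open>s s^-1\<close> satisfies y \<otimes> \<phi> t = \<open>y\<close>, an old point, and
  \<open>s\<close> takes this tensor to y \<otimes> (\<phi> t s) = y \<otimes> s.\<close>

lemma ext_generated:
  assumes a: "a \<in> carrier S" and xz: "(x, z) \<in> ext a" and x: "length x = Suc n"
  obtains y s where "s \<in> carrier S" "length y = n" "(y, x) \<in> ext s"
  using xz a
proof (rule extE)
  fix y s assume h: "s \<in> carrier S" "teq y s y s" "x = ten y s"
  then obtain t where t: "t \<in> carrier U" "(y, y) \<in> N t" "\<phi> t \<preceq>\<^bsub>S\<^esub> s \<otimes>\<^bsub>S\<^esub> sinv S s"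
    by (auto simp: tensor_eq_def)
  have ti: "\<phi> t \<in> idempotents S" using S.nat_le_idem[OF t(3)] S.range_idem h by blast
  note c = \<phi>_closed[OF t(1)] h(1) S.sinv_closed[OF h(1)]
  have "\<phi> t \<otimes>\<^bsub>S\<^esub> \<phi> t \<preceq>\<^bsub>S\<^esub> \<phi> t \<otimes>\<^bsub>S\<^esub> (s \<otimes>\<^bsub>S\<^esub> sinv S s)"
    using S.nat_le_mult[OF S.nat_le_refl t(3)] c by blast
  then have "\<phi> t \<preceq>\<^bsub>S\<^esub> (\<phi> t \<otimes>\<^bsub>S\<^esub> s) \<otimes>\<^bsub>S\<^esub> sinv S s"
    using S.idem_idem[OF ti] c by (simp add: S.m_assoc)
  then have e: "teq y (\<phi> t \<otimes>\<^bsub>S\<^esub> s) y s" using t teqI by blast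
  then have "teq y (\<phi> t \<otimes>\<^bsub>S\<^esub> s) y (\<phi> t \<otimes>\<^bsub>S\<^esub> s)" using teq_trans teq_sym c S.m_closed by blast
  then have "(ten y (\<phi> t), ten y (\<phi> t \<otimes>\<^bsub>S\<^esub> s)) \<in> ext s" "ten y (\<phi> t \<otimes>\<^bsub>S\<^esub> s) = ten y s"
    using extI ten_eq_iff e h c S.m_closed by auto
  moreover have "ten y (\<phi> t) = y" using ten_old toldI[OF t(1,2)] S.nat_le_refl c by blast
  ultimately show thesis using that[OF h(1)] teq_len[OF h(2)] h(3) by metis
qed

end

section \<open>The tree of lobes\<close>

text \<open>
  Starting from the right regular representation of \<open>S b\<close> by partial bijections, the action of
  \<open>U\<close> on the points last added is extended alternately to \<open>S (\<not> b)\<close> and to \<open>S b\<close>. Points are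
  lists; those of length \<open>n + 1\<close> are the new ones of block \<open>n\<close> and the old ones of block \<open>n + 1\<close>.
\<close>

locale lobe_tree =
  U: inverse_semigroup U for U :: "('c, 'k) monoid_scheme" +
  fixes S :: "bool \<Rightarrow> 'l monoid" and \<phi> :: "bool \<Rightarrow> 'c \<Rightarrow> 'l" and b :: bool
  assumes inverse_semigroup_S: "inverse_semigroup (S i)" and emb: "\<phi> i \<in> mon U (S i)"
begin

sublocale S: inverse_semigroup "S i" for i by (rule inverse_semigroup_S)

definition side :: "nat \<Rightarrow> bool" where
  "side n \<longleftrightarrow> (even n \<longleftrightarrow> b)"

text \<open>This is the Wagner-Preston representation: the condition says that \<open>x^-1 x\<close>
  lies below \<open>a a^-1\<close>, and on such \<open>x\<close> right translation by
  \<open>a\<close> is injective.\<close>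

definition base_action :: "'l \<Rightarrow> 'l list rel" where
  "base_action a = {([x], [x \<otimes>\<^bsub>S b\<^esub> a]) | x.
     x \<in> carrier (S b) \<and> x \<otimes>\<^bsub>S b\<^esub> a \<otimes>\<^bsub>S b\<^esub> sinv (S b) a = x}"

primrec block :: "nat \<Rightarrow> 'l \<Rightarrow> 'l list rel" where
  "block 0 = base_action"
| "block (Suc n) = extend_action (S (side (Suc n))) U (\<phi> (side (Suc n)))
     (\<lambda>u. block n (\<phi> (side n) u) \<inter> {x. length x = Suc n} \<times> {x. length x = Suc n})"

text \<open>The action of \<open>U\<close> on the points that are new in block \<open>n\<close>. It
  depends on \<open>block\<close>, so the recursion there spells it out and \<open>block_Suc\<close>
  folds it back.\<close>

definition layer :: "nat \<Rightarrow> 'c \<Rightarrow> 'l list rel" where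
  "layer n u = block n (\<phi> (side n) u) \<inter> {x. length x = Suc n} \<times> {x. length x = Suc n}"

definition tree_action :: "bool \<Rightarrow> 'l \<Rightarrow> 'l list rel" where
  "tree_action i a = (\<Union>n\<in>{n. side n = i}. block n a)"

lemma block_Suc:
  "block (Suc n) = extend_action (S (side (Suc n))) U (\<phi> (side (Suc n))) (layer n)"
  by (simp add: layer_def[abs_def])

lemma \<phi>_hom: "\<phi> i \<in> hom U (S i)" using emb by (simp add: mon_def)

lemma \<phi>_closed: "u \<in> carrier U \<Longrightarrow> \<phi> i u \<in> carrier (S i)" using \<phi>_hom by (rule hom_in_carrier)

section \<open>The root lobe\<close>

lemma base_action_sinv:
  assumes a: "a \<in> carrier (S b)" and xz: "(x, z) \<in> base_action a"
  shows "(z, x) \<in> base_action (sinv (S b) a)"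
proof -
  obtain y where y: "x = [y]" "z = [y \<otimes>\<^bsub>S b\<^esub> a]" "y \<in> carrier (S b)"
    "y \<otimes>\<^bsub>S b\<^esub> a \<otimes>\<^bsub>S b\<^esub> sinv (S b) a = y"
    using xz by (auto simp: base_action_def)
  then show ?thesis
    using a S.m_closed by (auto simp: base_action_def S.sinv_sinv intro!: exI[where x = "y \<otimes>\<^bsub>S b\<^esub> a"])
qed

lemma partial_action_base: "partial_action (S b) base_action"
  unfolding partial_action_def
proof (intro conjI ballI)
  fix a assume a: "a \<in> carrier (S b)"
  show "single_valued (base_action a)" by (auto simp: base_action_def single_valued_def)
  show "base_action (sinv (S b) a) = (base_action a)\<inverse>"
    using base_action_sinv a base_action_sinv[of "sinv (S b) a"] by (auto simp: S.sinv_closed S.sinv_sinv)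
next
  fix a c assume ac: "a \<in> carrier (S b)" "c \<in> carrier (S b)"
  let ?i = "sinv (S b)"
  \<comment> \<open>The composite imposes a domain condition for \<open>a\<close> at
    \<open>x\<close> and another for \<open>c\<close> at \<open>x a\<close>, the product a single
    one. \<open>fwd\<close> derives the two from the one by commuting \<open>c c^-1\<close> with
    \<open>a^-1 a\<close>; \<open>bwd\<close> substitutes one into the other.\<close>
  have fwd: "x \<otimes>\<^bsub>S b\<^esub> a \<otimes>\<^bsub>S b\<^esub> ?i a = x \<and> x \<otimes>\<^bsub>S b\<^esub> a \<otimes>\<^bsub>S b\<^esub> c \<otimes>\<^bsub>S b\<^esub> ?i c = x \<otimes>\<^bsub>S b\<^esub> a"
    if x: "x \<in> carrier (S b)" and e: "x \<otimes>\<^bsub>S b\<^esub> (a \<otimes>\<^bsub>S b\<^esub> c) \<otimes>\<^bsub>S b\<^esub> ?i (a \<otimes>\<^bsub>S b\<^esub> c) = x" for x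
  proof -
    note cl = ac x S.sinv_closed[OF ac(1)] S.sinv_closed[OF ac(2)] S.m_closed
    have e': "x = x \<otimes>\<^bsub>S b\<^esub> a \<otimes>\<^bsub>S b\<^esub> c \<otimes>\<^bsub>S b\<^esub> ?i c \<otimes>\<^bsub>S b\<^esub> ?i a"
      using e cl by (simp add: S.sinv_mult S.m_assoc)
    have "x \<otimes>\<^bsub>S b\<^esub> a \<otimes>\<^bsub>S b\<^esub> ?i a =
      x \<otimes>\<^bsub>S b\<^esub> a \<otimes>\<^bsub>S b\<^esub> c \<otimes>\<^bsub>S b\<^esub> ?i c \<otimes>\<^bsub>S b\<^esub> (?i a \<otimes>\<^bsub>S b\<^esub> a \<otimes>\<^bsub>S b\<^esub> ?i a)"
      by (subst e') (use cl in \<open>simp add: S.m_assoc\<close>)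
    also have "\<dots> = x" using S.inv2'[OF ac(1)] e' by simp
    finally have 1: "x \<otimes>\<^bsub>S b\<^esub> a \<otimes>\<^bsub>S b\<^esub> ?i a = x" .
    have "x \<otimes>\<^bsub>S b\<^esub> a = x \<otimes>\<^bsub>S b\<^esub> a \<otimes>\<^bsub>S b\<^esub> ((c \<otimes>\<^bsub>S b\<^esub> ?i c) \<otimes>\<^bsub>S b\<^esub> (?i a \<otimes>\<^bsub>S b\<^esub> a))"
      by (subst e') (use cl in \<open>simp add: S.m_assoc\<close>)
    also have "\<dots> = x \<otimes>\<^bsub>S b\<^esub> a \<otimes>\<^bsub>S b\<^esub> ((?i a \<otimes>\<^bsub>S b\<^esub> a) \<otimes>\<^bsub>S b\<^esub> (c \<otimes>\<^bsub>S b\<^esub> ?i c))"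
      using S.idem_commute[OF S.range_idem[OF ac(2)] S.domain_idem[OF ac(1)]] by simp
    also have "\<dots> = (x \<otimes>\<^bsub>S b\<^esub> a \<otimes>\<^bsub>S b\<^esub> ?i a) \<otimes>\<^bsub>S b\<^esub> a \<otimes>\<^bsub>S b\<^esub> c \<otimes>\<^bsub>S b\<^esub> ?i c"
      using cl by (simp add: S.m_assoc)
    finally show ?thesis using 1 by simp
  qed
  have bwd: "x \<otimes>\<^bsub>S b\<^esub> (a \<otimes>\<^bsub>S b\<^esub> c) \<otimes>\<^bsub>S b\<^esub> ?i (a \<otimes>\<^bsub>S b\<^esub> c) = x"
    if x: "x \<in> carrier (S b)" and 1: "x \<otimes>\<^bsub>S b\<^esub> a \<otimes>\<^bsub>S b\<^esub> ?i a = x"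
      and 2: "x \<otimes>\<^bsub>S b\<^esub> a \<otimes>\<^bsub>S b\<^esub> c \<otimes>\<^bsub>S b\<^esub> ?i c = x \<otimes>\<^bsub>S b\<^esub> a" for x
  proof -
    have "x \<otimes>\<^bsub>S b\<^esub> (a \<otimes>\<^bsub>S b\<^esub> c) \<otimes>\<^bsub>S b\<^esub> ?i (a \<otimes>\<^bsub>S b\<^esub> c) =
      (x \<otimes>\<^bsub>S b\<^esub> a \<otimes>\<^bsub>S b\<^esub> c \<otimes>\<^bsub>S b\<^esub> ?i c) \<otimes>\<^bsub>S b\<^esub> ?i a"
      using ac x by (simp add: S.sinv_mult S.m_assoc S.m_closed S.sinv_closed)
    then show ?thesis unfolding 2 1 .
  qed
  show "base_action (a \<otimes>\<^bsub>S b\<^esub> c) = base_action a O base_action c"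
  proof (intro equalityI subrelI)
    fix y z assume "(y, z) \<in> base_action (a \<otimes>\<^bsub>S b\<^esub> c)"
    then obtain x where x: "y = [x]" "z = [x \<otimes>\<^bsub>S b\<^esub> (a \<otimes>\<^bsub>S b\<^esub> c)]" "x \<in> carrier (S b)"
      "x \<otimes>\<^bsub>S b\<^esub> (a \<otimes>\<^bsub>S b\<^esub> c) \<otimes>\<^bsub>S b\<^esub> ?i (a \<otimes>\<^bsub>S b\<^esub> c) = x"
      by (auto simp: base_action_def)
    have "(y, [x \<otimes>\<^bsub>S b\<^esub> a]) \<in> base_action a" "([x \<otimes>\<^bsub>S b\<^esub> a], z) \<in> base_action c"
      using fwd[OF x(3,4)] x ac by (auto simp: base_action_def S.m_assoc S.m_closed)
    then show "(y, z) \<in> base_action a O base_action c" by blast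
  next
    fix y z assume "(y, z) \<in> base_action a O base_action c"
    then obtain x where "y = [x]" "z = [x \<otimes>\<^bsub>S b\<^esub> a \<otimes>\<^bsub>S b\<^esub> c]" "x \<in> carrier (S b)"
      "x \<otimes>\<^bsub>S b\<^esub> a \<otimes>\<^bsub>S b\<^esub> ?i a = x" "x \<otimes>\<^bsub>S b\<^esub> a \<otimes>\<^bsub>S b\<^esub> c \<otimes>\<^bsub>S b\<^esub> ?i c = x \<otimes>\<^bsub>S b\<^esub> a"
      by (auto simp: base_action_def)
    then show "(y, z) \<in> base_action (a \<otimes>\<^bsub>S b\<^esub> c)"
      using bwd ac by (auto simp: base_action_def S.m_assoc)
  qed
qed

section \<open>The blocks and their union\<close>

text \<open>One induction for all three properties: that \<open>U\<close> keeps new points new makes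
  \<open>layer n\<close> an action of \<open>U\<close>, and this in turn permits the extension to
  the next block.\<close>

lemma block_props:
  "partial_action (S (side n)) (block n) \<and>
   (\<forall>a\<in>carrier (S (side n)). \<forall>(x, z)\<in>block n a.
      length x \<in> {n, Suc n} \<and> length z \<in> {n, Suc n} \<and> x \<noteq> [] \<and> z \<noteq> []) \<and>
   (\<forall>u\<in>carrier U. \<forall>(x, z)\<in>block n (\<phi> (side n) u). length x = Suc n \<longleftrightarrow> length z = Suc n)"
  (is "?A n \<and> ?B n \<and> ?C n")
proof (induction n)
  case 0
  show ?case using partial_action_base by (auto simp: side_def) (auto simp: base_action_def)
next
  case (Suc n)
  have "partial_action U (layer n)"
    unfolding layer_def[abs_def]
    by (rule partial_action_restrict)
      (use Suc partial_action_hom[OF U.inverse_semigroup_axioms inverse_semigroup_S \<phi>_hom] in auto)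
  then interpret action_extension "S (side (Suc n))" U "layer n" "\<phi> (side (Suc n))" "Suc n"
    by unfold_locales (auto simp: layer_def emb)
  have "length x \<in> {Suc n, Suc (Suc n)} \<and> length z \<in> {Suc n, Suc (Suc n)} \<and> x \<noteq> [] \<and> z \<noteq> []"
    if "a \<in> carrier (S (side (Suc n)))" "(x, z) \<in> ext a" for a x z
    using ext_len[OF that] by auto
  then show ?case
    unfolding block_Suc using partial_action_ext ext_\<phi>_new by blast
qed

lemma partial_action_block: "partial_action (S (side n)) (block n)"
  using block_props by blast

lemma block_length:
  assumes "a \<in> carrier (S (side n))" "(x, z) \<in> block n a"
  shows "length x \<in> {n, Suc n}" "length z \<in> {n, Suc n}" "x \<noteq> []" "z \<noteq> []"
  using bspec[OF block_props[THEN conjunct2, THEN conjunct1] assms(1)] assms(2) by auto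

lemma partial_action_layer: "partial_action U (layer n)"
  unfolding layer_def[abs_def]
  by (rule partial_action_restrict)
    (use block_props[of n] partial_action_hom[OF U.inverse_semigroup_axioms inverse_semigroup_S \<phi>_hom]
      in auto)

sublocale X: action_extension "S (side (Suc n))" U "layer n" "\<phi> (side (Suc n))" "Suc n" for n
  by unfold_locales (auto simp: layer_def emb partial_action_layer)

sublocale B: inverse_semigroup_action "S (side n)" "block n" for n
  by unfold_locales (rule partial_action_block)

lemma partial_action_tree: "partial_action (S i) (tree_action i)"
  unfolding tree_action_def[abs_def]
\<comment> \<open>Blocks of the same factor have indices of equal parity, and points of block
  \<open>n\<close> have length \<open>n\<close> or \<open>n + 1\<close>. The parity of the length
  thus decides which of the two it is.\<close>
proof (rule partial_action_UN[where
      c = "\<lambda>x. if even (length x) = (i = b) then length x else length x - 1"])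
  fix n a x z assume h: "n \<in> {n. side n = i}" "a \<in> carrier (S i)" "(x, z) \<in> block n a"
  then have "length x \<in> {n, Suc n}" "length z \<in> {n, Suc n}" using block_length by auto
  moreover have "even n = (i = b)" using h(1) by (auto simp: side_def)
  ultimately show "(if even (length x) = (i = b) then length x else length x - 1) = n \<and>
      (if even (length z) = (i = b) then length z else length z - 1) = n" by auto
qed (use partial_action_block inverse_semigroup_S in auto)

sublocale T: inverse_semigroup_action "S i" "tree_action i" for i
  by unfold_locales (rule partial_action_tree)

lemma side_Suc: "side (Suc n) \<longleftrightarrow> \<not> side n" by (auto simp: side_def)

text \<open>Each layer is seen twice, by block \<open>n\<close> as its new points and by block
  \<open>n + 1\<close> as its old ones, that is, once by each factor. So the two actions agree on
  \<open>U\<close>, as is needed to extend them to the product.\<close>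

lemma tree_action_U:
  assumes u: "u \<in> carrier U" shows "tree_action i (\<phi> i u) = (\<Union>n. layer n u)"
proof (intro equalityI subrelI)
  fix x z assume "(x, z) \<in> tree_action i (\<phi> i u)"
  then obtain n where n: "side n = i" "(x, z) \<in> block n (\<phi> (side n) u)" by (auto simp: tree_action_def)
  show "(x, z) \<in> (\<Union>n. layer n u)"
  proof (cases "length x = Suc n")
    case True
    then have "(x, z) \<in> layer n u" using block_props[of n] n u by (auto simp: layer_def)
    then show ?thesis by blast
  next
    case False
    then obtain m where m: "n = Suc m" "length x = Suc m"
      using block_length[OF \<phi>_closed[OF u] n(2)] by (cases n) auto
    then show ?thesis using n(2) X.ext_\<phi>_old[OF u, of x m z] by (auto simp: block_Suc simp del: block.simps)
  qed
next
  fix x z assume "(x, z) \<in> (\<Union>n. layer n u)"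
  then obtain n where n: "(x, z) \<in> layer n u" by blast
  show "(x, z) \<in> tree_action i (\<phi> i u)"
  proof (cases "side n = i")
    case True
    then show ?thesis using n by (auto simp: tree_action_def layer_def)
  next
    case False
    then have "side (Suc n) = i" by (auto simp: side_Suc)
    then show ?thesis using X.N_imp_ext[OF u n] unfolding block_Suc[symmetric] by (auto simp: tree_action_def)
  qed
qed

lemma tree_actionE:
  assumes "(x, z) \<in> tree_action i a" "a \<in> carrier (S i)"
  obtains n where "i = side n" "(x, z) \<in> block n a" "length x = n \<or> length x = Suc n"
proof -
  obtain n where n: "i = side n" "(x, z) \<in> block n a" using assms by (auto simp: tree_action_def)
  then show thesis using that block_length(1)[of a n x z] assms(2) by auto
qed

lemma block_tree: "(x, z) \<in> block n a \<Longrightarrow> (x, z) \<in> tree_action (side n) a"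
  by (auto simp: tree_action_def)

end

section \<open>Maximal subgroups of the amalgamated product\<close>

text \<open>The product enters through its compatible maps from the factors, through generation by
  them, in the form of an induction by right multiplication, and through the extension of compatible
  actions, here on the point type of the tree.\<close>

locale lobe_tree_product = lobe_tree U S \<phi> b + P: inverse_semigroup P
  for U :: "('c, 'k) monoid_scheme" and S :: "bool \<Rightarrow> 'l monoid" and \<phi> b
    and P :: "('p, 'q) monoid_scheme" +
  fixes \<kappa> :: "bool \<Rightarrow> 'l \<Rightarrow> 'p"
  assumes \<kappa>_hom: "\<kappa> i \<in> hom (S i) P"
    and \<kappa>_U: "u \<in> carrier U \<Longrightarrow> \<kappa> i (\<phi> i u) = \<kappa> j (\<phi> j u)"
    and generated: "x \<in> carrier P \<Longrightarrow>
      (\<And>i a. a \<in> carrier (S i) \<Longrightarrow> R (\<kappa> i a)) \<Longrightarrow>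
      (\<And>i a x. x \<in> carrier P \<Longrightarrow> R x \<Longrightarrow> a \<in> carrier (S i) \<Longrightarrow> R (x \<otimes>\<^bsub>P\<^esub> \<kappa> i a)) \<Longrightarrow> R x"
    and extends: "\<And>M :: bool \<Rightarrow> 'l \<Rightarrow> 'l list rel.
      (\<And>i. partial_action (S i) (M i)) \<Longrightarrow>
      (\<And>u i j. u \<in> carrier U \<Longrightarrow> M i (\<phi> i u) = M j (\<phi> j u)) \<Longrightarrow>
      \<exists>Q. partial_action P Q \<and> (\<forall>i. \<forall>a\<in>carrier (S i). Q (\<kappa> i a) = M i a)"
begin

section \<open>The action of the product on the tree\<close>

definition Q :: "'p \<Rightarrow> 'l list rel" where
  "Q = (SOME Q. partial_action P Q \<and> (\<forall>i. \<forall>a\<in>carrier (S i). Q (\<kappa> i a) = tree_action i a))"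

lemma Q: "partial_action P Q" "a \<in> carrier (S i) \<Longrightarrow> Q (\<kappa> i a) = tree_action i a"
proof -
  have "\<exists>Q. partial_action P Q \<and> (\<forall>i. \<forall>a\<in>carrier (S i). Q (\<kappa> i a) = tree_action i a)"
    by (rule extends) (simp_all add: partial_action_tree tree_action_U)
  from someI_ex[OF this] show "partial_action P Q" "a \<in> carrier (S i) \<Longrightarrow> Q (\<kappa> i a) = tree_action i a"
    unfolding Q_def by blast+
qed

sublocale Q: inverse_semigroup_action P Q
  by unfold_locales (rule Q)

lemma \<kappa>_closed: "a \<in> carrier (S i) \<Longrightarrow> \<kappa> i a \<in> carrier P" using \<kappa>_hom by (rule hom_in_carrier)

lemma \<kappa>_mult: "a \<in> carrier (S i) \<Longrightarrow> c \<in> carrier (S i) \<Longrightarrow> \<kappa> i (a \<otimes>\<^bsub>S i\<^esub> c) = \<kappa> i a \<otimes>\<^bsub>P\<^esub> \<kappa> i c"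
  using \<kappa>_hom by (rule hom_mult)

lemma \<kappa>_sinv: "a \<in> carrier (S i) \<Longrightarrow> \<kappa> i (sinv (S i) a) = sinv P (\<kappa> i a)"
  using hom_sinv[OF inverse_semigroup_S P.inverse_semigroup_axioms \<kappa>_hom] .

lemma side_0: "side 0 = b" by (auto simp: side_def)

text \<open>The root is a faithful lobe. If \<open>a\<close> and \<open>c\<close> have the same
  image, they act alike on the point \<open>[a a^-1]\<close>; parity rules out block 1, so the root
  gives \<open>a = a a^-1 c\<close> and hence \<open>a \<preceq> c\<close>. By symmetry the two are
  equal.\<close>

lemma \<kappa>_inj: "inj_on (\<kappa> b) (carrier (S b))"
proof (rule inj_onI)
  have le: "a \<preceq>\<^bsub>S b\<^esub> c" if ac: "a \<in> carrier (S b)" "c \<in> carrier (S b)" "\<kappa> b a = \<kappa> b c" for a c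
  proof -
    let ?e = "a \<otimes>\<^bsub>S b\<^esub> sinv (S b) a"
    have e: "?e \<in> idempotents (S b)" using S.range_idem ac by blast
    have "?e \<otimes>\<^bsub>S b\<^esub> a = a" using S.inv1' ac by simp
    then have "([?e], [a]) \<in> block 0 a"
      using ac S.idem_closed[OF e] by (auto simp: base_action_def)
    then have "([?e], [a]) \<in> tree_action b c"
      using block_tree[of _ _ 0, unfolded side_0] Q(2)[OF ac(1)] Q(2)[OF ac(2)] ac(3) by simp
    then obtain n where n: "b = side n" "([?e], [a]) \<in> block n c" "n = 1 \<or> n = 0"
      using ac(2) by (elim tree_actionE) auto
    then have "n = 0" by (auto simp: side_def)
    then have "a = ?e \<otimes>\<^bsub>S b\<^esub> c" using n(2) by (auto simp: base_action_def)
    then show ?thesis using S.idem_mult_le[OF e ac(2)] by simp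
  qed
  fix a c assume "a \<in> carrier (S b)" "c \<in> carrier (S b)" "\<kappa> b a = \<kappa> b c"
  then show "a = c" using le[of a c] le[of c a] S.nat_le_antisym by simp
qed

text \<open>
  \<open>standard g q x\<close>: the element \<open>x\<close> takes \<open>[g]\<close> to \<open>q\<close> along a path with at most one step in
  each lobe.
\<close>

inductive standard :: "'l \<Rightarrow> 'l list \<Rightarrow> 'p \<Rightarrow> bool" for g where
  base: "s \<in> carrier (S b) \<Longrightarrow> ([g], q) \<in> block 0 s \<Longrightarrow> standard g q (\<kappa> b s)"
| step: "standard g y x \<Longrightarrow> length y = Suc n \<Longrightarrow> s \<in> carrier (S (side (Suc n))) \<Longrightarrow>
    (y, q) \<in> block (Suc n) s \<Longrightarrow> length q = Suc (Suc n) \<Longrightarrow>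
    standard g q (x \<otimes>\<^bsub>P\<^esub> \<kappa> (side (Suc n)) s)"

lemma standard_closed: "standard g q x \<Longrightarrow> x \<in> carrier P"
  by (induction rule: standard.induct) (simp_all add: \<kappa>_closed P.m_closed)

lemma base_length:
  assumes "s \<in> carrier (S b)" "(y, q) \<in> block 0 s" shows "length y = 1" "length q = 1"
  using assms by (auto simp: base_action_def)

lemma standard_nonempty: "standard g q x \<Longrightarrow> q \<noteq> []"
  by (cases rule: standard.cases) (auto dest: base_length)

text \<open>An element of \<open>U\<close> keeps \<open>q\<close> within its layer, so it can be
  absorbed into the last step of the path without changing its shape. Its image in the product is
  the same from either factor, so \<open>i\<close> is arbitrary.\<close>

lemma standard_layer:
  assumes "standard g q x" and qz: "(q, z) \<in> layer n t" and t: "t \<in> carrier U"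
  shows "standard g z (x \<otimes>\<^bsub>P\<^esub> \<kappa> i (\<phi> i t))"
  using assms(1)
proof cases
  case (base s)
  then have n: "n = 0" using qz base_length by (auto simp: layer_def)
  have "(q, z) \<in> block 0 (\<phi> b t)" using qz n side_0 by (simp add: layer_def)
  then have "([g], z) \<in> block 0 (s \<otimes>\<^bsub>S b\<^esub> \<phi> b t)"
    using B.act_multI[of _ _ 0, unfolded side_0] base t \<phi>_closed by blast
  then have "standard g z (\<kappa> b (s \<otimes>\<^bsub>S b\<^esub> \<phi> b t))"
    using standard.base base t \<phi>_closed S.m_closed by blast
  then show ?thesis using base t \<phi>_closed \<kappa>_mult \<kappa>_U by metis
next
  case (step y x' m s)
  then have n: "n = Suc m" using qz by (auto simp: layer_def)
  let ?i = "side (Suc m)"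
  have qz': "(q, z) \<in> block (Suc m) (\<phi> ?i t)" "length z = Suc (Suc m)"
    using qz n by (auto simp: layer_def simp del: block.simps)
  have "(y, z) \<in> block (Suc m) (s \<otimes>\<^bsub>S ?i\<^esub> \<phi> ?i t)"
    using B.act_multI step qz' t \<phi>_closed by blast
  then have "standard g z (x' \<otimes>\<^bsub>P\<^esub> \<kappa> ?i (s \<otimes>\<^bsub>S ?i\<^esub> \<phi> ?i t))"
    using standard.step step qz' t \<phi>_closed S.m_closed by blast
  moreover have "x' \<otimes>\<^bsub>P\<^esub> \<kappa> ?i (s \<otimes>\<^bsub>S ?i\<^esub> \<phi> ?i t) = x \<otimes>\<^bsub>P\<^esub> \<kappa> ?i (\<phi> ?i t)"
    using step t \<phi>_closed standard_closed by (simp add: \<kappa>_mult P.m_assoc \<kappa>_closed)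
  ultimately show ?thesis using \<kappa>_U[OF t, of i ?i] by simp
qed

text \<open>If \<open>z\<close> is new, the path gains one step. Otherwise the excursion returns to
  the old points, and \<open>ext_tight\<close> replaces \<open>a\<close> by an element of
  \<open>U\<close> below it, which is absorbed; this is where equality weakens to the order.\<close>

lemma standard_old:
  assumes y: "standard g y x" "length y = Suc n" and a: "a \<in> carrier (S (side (Suc n)))"
    and yz: "(y, z) \<in> block (Suc n) a"
  shows "\<exists>x'. standard g z x' \<and> x' \<preceq>\<^bsub>P\<^esub> x \<otimes>\<^bsub>P\<^esub> \<kappa> (side (Suc n)) a"
proof (cases "length z = Suc (Suc n)")
  case True
  then show ?thesis
    using standard.step[OF y a yz] P.nat_le_refl standard_closed by blast
next
  case False
  let ?i = "side (Suc n)"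
  from False have "length z = Suc n" using block_length[OF a yz] by auto
  then obtain t where t: "t \<in> carrier U" "(y, z) \<in> layer n t" "\<phi> ?i t \<preceq>\<^bsub>S ?i\<^esub> a"
    using X.ext_tight[OF a yz[unfolded block_Suc] y(2)] by blast
  have "\<kappa> ?i (\<phi> ?i t) \<preceq>\<^bsub>P\<^esub> \<kappa> ?i a" using hom_nat_le[OF \<kappa>_hom t(3)] .
  then have "x \<otimes>\<^bsub>P\<^esub> \<kappa> ?i (\<phi> ?i t) \<preceq>\<^bsub>P\<^esub> x \<otimes>\<^bsub>P\<^esub> \<kappa> ?i a"
    using P.nat_le_mult P.nat_le_refl standard_closed y(1) by blast
  then show ?thesis using standard_layer[OF y(1) t(2,1)] by blast
qed

text \<open>If \<open>q\<close> is old for the block in which \<open>a\<close> acts, a further lobe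
  is entered. If \<open>q\<close> is new, the last step of the path took place in that very block
  and is merged with \<open>a\<close>.\<close>

lemma standard_act:
  assumes q: "standard g q x" and a: "a \<in> carrier (S i)" and qz: "(q, z) \<in> tree_action i a"
  shows "\<exists>x'. standard g z x' \<and> x' \<preceq>\<^bsub>P\<^esub> x \<otimes>\<^bsub>P\<^esub> \<kappa> i a"
proof -
  obtain n where n: "i = side n" "(q, z) \<in> block n a" "length q = n \<or> length q = Suc n"
    using qz a by (rule tree_actionE)
  show ?thesis
  proof (cases "length q = n")
    case True
    then obtain m where "n = Suc m" using standard_nonempty[OF q] by (cases n) auto
    then show ?thesis using standard_old[OF q, of m a z] True n a by blast
  next
    case False
    then have len: "length q = Suc n" using n by blast
    from q show ?thesis
    proof cases
      case (base s)
      then have "n = 0" using base_length len by auto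
      then have i: "i = b" and qz': "(q, z) \<in> block 0 a" using n side_0 by auto
      have "([g], z) \<in> block 0 (s \<otimes>\<^bsub>S b\<^esub> a)"
        using B.act_multI[of _ _ 0, unfolded side_0] base qz' a[unfolded i] by blast
      then have "standard g z (\<kappa> b (s \<otimes>\<^bsub>S b\<^esub> a))" using standard.base base a i S.m_closed by blast
      moreover have "\<kappa> b (s \<otimes>\<^bsub>S b\<^esub> a) = x \<otimes>\<^bsub>P\<^esub> \<kappa> i a"
        unfolding i base(1) using base(2) a[unfolded i] by (rule \<kappa>_mult)
      ultimately show ?thesis using P.nat_le_refl standard_closed by metis
    next
      case (step y x' m s)
      have nm: "n = Suc m" using len step by simp
      have i: "i = side (Suc m)" and qz': "(q, z) \<in> block (Suc m) a" using n nm by simp_all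
      have "(y, z) \<in> block (Suc m) (s \<otimes>\<^bsub>S i\<^esub> a)"
        using B.act_multI[OF step(5) qz' step(4) a[unfolded i]] unfolding i .
      then obtain w where "standard g z w" "w \<preceq>\<^bsub>P\<^esub> x' \<otimes>\<^bsub>P\<^esub> \<kappa> i (s \<otimes>\<^bsub>S i\<^esub> a)"
        using standard_old[OF step(2,3), of "s \<otimes>\<^bsub>S i\<^esub> a" z] step(4) a S.m_closed i by blast
      moreover have "x' \<otimes>\<^bsub>P\<^esub> \<kappa> i (s \<otimes>\<^bsub>S i\<^esub> a) = x \<otimes>\<^bsub>P\<^esub> \<kappa> i a"
        using step(1,4) a standard_closed[OF step(2)] i by (simp add: \<kappa>_mult P.m_assoc \<kappa>_closed)
      ultimately show ?thesis by auto
    qed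
  qed
qed

lemma idem_fixes_base:
  assumes g: "g \<in> idempotents (S b)" shows "([g], [g]) \<in> block 0 g"
  using S.idem_closed[OF g] S.idem_idem[OF g] S.idem_sinv[OF g] by (auto simp: base_action_def)

text \<open>The path starts as \<open>\<kappa> b g\<close>, which fixes \<open>[g]\<close>, and the
  factors of \<open>x\<close> are appended one by one with \<open>standard_act\<close>.\<close>

lemma standard_below:
  assumes g: "g \<in> idempotents (S b)" and x: "x \<in> carrier P" and "([g], q) \<in> Q x"
  shows "\<exists>x'. standard g q x' \<and> x' \<preceq>\<^bsub>P\<^esub> \<kappa> b g \<otimes>\<^bsub>P\<^esub> x"
proof -
  have "\<forall>q. ([g], q) \<in> Q x \<longrightarrow> (\<exists>x'. standard g q x' \<and> x' \<preceq>\<^bsub>P\<^esub> \<kappa> b g \<otimes>\<^bsub>P\<^esub> x)" using x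
  proof (rule generated)
    fix i a assume a: "a \<in> carrier (S i)"
    have "standard g [g] (\<kappa> b g)" using standard.base S.idem_closed[OF g] idem_fixes_base[OF g] by blast
    then show "\<forall>q. ([g], q) \<in> Q (\<kappa> i a) \<longrightarrow>
        (\<exists>x'. standard g q x' \<and> x' \<preceq>\<^bsub>P\<^esub> \<kappa> b g \<otimes>\<^bsub>P\<^esub> \<kappa> i a)"
      using standard_act a Q(2) by blast
  next
    fix i a x
    assume x: "x \<in> carrier P" and a: "a \<in> carrier (S i)"
      and IH: "\<forall>q. ([g], q) \<in> Q x \<longrightarrow> (\<exists>x'. standard g q x' \<and> x' \<preceq>\<^bsub>P\<^esub> \<kappa> b g \<otimes>\<^bsub>P\<^esub> x)"
    show "\<forall>q. ([g], q) \<in> Q (x \<otimes>\<^bsub>P\<^esub> \<kappa> i a) \<longrightarrow>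
        (\<exists>x'. standard g q x' \<and> x' \<preceq>\<^bsub>P\<^esub> \<kappa> b g \<otimes>\<^bsub>P\<^esub> (x \<otimes>\<^bsub>P\<^esub> \<kappa> i a))"
    proof (intro allI impI)
      fix q assume "([g], q) \<in> Q (x \<otimes>\<^bsub>P\<^esub> \<kappa> i a)"
      then obtain p where p: "([g], p) \<in> Q x" "(p, q) \<in> tree_action i a"
        using Q.act_mult[OF x \<kappa>_closed[OF a]] Q(2)[OF a] by auto
      obtain y where y: "standard g p y" "y \<preceq>\<^bsub>P\<^esub> \<kappa> b g \<otimes>\<^bsub>P\<^esub> x" using IH p by blast
      obtain z where z: "standard g q z" "z \<preceq>\<^bsub>P\<^esub> y \<otimes>\<^bsub>P\<^esub> \<kappa> i a" using standard_act[OF y(1) a p(2)] by blast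
      note z(2)
      also have "y \<otimes>\<^bsub>P\<^esub> \<kappa> i a \<preceq>\<^bsub>P\<^esub> \<kappa> b g \<otimes>\<^bsub>P\<^esub> x \<otimes>\<^bsub>P\<^esub> \<kappa> i a"
        using P.nat_le_mult[OF y(2) P.nat_le_refl] \<kappa>_closed a by blast
      finally show "\<exists>x'. standard g q x' \<and> x' \<preceq>\<^bsub>P\<^esub> \<kappa> b g \<otimes>\<^bsub>P\<^esub> (x \<otimes>\<^bsub>P\<^esub> \<kappa> i a)"
        using z(1) x a \<kappa>_closed S.idem_closed[OF g] by (auto simp: P.m_assoc)
    qed
  qed
  then show ?thesis using assms by blast
qed

text \<open>Every \<open>step\<close> ends at a point of length at least 2, so a standard path to a
  point of length 1 is a single element of the root factor.\<close>

lemma base_below: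
  assumes g: "g \<in> idempotents (S b)" and x: "x \<in> carrier P" and q: "([g], q) \<in> Q x" "length q = 1"
  obtains s where "s \<in> carrier (S b)" "([g], q) \<in> block 0 s" "\<kappa> b s \<preceq>\<^bsub>P\<^esub> \<kappa> b g \<otimes>\<^bsub>P\<^esub> x"
proof -
  obtain y where y: "standard g q y" "y \<preceq>\<^bsub>P\<^esub> \<kappa> b g \<otimes>\<^bsub>P\<^esub> x" using standard_below[OF g x q(1)] by blast
  from y(1) show thesis by cases (use that y q(2) in auto)
qed

section \<open>Fixed points inside and outside the root\<close>

lemma block_0_fixed:
  assumes "s \<in> carrier (S b)" "([g], q) \<in> block 0 s"
  shows "q = [g \<otimes>\<^bsub>S b\<^esub> s]" "g \<otimes>\<^bsub>S b\<^esub> s \<otimes>\<^bsub>S b\<^esub> sinv (S b) s = g"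
  using assms by (auto simp: base_action_def)

text \<open>Let \<open>s\<close> take an old point \<open>y\<close> of the lobe to \<open>q\<close>.
  Then \<open>s g s^-1\<close> fixes \<open>y\<close>, so \<open>ext_tight\<close> finds some
  \<open>t\<close> in \<open>U\<close> that fixes \<open>y\<close> and has its image below
  \<open>s g s^-1\<close>. Conjugating this image back by \<open>s\<close> gives
  \<open>h\<close>.\<close>

lemma fixed_new_point:
  assumes g: "g \<in> idempotents (S b)" and q: "(q, q) \<in> tree_action b g" "length q \<noteq> 1"
  obtains h t where "h \<in> idempotents (S b)" "h \<preceq>\<^bsub>S b\<^esub> g" "(q, q) \<in> tree_action b h"
    "t \<in> idempotents U" "(h, \<phi> b t) \<in> greenD (S b)"
proof -
  note gc = S.idem_closed[OF g]
  obtain n where n: "b = side n" "(q, q) \<in> block n g" using q(1) gc by (rule tree_actionE)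
  then obtain m where m: "n = Suc m" using q(2) base_length gc by (cases n) auto
  have b: "b = side (Suc m)" using n m by simp
  have qq: "(q, q) \<in> block (Suc m) g" using n m by simp
  have gc': "g \<in> carrier (S (side (Suc m)))" using gc by (simp flip: b)
  \<comment> \<open>If \<open>q\<close> is itself old in its block, \<open>q\<close> and
    \<open>g\<close> serve as \<open>y\<close> and \<open>s\<close>.\<close>
  have "\<exists>s y. s \<in> carrier (S b) \<and> length y = Suc m \<and> (y, q) \<in> block (Suc m) s"
  proof (cases "length q = Suc m")
    case True
    then show ?thesis using qq gc by blast
  next
    case False
    then have "length q = Suc (Suc m)" using block_length[OF gc' qq] by auto
    then show ?thesis using X.ext_generated[OF gc' qq[unfolded block_Suc], folded block_Suc b] by metis
  qed
  then obtain s y where s: "s \<in> carrier (S b)" "length y = Suc m" "(y, q) \<in> block (Suc m) s" by blast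
  let ?i = "sinv (S b)"
  note c = s(1) gc S.sinv_closed[OF s(1)] S.m_closed
  have "(y, y) \<in> block (Suc m) (s \<otimes>\<^bsub>S b\<^esub> g \<otimes>\<^bsub>S b\<^esub> ?i s)"
    using B.act_multI[of _ _ "Suc m", folded b] B.act_sinv[of _ "Suc m", folded b] s qq c by metis
  then obtain t where t: "t \<in> carrier U" "(y, y) \<in> layer m t"
    "\<phi> b t \<preceq>\<^bsub>S b\<^esub> s \<otimes>\<^bsub>S b\<^esub> g \<otimes>\<^bsub>S b\<^esub> ?i s"
    using X.ext_tight[of "s \<otimes>\<^bsub>S b\<^esub> g \<otimes>\<^bsub>S b\<^esub> ?i s" m y y, folded block_Suc b] s(2) c by blast
  let ?f = "\<phi> b t" and ?h = "?i s \<otimes>\<^bsub>S b\<^esub> \<phi> b t \<otimes>\<^bsub>S b\<^esub> s"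
  have f: "?f \<in> idempotents (S b)" using S.nat_le_idem[OF t(3)] S.conj_idem[OF g s(1)] by blast
  have ti: "t \<in> idempotents U" using X.\<phi>_idem[OF t(1), of m, folded b] f by blast
  note fc = S.idem_closed[OF f]
  have h: "?h \<in> idempotents (S b)" using S.conj_idem[OF f c(3)] S.sinv_sinv s by simp
  have f1: "?f \<preceq>\<^bsub>S b\<^esub> s \<otimes>\<^bsub>S b\<^esub> ?i s"
  proof -
    note t(3)
    also have "s \<otimes>\<^bsub>S b\<^esub> g \<otimes>\<^bsub>S b\<^esub> ?i s \<preceq>\<^bsub>S b\<^esub> s \<otimes>\<^bsub>S b\<^esub> ?i s"
      using S.nat_le_mult[OF S.mult_idem_le[OF g] S.nat_le_refl] c by blast
    finally show ?thesis .
  qed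
  then obtain e where e: "e \<in> idempotents (S b)" "?f = e \<otimes>\<^bsub>S b\<^esub> (s \<otimes>\<^bsub>S b\<^esub> ?i s)" by (auto simp: nat_le_def)
  \<comment> \<open>Being below the idempotent \<open>s s^-1\<close>, \<open>?f\<close> absorbs it.
    This makes \<open>s^-1 ?f\<close> a witness that \<open>?h\<close> and \<open>?f\<close> are
    \<D>-related.\<close>
  have fs: "?f \<otimes>\<^bsub>S b\<^esub> (s \<otimes>\<^bsub>S b\<^esub> ?i s) = ?f"
  proof -
    have "?f \<otimes>\<^bsub>S b\<^esub> (s \<otimes>\<^bsub>S b\<^esub> ?i s) = e \<otimes>\<^bsub>S b\<^esub> ((s \<otimes>\<^bsub>S b\<^esub> ?i s) \<otimes>\<^bsub>S b\<^esub> (s \<otimes>\<^bsub>S b\<^esub> ?i s))"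
      using e c S.idem_closed[OF e(1)] by (simp add: S.m_assoc)
    then show ?thesis using S.idem_idem[OF S.range_idem[OF s(1)]] e by simp
  qed
  have hg: "?h \<preceq>\<^bsub>S b\<^esub> g"
  proof -
    have "?h \<preceq>\<^bsub>S b\<^esub> ?i s \<otimes>\<^bsub>S b\<^esub> (s \<otimes>\<^bsub>S b\<^esub> g \<otimes>\<^bsub>S b\<^esub> ?i s) \<otimes>\<^bsub>S b\<^esub> s"
      using S.nat_le_mult[OF S.nat_le_mult[OF S.nat_le_refl t(3)] S.nat_le_refl] c by blast
    also have "\<dots> = (?i s \<otimes>\<^bsub>S b\<^esub> s) \<otimes>\<^bsub>S b\<^esub> g \<otimes>\<^bsub>S b\<^esub> (?i s \<otimes>\<^bsub>S b\<^esub> s)" using c by (simp add: S.m_assoc)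
    also have "\<dots> \<preceq>\<^bsub>S b\<^esub> (?i s \<otimes>\<^bsub>S b\<^esub> s) \<otimes>\<^bsub>S b\<^esub> g"
      using S.mult_idem_le[OF S.domain_idem[OF s(1)]] c by blast
    also have "\<dots> \<preceq>\<^bsub>S b\<^esub> g" using S.idem_mult_le[OF S.domain_idem[OF s(1)]] c by blast
    finally show ?thesis .
  qed
  have "(y, y) \<in> block (Suc m) ?f" using X.N_imp_ext[OF t(1,2), folded block_Suc b] .
  moreover have "(q, y) \<in> block (Suc m) (?i s)" using B.act_sinv[of s "Suc m", folded b] s by blast
  ultimately have "(q, q) \<in> block (Suc m) ?h"
    using B.act_multI[of _ _ "Suc m", folded b] s c fc by blast
  then have qh: "(q, q) \<in> tree_action b ?h" using block_tree[of _ _ "Suc m", folded b] by blast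
  have D: "(?h, ?f) \<in> greenD (S b)"
    unfolding S.greenD_idem_iff[OF h f]
  proof (intro bexI conjI)
    let ?z = "?i s \<otimes>\<^bsub>S b\<^esub> ?f"
    show "?z \<in> carrier (S b)" using c fc by blast
    have iz: "?i ?z = ?f \<otimes>\<^bsub>S b\<^esub> s" using c fc by (simp add: S.sinv_mult S.sinv_sinv S.idem_sinv[OF f])
    have "?z \<otimes>\<^bsub>S b\<^esub> ?i ?z = ?i s \<otimes>\<^bsub>S b\<^esub> (?f \<otimes>\<^bsub>S b\<^esub> ?f) \<otimes>\<^bsub>S b\<^esub> s"
      unfolding iz using c(1-3) fc by (simp add: S.m_assoc S.m_closed)
    then show "?z \<otimes>\<^bsub>S b\<^esub> ?i ?z = ?h" using S.idem_idem[OF f] by simp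
    have "?i ?z \<otimes>\<^bsub>S b\<^esub> ?z = (?f \<otimes>\<^bsub>S b\<^esub> (s \<otimes>\<^bsub>S b\<^esub> ?i s)) \<otimes>\<^bsub>S b\<^esub> ?f"
      unfolding iz using c(1-3) fc by (simp add: S.m_assoc S.m_closed)
    then show "?i ?z \<otimes>\<^bsub>S b\<^esub> ?z = ?f" unfolding fs using S.idem_idem[OF f] by simp
  qed
  show thesis using that[OF h hg qh ti D] .
qed

lemma greenD_\<kappa>:
  assumes "e \<in> idempotents (S b)" "f \<in> idempotents (S b)" "(e, f) \<in> greenD (S b)"
  shows "(\<kappa> b e, \<kappa> b f) \<in> greenD P"
proof -
  obtain z where "z \<in> carrier (S b)" "z \<otimes>\<^bsub>S b\<^esub> sinv (S b) z = e" "sinv (S b) z \<otimes>\<^bsub>S b\<^esub> z = f"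
    using assms S.greenD_idem_iff by blast
  then show ?thesis
    using P.greenD_idem_iff[OF hom_idem[OF \<kappa>_hom assms(1)] hom_idem[OF \<kappa>_hom assms(2)]]
      \<kappa>_closed \<kappa>_mult \<kappa>_sinv S.sinv_closed by metis
qed

theorem max_subgroup_subset:
  assumes g: "g \<in> idempotents (S b)"
    and not_U: "\<And>u. u \<in> idempotents U \<Longrightarrow> (\<kappa> b g, \<kappa> b (\<phi> b u)) \<notin> greenD P"
  shows "carrier (max_subgroup P (\<kappa> b g)) \<subseteq> \<kappa> b ` carrier (S b)"
proof
  let ?g = "\<kappa> b g" and ?i = "sinv P"
  fix x assume "x \<in> carrier (max_subgroup P ?g)"
  have gi: "?g \<in> idempotents P" using hom_idem[OF \<kappa>_hom g] .
  then have x: "x \<in> carrier P" "x \<otimes>\<^bsub>P\<^esub> ?i x = ?g" "?i x \<otimes>\<^bsub>P\<^esub> x = ?g"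
    using P.max_subgroup_sinv_iff \<open>x \<in> carrier (max_subgroup P ?g)\<close> by blast+
  note gc = S.idem_closed[OF g] P.idem_closed[OF gi] and xc = x(1) P.sinv_closed[OF x(1)]
  have gx: "?g \<otimes>\<^bsub>P\<^esub> x = x" "x \<otimes>\<^bsub>P\<^esub> ?g = x"
    using P.inv1'[OF x(1)] x(2) P.inv1[OF x(1)] x(3) by simp_all
  have "([g], [g]) \<in> Q ?g" using block_tree[OF idem_fixes_base[OF g], unfolded side_0] Q(2)[OF gc(1)] by simp
  \<comment> \<open>The range idempotent of \<open>x\<close> is \<open>\<kappa> b g\<close>, which
    fixes \<open>[g]\<close>, so \<open>x\<close> is defined there.\<close>
  then obtain q where q: "([g], q) \<in> Q x" using Q.act_rangeE[OF x(1)] x(2) by metis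
  have "(q, [g]) \<in> Q (?i x)" using Q.act_sinv x(1) q by blast
  then have "(q, q) \<in> Q ?g" using Q.act_multI q xc x(3) by metis
  then have qq: "(q, q) \<in> tree_action b g" using Q(2)[OF gc(1)] by simp
  have "length q = 1"
  proof (rule ccontr)
    assume "length q \<noteq> 1"
    then obtain h t where h: "h \<in> idempotents (S b)" "h \<preceq>\<^bsub>S b\<^esub> g" "(q, q) \<in> tree_action b h"
      "t \<in> idempotents U" "(h, \<phi> b t) \<in> greenD (S b)"
      using fixed_new_point[OF g qq] by blast
    let ?h = "\<kappa> b h"
    have hi: "?h \<in> idempotents P" using hom_idem[OF \<kappa>_hom h(1)] .
    note hc = S.idem_closed[OF h(1)] P.idem_closed[OF hi]
    have hg: "?h \<preceq>\<^bsub>P\<^esub> ?g" using hom_nat_le[OF \<kappa>_hom h(2)] .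
    let ?y = "x \<otimes>\<^bsub>P\<^esub> ?h \<otimes>\<^bsub>P\<^esub> ?i x"
    have yc: "?y \<in> carrier P" using xc hc P.m_closed by blast
    have "(q, q) \<in> Q ?h" using Q(2)[OF hc(1)] h(3) by simp
    then have "([g], [g]) \<in> Q ?y"
      using Q.act_multI q \<open>(q, [g]) \<in> Q (?i x)\<close> xc hc P.m_closed by meson
    then obtain s where s: "s \<in> carrier (S b)" "([g], [g]) \<in> block 0 s" "\<kappa> b s \<preceq>\<^bsub>P\<^esub> ?g \<otimes>\<^bsub>P\<^esub> ?y"
      using base_below[OF g yc, of "[g]"] by (metis One_nat_def length_Cons list.size(3))
    \<comment> \<open>In the root, fixing \<open>[g]\<close> means \<open>g s = g\<close>. This
      turns the bound on \<open>\<kappa> b s\<close> into \<open>?g \<preceq> ?y\<close>.\<close>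
    have "g \<otimes>\<^bsub>S b\<^esub> s = g" using block_0_fixed[OF s(1,2)] by simp
    then have "?g = ?g \<otimes>\<^bsub>P\<^esub> \<kappa> b s" using \<kappa>_mult[OF gc(1) s(1)] by simp
    also have "\<dots> \<preceq>\<^bsub>P\<^esub> ?g \<otimes>\<^bsub>P\<^esub> (?g \<otimes>\<^bsub>P\<^esub> ?y)" using P.nat_le_mult[OF P.nat_le_refl[OF gc(2)] s(3)] .
    also have "\<dots> = (?g \<otimes>\<^bsub>P\<^esub> (?g \<otimes>\<^bsub>P\<^esub> x)) \<otimes>\<^bsub>P\<^esub> ?h \<otimes>\<^bsub>P\<^esub> ?i x"
      using gc hc xc by (simp add: P.m_assoc P.m_closed)
    finally have gy: "?g \<preceq>\<^bsub>P\<^esub> ?y" unfolding gx .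
    \<comment> \<open>Conjugating by \<open>x\<close> undoes the conjugation in \<open>?y\<close>
      and leaves \<open>?g \<preceq> ?h\<close>, hence equality.\<close>
    have "?g = ?i x \<otimes>\<^bsub>P\<^esub> ?g \<otimes>\<^bsub>P\<^esub> x" using gx x xc gc by (simp add: P.m_assoc)
    also have "\<dots> \<preceq>\<^bsub>P\<^esub> ?i x \<otimes>\<^bsub>P\<^esub> ?y \<otimes>\<^bsub>P\<^esub> x"
      using P.nat_le_mult[OF P.nat_le_mult[OF P.nat_le_refl gy] P.nat_le_refl] xc by blast
    also have "\<dots> = (?i x \<otimes>\<^bsub>P\<^esub> x) \<otimes>\<^bsub>P\<^esub> ?h \<otimes>\<^bsub>P\<^esub> (?i x \<otimes>\<^bsub>P\<^esub> x)"
      using hc xc by (simp add: P.m_assoc P.m_closed)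
    also have "\<dots> \<preceq>\<^bsub>P\<^esub> ?g \<otimes>\<^bsub>P\<^esub> ?h"
      unfolding x(3) using P.mult_idem_le[OF gi] gc hc P.m_closed by blast
    also have "\<dots> \<preceq>\<^bsub>P\<^esub> ?h" using P.idem_mult_le[OF gi hc(2)] .
    finally have "?g = ?h" using P.nat_le_antisym hg by blast
    then show False using not_U[OF h(4)] greenD_\<kappa>[OF h(1) hom_idem[OF \<phi>_hom h(4)] h(5)] by simp
  qed
  then obtain s where s: "s \<in> carrier (S b)" "([g], q) \<in> block 0 s" "\<kappa> b s \<preceq>\<^bsub>P\<^esub> ?g \<otimes>\<^bsub>P\<^esub> x"
    using base_below[OF g x(1) q] by blast
  let ?s = "g \<otimes>\<^bsub>S b\<^esub> s"
  have sc: "?s \<in> carrier (S b)" using gc(1) s(1) S.m_closed by blast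
  \<comment> \<open>The image of \<open>?s\<close> lies below \<open>x\<close>; to conclude equality
    by \<open>nat_le_eq\<close>, its range idempotent has to be \<open>?g\<close> as well.\<close>
  have "?s \<otimes>\<^bsub>S b\<^esub> sinv (S b) ?s = (?s \<otimes>\<^bsub>S b\<^esub> sinv (S b) s) \<otimes>\<^bsub>S b\<^esub> g"
    using gc(1) s(1) S.idem_sinv[OF g] by (simp add: S.sinv_mult S.m_assoc S.m_closed S.sinv_closed)
  also have "\<dots> = g" using block_0_fixed[OF s(1,2)] S.idem_idem[OF g] by simp
  finally have "\<kappa> b ?s \<otimes>\<^bsub>P\<^esub> ?i (\<kappa> b ?s) = ?g"
    using \<kappa>_mult[OF sc S.sinv_closed[OF sc]] \<kappa>_sinv[OF sc] by simp
  moreover have "\<kappa> b ?s \<preceq>\<^bsub>P\<^esub> x"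
    using P.nat_le_mult[OF P.nat_le_refl[OF gc(2)] s(3)] gx \<kappa>_mult[OF gc(1) s(1)] by simp
  ultimately have "\<kappa> b ?s = x" using P.nat_le_eq x(2) by simp
  then show "x \<in> \<kappa> b ` carrier (S b)" using sc by blast
qed

end

text \<open>
  \<open>S1\<close> and \<open>S2\<close> are copied into the type of letters, so that they form a family indexed by \<open>bool\<close>
  and either of them can be put at the root of the tree.
\<close>

definition copy_semigroup :: "('a \<Rightarrow> 'b) \<Rightarrow> ('a, 'm) monoid_scheme \<Rightarrow> 'b monoid" where
  "copy_semigroup f S = \<lparr>carrier = f ` carrier S,
     mult = (\<lambda>x y. f (inv_into (carrier S) f x \<otimes>\<^bsub>S\<^esub> inv_into (carrier S) f y)), one = undefined\<rparr>"

lemma carrier_copy: "carrier (copy_semigroup f S) = f ` carrier S"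
  by (simp add: copy_semigroup_def)

lemma mult_copy:
  assumes "inj_on f (carrier S)" "x \<in> carrier S" "y \<in> carrier S"
  shows "f x \<otimes>\<^bsub>copy_semigroup f S\<^esub> f y = f (x \<otimes>\<^bsub>S\<^esub> y)"
  using assms by (simp add: copy_semigroup_def)

lemma copy_hom: "inj_on f (carrier S) \<Longrightarrow> f \<in> hom S (copy_semigroup f S)"
  by (rule homI) (auto simp: carrier_copy mult_copy)

lemma inverse_semigroup_copy:
  assumes f: "inj_on f (carrier S)" and S: "inverse_semigroup S"
  shows "inverse_semigroup (copy_semigroup f S)"
proof -
  interpret inverse_semigroup S by fact
  note simps = carrier_copy mult_copy[OF f] m_closed sinv_closed
  show ?thesis
  proof (rule inverse_semigroupI[where
        R = "\<lambda>x y. \<exists>s\<in>carrier S. x = f s \<and> y = f (sinv S s)"])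
    show "carrier (copy_semigroup f S) \<noteq> {}" using nonempty by (simp add: simps)
  next
    fix x y assume "\<exists>s\<in>carrier S. x = f s \<and> y = f (sinv S s)"
    then show "\<exists>s\<in>carrier S. y = f s \<and> x = f (sinv S s)" by (metis sinv_closed sinv_sinv)
  next
    fix x x' y y'
    assume "\<exists>s\<in>carrier S. x = f s \<and> x' = f (sinv S s)" "\<exists>s\<in>carrier S. y = f s \<and> y' = f (sinv S s)"
    then obtain s t where "s \<in> carrier S" "t \<in> carrier S" "x = f s" "x' = f (sinv S s)" "y = f t"
      "y' = f (sinv S t)" by blast
    then show "x \<otimes>\<^bsub>copy_semigroup f S\<^esub> x' \<otimes>\<^bsub>copy_semigroup f S\<^esub> (y \<otimes>\<^bsub>copy_semigroup f S\<^esub> y') =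
        y \<otimes>\<^bsub>copy_semigroup f S\<^esub> y' \<otimes>\<^bsub>copy_semigroup f S\<^esub> (x \<otimes>\<^bsub>copy_semigroup f S\<^esub> x')"
      using idem_commute[OF range_idem[of s] range_idem[of t]] by (simp add: simps)
  qed (auto simp: simps m_assoc inv1)
qed

section \<open>Extending compatible actions to the amalgamated product\<close>

definition word_action :: "('l \<Rightarrow> 'o rel) \<Rightarrow> 'l list \<Rightarrow> 'o rel" where
  "word_action M w = foldr (\<lambda>l R. M l O R) w Id"

lemma word_action_Nil: "word_action M [] = Id"
  and word_action_Cons: "word_action M (l # w) = M l O word_action M w"
  by (simp_all add: word_action_def)

lemma word_action_append: "word_action M (v @ w) = word_action M v O word_action M w"
  by (induction v) (simp_all add: word_action_Nil word_action_Cons O_assoc)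

context inverse_semigroup_amalgam
begin

lemma sinv_class: "w \<in> W \<Longrightarrow> sinv P (C `` {w}) = C `` {word_inv S1 S2 w}"
proof -
  interpret P: inverse_semigroup P by (rule inverse_semigroup_product)
  have *: "C `` {v} \<otimes>\<^bsub>P\<^esub> (C `` {word_inv S1 S2 v} \<otimes>\<^bsub>P\<^esub> C `` {v}) = C `` {v}" if "v \<in> W" for v
    using that equiv_class_eq[OF equiv_cong amalg_cong.vagner[OF that]]
    by (simp add: mult_class words_append word_inv_words)
  assume w: "w \<in> W"
  show ?thesis
    by (rule P.sinv_unique)
      (use w *[of w] *[of "word_inv S1 S2 w"] in
        \<open>simp_all add: class_in_carrier word_inv_words word_inv_word_inv\<close>)
qed

text \<open>Words act by composing their letters. The Vagner relations hold for partial bijections,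
  since R followed by its converse and by R again is R, and partial identities commute; the other
  relations are those of the given actions.\<close>

lemma product_action:
  fixes M :: "'a + 'b \<Rightarrow> 'o rel"
  assumes M1: "partial_action S1 (\<lambda>s. M (Inl s))" and M2: "partial_action S2 (\<lambda>s. M (Inr s))"
    and MU: "\<And>u. u \<in> carrier U \<Longrightarrow> M (Inl (\<phi>1 u)) = M (Inr (\<phi>2 u))"
  shows "\<exists>Q. partial_action P Q \<and> (\<forall>s\<in>carrier S1. Q (\<iota>1 s) = M (Inl s)) \<and>
    (\<forall>s\<in>carrier S2. Q (\<iota>2 s) = M (Inr s))"
proof -
  let ?p = "word_action M"
  define A where "A = carrier S1 <+> carrier S2"
  have single: "single_valued (M l)" and inv: "M (map_sum (sinv S1) (sinv S2) l) = (M l)\<inverse>"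
    if "l \<in> A" for l
    using that M1 M2 by (auto simp: A_def partial_action_def)
  have p_single: "set w \<subseteq> A \<Longrightarrow> single_valued (?p w)" for w
    by (induction w) (simp_all add: word_action_Nil word_action_Cons single single_valued_relcomp)
  have p_inv: "set w \<subseteq> A \<Longrightarrow> ?p (word_inv S1 S2 w) = (?p w)\<inverse>" for w
    by (induction w) (simp_all add: word_inv_Cons word_action_append word_action_Nil word_action_Cons
        inv converse_relcomp, simp add: word_inv_def word_action_Nil)
  have WA: "set w \<subseteq> A" if "w \<in> W" for w using that by (simp add: words_def A_def)
  have p_cong: "(v, w) \<in> C \<Longrightarrow> ?p v = ?p w" for v w
  proof (induction rule: amalg_cong.induct)
    case (vagner w)
    have "R O (R\<inverse> O R) = R" if "single_valued R" for R :: "'o rel"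
      using that by (auto simp: single_valued_def)
    then show ?case using p_single p_inv WA vagner by (simp add: word_action_append)
  next
    case (vagner_comm v w)
    have "single_valued (?p w)" "single_valued (?p v)"
      "single_valued (?p (word_inv S1 S2 v))" "single_valued (?p (word_inv S1 S2 w))"
      using p_single WA vagner_comm word_inv_words by auto
    then have "?p v O ?p (word_inv S1 S2 v) \<subseteq> Id" "?p w O ?p (word_inv S1 S2 w) \<subseteq> Id"
      using p_inv WA vagner_comm by (auto simp: single_valued_def)
    then have "(?p v O ?p (word_inv S1 S2 v)) O (?p w O ?p (word_inv S1 S2 w)) =
        (?p w O ?p (word_inv S1 S2 w)) O (?p v O ?p (word_inv S1 S2 v))" by blast
    then show ?case by (simp add: word_action_append O_assoc)
  qed (use M1 M2 MU in
      \<open>auto simp: word_action_append word_action_Nil word_action_Cons partial_action_def\<close>)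
  \<comment> \<open>All words of a class act alike, so the union is the action of any
    representative.\<close>
  define Q where "Q X = (\<Union>w\<in>X. ?p w)" for X
  have Q: "Q (C `` {w}) = ?p w" if "w \<in> W" for w
  proof -
    have "w \<in> C `` {w}" using amalg_cong.refl[OF that] by simp
    moreover have "?p v = ?p w" if "v \<in> C `` {w}" for v using p_cong[of w v] that by simp
    ultimately show ?thesis unfolding Q_def by blast
  qed
  have "partial_action P Q"
    unfolding partial_action_def
  proof (intro conjI ballI)
    fix X assume "X \<in> carrier P"
    then obtain w where w: "w \<in> W" "X = C `` {w}" by (rule carrier_productE)
    then show "single_valued (Q X)" "Q (sinv P X) = (Q X)\<inverse>"
      using p_single p_inv WA by (simp_all add: Q sinv_class word_inv_words)
  next
    fix X Y assume "X \<in> carrier P" "Y \<in> carrier P"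
    then show "Q (X \<otimes>\<^bsub>P\<^esub> Y) = Q X O Q Y"
      by (elim carrier_productE) (simp add: Q mult_class words_append word_action_append)
  qed
  moreover have "Q (\<iota>1 s) = M (Inl s)" if "s \<in> carrier S1" for s
    using Q[OF letter_words(1)[OF that]] by (simp add: amalg_inj1_def word_action_Nil word_action_Cons)
  moreover have "Q (\<iota>2 s) = M (Inr s)" if "s \<in> carrier S2" for s
    using Q[OF letter_words(2)[OF that]] by (simp add: amalg_inj2_def word_action_Nil word_action_Cons)
  ultimately show ?thesis by blast
qed

section \<open>The two factors as a family\<close>

definition factor :: "bool \<Rightarrow> ('a + 'b) monoid" where
  "factor i = (if i then copy_semigroup Inl S1 else copy_semigroup Inr S2)"

definition factor_emb :: "bool \<Rightarrow> 'c \<Rightarrow> 'a + 'b" where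
  "factor_emb i u = (if i then Inl (\<phi>1 u) else Inr (\<phi>2 u))"

definition factor_inj :: "bool \<Rightarrow> 'a + 'b \<Rightarrow> ('a, 'b) word set" where
  "factor_inj i = case_sum \<iota>1 \<iota>2"

lemma Inl_hom: "Inl \<in> hom S1 (factor True)" and Inr_hom: "Inr \<in> hom S2 (factor False)"
  by (simp_all add: factor_def copy_hom)

lemma carrier_factor: "carrier (factor i) = (if i then Inl ` carrier S1 else Inr ` carrier S2)"
  by (simp add: factor_def carrier_copy)

lemma inverse_semigroup_factor: "inverse_semigroup (factor i)"
  unfolding factor_def
  by (auto intro: inverse_semigroup_copy S1.inverse_semigroup_axioms S2.inverse_semigroup_axioms)

text \<open>The root of the tree is left open here and chosen in each use, so that either factor can
  be put there.\<close>

lemma lobe_tree_product: "lobe_tree_product U factor factor_emb P factor_inj"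
proof (intro lobe_tree_product.intro lobe_tree.intro lobe_tree_axioms.intro
    lobe_tree_product_axioms.intro)
  show "inverse_semigroup U" "inverse_semigroup P" "inverse_semigroup (factor i)" for i
    by (fact U.inverse_semigroup_axioms inverse_semigroup_product inverse_semigroup_factor)+
  show "factor_emb i \<in> mon U (factor i)" for i
    using emb1 emb2 hom_compose[OF _ Inl_hom, of \<phi>1 U] hom_compose[OF _ Inr_hom, of \<phi>2 U]
    by (cases i) (auto simp: mon_def factor_emb_def[abs_def] inj_on_def comp_def)
  show "factor_inj i \<in> hom (factor i) P" for i
    using inj1_hom inj2_hom
    by (intro homI) (auto simp: carrier_factor factor_inj_def hom_in_carrier hom_mult split: if_splits
        simp flip: hom_mult[OF Inl_hom] hom_mult[OF Inr_hom])
  show "factor_inj i (factor_emb i u) = factor_inj j (factor_emb j u)" if "u \<in> carrier U" for u i j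
    using inj_amalg[OF that] by (simp add: factor_inj_def factor_emb_def)
next
  fix X R
  assume X: "X \<in> carrier P" and one: "\<And>i a. a \<in> carrier (factor i) \<Longrightarrow> R (factor_inj i a)"
    and mult: "\<And>i a X. X \<in> carrier P \<Longrightarrow> R X \<Longrightarrow> a \<in> carrier (factor i) \<Longrightarrow>
      R (X \<otimes>\<^bsub>P\<^esub> factor_inj i a)"
  have letter: "\<exists>i. l \<in> carrier (factor i) \<and> factor_inj i l = C `` {[l]}"
    if "l \<in> carrier S1 <+> carrier S2" for l
    using that by (auto simp: carrier_factor factor_inj_def amalg_inj1_def amalg_inj2_def)
  \<comment> \<open>Words grow at the right end, to match the right multiplication in
    \<open>mult\<close>.\<close>
  have "w \<noteq> [] \<Longrightarrow> set w \<subseteq> carrier S1 <+> carrier S2 \<Longrightarrow> R (C `` {w})" for w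
  proof (induction w rule: rev_nonempty_induct)
    case (single l)
    then show ?case using letter[of l] one by force
  next
    case (snoc l w)
    then have w: "w \<in> W" "[l] \<in> W" by (auto simp: words_def)
    obtain i where "l \<in> carrier (factor i)" "factor_inj i l = C `` {[l]}" using letter[of l] snoc by auto
    then show ?case using mult[of "C `` {w}" l i] snoc w by (simp add: class_in_carrier mult_class)
  qed
  then show "R X" using X by (elim carrier_productE) (simp add: words_def)
next
  fix M :: "bool \<Rightarrow> 'a + 'b \<Rightarrow> ('a + 'b) list rel"
  assume M: "\<And>i. partial_action (factor i) (M i)"
    and MU: "\<And>u i j. u \<in> carrier U \<Longrightarrow> M i (factor_emb i u) = M j (factor_emb j u)"
  let ?M = "case_sum (\<lambda>s. M True (Inl s)) (\<lambda>s. M False (Inr s))"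
  have "\<exists>Q. partial_action P Q \<and> (\<forall>s\<in>carrier S1. Q (\<iota>1 s) = ?M (Inl s)) \<and>
      (\<forall>s\<in>carrier S2. Q (\<iota>2 s) = ?M (Inr s))"
  proof (rule product_action)
    show "partial_action S1 (\<lambda>s. ?M (Inl s))"
      using partial_action_hom[OF S1.inverse_semigroup_axioms inverse_semigroup_factor Inl_hom M] by simp
    show "partial_action S2 (\<lambda>s. ?M (Inr s))"
      using partial_action_hom[OF S2.inverse_semigroup_axioms inverse_semigroup_factor Inr_hom M] by simp
    show "?M (Inl (\<phi>1 u)) = ?M (Inr (\<phi>2 u))" if "u \<in> carrier U" for u
      using MU[OF that, of True False] by (simp add: factor_emb_def)
  qed
  then show "\<exists>Q. partial_action P Q \<and> (\<forall>i. \<forall>a\<in>carrier (factor i). Q (factor_inj i a) = M i a)"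
    by (elim exE) (rule exI, auto simp: carrier_factor factor_inj_def split: if_splits)
qed

text \<open>Three transports are combined: \<open>D\<close> gives an isomorphism from the group at
  \<open>e\<close> to that at the image of \<open>g\<close>, it carries \<open>not_U\<close> over to
  this image, and \<open>max_subgroup_subset\<close> then identifies the group there with the one in
  the factor.\<close>

lemma max_subgroup_cong_factor:
  assumes e: "e \<in> idempotents P" and f: "f \<in> hom S (factor i)" "inj f" "carrier (factor i) = f ` carrier S"
    and S: "inverse_semigroup S"
    and not_U: "\<And>u. u \<in> idempotents U \<Longrightarrow> (e, factor_inj i (factor_emb i u)) \<notin> greenD P"
    and g: "g \<in> idempotents S" and D: "(e, factor_inj i (f g)) \<in> greenD P"
  shows "max_subgroup P e \<cong> max_subgroup S g"
proof -
  interpret lobe_tree_product U factor factor_emb i P factor_inj by (rule lobe_tree_product)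
  have fg: "f g \<in> idempotents (factor i)" using hom_idem[OF f(1) g] .
  have g': "factor_inj i (f g) \<in> idempotents P" using hom_idem[OF \<kappa>_hom fg] .
  have "(factor_inj i (f g), factor_inj i (factor_emb i u)) \<notin> greenD P" if u: "u \<in> idempotents U" for u
    using P.greenD_trans[OF e g' hom_idem[OF \<kappa>_hom hom_idem[OF \<phi>_hom u]] D] not_U[OF u] by blast
  then have "carrier (max_subgroup P (factor_inj i (f g))) \<subseteq> factor_inj i ` carrier (factor i)"
    by (rule max_subgroup_subset[OF fg])
  then have "carrier (max_subgroup P ((factor_inj i \<circ> f) g)) \<subseteq> (factor_inj i \<circ> f) ` carrier S"
    by (simp add: f(3) image_comp)
  moreover have "inj_on (factor_inj i \<circ> f) (carrier S)"
    using \<kappa>_inj f(2,3) by (simp add: comp_inj_on inj_on_subset)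
  ultimately have "max_subgroup S g \<cong> max_subgroup P (factor_inj i (f g))"
    using max_subgroup_cong_hom[OF S P.inverse_semigroup_axioms hom_compose[OF f(1) \<kappa>_hom] _ g] by simp
  then have "max_subgroup P (factor_inj i (f g)) \<cong> max_subgroup S g"
    by (rule group.iso_sym[OF inverse_semigroup.group_max_subgroup[OF S g]])
  with P.max_subgroup_cong_greenD[OF e g' D] show ?thesis by (rule iso_trans)
qed

end

theorem corollary3:
  fixes S1 :: "('a, 'm) monoid_scheme" and S2 :: "('b, 'n) monoid_scheme"
    and U :: "('c, 'k) monoid_scheme"
    and \<phi>1 :: "'c \<Rightarrow> 'a" and \<phi>2 :: "'c \<Rightarrow> 'b"
    and e :: "('a, 'b) word set"
  assumes amalgam: "inverse_semigroup_amalgam S1 S2 U \<phi>1 \<phi>2"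
    and finite1: "finite (carrier S1)" and finite2: "finite (carrier S2)"
    and e: "e \<in> idempotents (amalg_product S1 S2 U \<phi>1 \<phi>2)"
    and not_U: "\<And>u. u \<in> idempotents U \<Longrightarrow>
      (e, amalg_inj1 S1 S2 U \<phi>1 \<phi>2 (\<phi>1 u)) \<notin> greenD (amalg_product S1 S2 U \<phi>1 \<phi>2)"
  shows "(\<forall>g \<in> idempotents S1 - \<phi>1 ` carrier U.
            (e, amalg_inj1 S1 S2 U \<phi>1 \<phi>2 g) \<in> greenD (amalg_product S1 S2 U \<phi>1 \<phi>2) \<longrightarrow>
            max_subgroup (amalg_product S1 S2 U \<phi>1 \<phi>2) e \<cong> max_subgroup S1 g)
       \<and> (\<forall>g \<in> idempotents S2 - \<phi>2 ` carrier U.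
            (e, amalg_inj2 S1 S2 U \<phi>1 \<phi>2 g) \<in> greenD (amalg_product S1 S2 U \<phi>1 \<phi>2) \<longrightarrow>
            max_subgroup (amalg_product S1 S2 U \<phi>1 \<phi>2) e \<cong> max_subgroup S2 g)"
proof (intro conjI ballI impI)
  interpret inverse_semigroup_amalgam S1 S2 U \<phi>1 \<phi>2 by (rule amalgam)
  fix g assume "g \<in> idempotents S1 - \<phi>1 ` carrier U" "(e, \<iota>1 g) \<in> greenD P"
  then show "max_subgroup P e \<cong> max_subgroup S1 g"
    using max_subgroup_cong_factor[OF e Inl_hom _ _ S1.inverse_semigroup_axioms, of g] not_U
    by (simp add: carrier_factor factor_inj_def factor_emb_def)
next
  interpret inverse_semigroup_amalgam S1 S2 U \<phi>1 \<phi>2 by (rule amalgam)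
  fix g assume "g \<in> idempotents S2 - \<phi>2 ` carrier U" "(e, \<iota>2 g) \<in> greenD P"
  \<comment> \<open>\<open>not_U\<close> speaks of \<open>U\<close> through \<open>S1\<close>; the
    identification of both copies of \<open>U\<close> in the product carries it over to
    \<open>S2\<close>.\<close>
  moreover have "(e, \<iota>2 (\<phi>2 u)) \<notin> greenD P" if "u \<in> idempotents U" for u
    using not_U[OF that] inj_amalg[OF U.idem_closed[OF that]] by simp
  ultimately show "max_subgroup P e \<cong> max_subgroup S2 g"
    using max_subgroup_cong_factor[OF e Inr_hom _ _ S2.inverse_semigroup_axioms, of g]
    by (simp add: carrier_factor factor_inj_def factor_emb_def)
qed

end
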